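(* Let $n\ge 2$ be an integer and let $\alpha\in\mathfrak G_n$. Then there exists a permutation unitary $u\in\mathcal P_n$ such that $\alpha=\lambda_u|_{\mathcal D_n}$. Moreover, if $w$ is any unitary in $\mathcal O_n$ such that $\lambda_w|_{\mathcal D_n}=\alpha$, then $\lambda_w\in\mathrm{Aut}(\mathcal O_n)$.
   Context: Let $n\ge 2$. $\mathcal O_n$ is the Cuntz algebra, the $C^*$-algebra generated by isometries $S_1,\dots,S_n$ with $\sum_{i=1}^n S_iS_i^*=1$. For $k\ge 0$, $W_n^k$ is the set of words $\mu=(\mu_1,\dots,\mu_k)$ with letters in $\{1,\dots,n\}$, $S_\mu=S_{\mu_1}\cdots S_{\mu_k}$ (and $S_\emptyset=1$), $P_\mu=S_\mu S_\mu^*$. $\mathcal D_n$ (the diagonal) is the $C^*$-subalgebra generated by all $P_\mu$, and $\mathcal D_n^k=\mathrm{span}\{P_\mu:\mu\in W_n^k\}$. $\mathcal P_n=\bigcup_k\mathcal P_n^k$, where $\mathcal P_n^k$ is the set of unitaries $\sum_{\mu\in W_n^k}S_{\sigma(\mu)}S_\mu^*$ with $\sigma$ a permutation of $W_n^k$. For a unitary $u\in\mathcal O_n$, $\lambda_u$ is the unital $*$-endomorphism of $\mathcal O_n$ with $\lambda_u(S_i)=uS_i$ for all $i$. The canonical shift is $\varphi(x)=\sum_{i=1}^n S_ixS_i^*$; it restricts to an endomorphism of $\mathcal D_n$ (with $\varphi^0=\mathrm{id}$). An automorphism $\alpha$ of $\mathcal D_n$ has property (P) if there is an integer $m\ge 0$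 such that $\alpha\varphi^k(x)=\varphi^{k-m}\alpha\varphi^m(x)$ for all $k\ge m$ and all $x\in\mathcal D_n^1$. $\mathfrak G_n$ is the group of all $\alpha\in\mathrm{Aut}(\mathcal D_n)$ such that both $\alpha$ and $\alpha^{-1}$ have property (P). *)

theory Defs
  imports "HOL-Analysis.Analysis" "HOL-Combinatorics.Permutations"
begin

text \<open>Unital (nonzero) complex \<open>C\<^sup>*\<close>-algebras, on top of the real Banach algebra classes.\<close>

class cstar_algebra = real_normed_algebra_1 + banach +
  fixes scaleC :: "complex \<Rightarrow> 'a \<Rightarrow> 'a"  (infixr \<open>*\<^sub>C\<close> 75)
    and adj :: "'a \<Rightarrow> 'a"
  assumes scaleR_scaleC: "r *\<^sub>R x = complex_of_real r *\<^sub>C x"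
    and scaleC_add_right: "c *\<^sub>C (x + y) = c *\<^sub>C x + c *\<^sub>C y"
    and scaleC_add_left: "(c + d) *\<^sub>C x = c *\<^sub>C x + d *\<^sub>C x"
    and scaleC_scaleC: "c *\<^sub>C (d *\<^sub>C x) = (c * d) *\<^sub>C x"
    and mult_scaleC_left: "(c *\<^sub>C x) * y = c *\<^sub>C (x * y)"
    and mult_scaleC_right: "x * (c *\<^sub>C y) = c *\<^sub>C (x * y)"
    and norm_scaleC: "norm (c *\<^sub>C x) = cmod c * norm x"
    and adj_add: "adj (x + y) = adj x + adj y"
    and adj_scaleC: "adj (c *\<^sub>C x) = cnj c *\<^sub>C adj x"
    and adj_mult: "adj (x * y) = adj y * adj x"
    and adj_adj: "adj (adj x) = x"
    and norm_adj_mult_self: "norm (adj x * x) = (norm x)\<^sup>2"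

definition isometry :: "'a::cstar_algebra \<Rightarrow> bool" where
  "isometry v \<longleftrightarrow> adj v * v = 1"

definition unitary :: "'a::cstar_algebra \<Rightarrow> bool" where
  "unitary u \<longleftrightarrow> adj u * u = 1 \<and> u * adj u = 1"

definition cstar_subalgebra :: "'a::cstar_algebra set \<Rightarrow> bool" where
  "cstar_subalgebra B \<longleftrightarrow> 0 \<in> B \<and> (\<forall>x\<in>B. \<forall>y\<in>B. x + y \<in> B \<and> x * y \<in> B) \<and>
     (\<forall>c. \<forall>x\<in>B. c *\<^sub>C x \<in> B) \<and> (\<forall>x\<in>B. adj x \<in> B) \<and> closed B"

definition cstar_generated :: "'a::cstar_algebra set \<Rightarrow> 'a set" where
  "cstar_generated X = \<Inter>{B. cstar_subalgebra B \<and> X \<subseteq> B}"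

text \<open>*-homomorphisms and *-automorphisms of a subalgebra \<open>B\<close> are represented by functions on the
  ambient type, whose values outside \<open>B\<close> are irrelevant.\<close>

definition star_hom_on :: "'a::cstar_algebra set \<Rightarrow> ('a \<Rightarrow> 'a) \<Rightarrow> bool" where
  "star_hom_on B f \<longleftrightarrow>
     (\<forall>x\<in>B. \<forall>y\<in>B. f (x + y) = f x + f y \<and> f (x * y) = f x * f y) \<and>
     (\<forall>c. \<forall>x\<in>B. f (c *\<^sub>C x) = c *\<^sub>C f x) \<and> (\<forall>x\<in>B. f (adj x) = adj (f x))"

definition star_automorphism_on :: "'a::cstar_algebra set \<Rightarrow> ('a \<Rightarrow> 'a) \<Rightarrow> bool" where
  "star_automorphism_on B f \<longleftrightarrow> star_hom_on B f \<and> bij_betw f B B"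

text \<open>The ambient type, with the family \<open>S 1, \<dots>, S n\<close>, is the Cuntz algebra \<open>\<O>\<^sub>n\<close>. By Cuntz's
  uniqueness theorem every \<open>C\<^sup>*\<close>-algebra of this kind is canonically isomorphic to it. Values of \<open>S\<close>
  outside \<open>{1..n}\<close> are irrelevant.\<close>

definition cuntz_algebra :: "nat \<Rightarrow> (nat \<Rightarrow> 'a::cstar_algebra) \<Rightarrow> bool" where
  "cuntz_algebra n S \<longleftrightarrow> (\<forall>i\<in>{1..n}. isometry (S i)) \<and> (\<Sum>i=1..n. S i * adj (S i)) = 1 \<and>
     cstar_generated (S ` {1..n}) = UNIV"

definition words :: "nat \<Rightarrow> nat \<Rightarrow> nat list set" where
  "words n k = {\<mu>. length \<mu> = k \<and> set \<mu> \<subseteq> {1..n}}"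

definition word_isometry :: "(nat \<Rightarrow> 'a::cstar_algebra) \<Rightarrow> nat list \<Rightarrow> 'a" where
  "word_isometry S \<mu> = prod_list (map S \<mu>)"

definition word_projection :: "(nat \<Rightarrow> 'a::cstar_algebra) \<Rightarrow> nat list \<Rightarrow> 'a" where
  "word_projection S \<mu> = word_isometry S \<mu> * adj (word_isometry S \<mu>)"

definition diagonal :: "nat \<Rightarrow> (nat \<Rightarrow> 'a::cstar_algebra) \<Rightarrow> 'a set" where
  "diagonal n S = cstar_generated (\<Union>k. word_projection S ` words n k)"

definition diagonal_level :: "nat \<Rightarrow> (nat \<Rightarrow> 'a::cstar_algebra) \<Rightarrow> nat \<Rightarrow> 'a set" where
  "diagonal_level n S k = module.span scaleC (word_projection S ` words n k)"

definition permutation_unitaries_level :: "nat \<Rightarrow> (nat \<Rightarrow> 'a::cstar_algebra) \<Rightarrow> nat \<Rightarrow> 'a set" where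
  "permutation_unitaries_level n S k =
     {(\<Sum>\<mu>\<in>words n k. word_isometry S (\<sigma> \<mu>) * adj (word_isometry S \<mu>)) |\<sigma>. \<sigma> permutes words n k}"

definition permutation_unitaries :: "nat \<Rightarrow> (nat \<Rightarrow> 'a::cstar_algebra) \<Rightarrow> 'a set" where
  "permutation_unitaries n S = (\<Union>k. permutation_unitaries_level n S k)"

text \<open>\<open>\<lambda>\<^sub>u\<close>, for unitary \<open>u\<close>: its existence is the universal property of \<open>\<O>\<^sub>n\<close>, and it is unique
  because *-homomorphisms are continuous and the \<open>S i\<close> generate.\<close>

definition cuntz_endomorphism ::
    "nat \<Rightarrow> (nat \<Rightarrow> 'a::cstar_algebra) \<Rightarrow> 'a \<Rightarrow> 'a \<Rightarrow> 'a" where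
  "cuntz_endomorphism n S u =
     (THE f. star_hom_on UNIV f \<and> f 1 = 1 \<and> (\<forall>i\<in>{1..n}. f (S i) = u * S i))"

definition canonical_shift :: "nat \<Rightarrow> (nat \<Rightarrow> 'a::cstar_algebra) \<Rightarrow> 'a \<Rightarrow> 'a" where
  "canonical_shift n S x = (\<Sum>i=1..n. S i * x * adj (S i))"

definition property_P :: "nat \<Rightarrow> (nat \<Rightarrow> 'a::cstar_algebra) \<Rightarrow> ('a \<Rightarrow> 'a) \<Rightarrow> bool" where
  "property_P n S \<alpha> \<longleftrightarrow> (\<exists>m. \<forall>k\<ge>m. \<forall>x\<in>diagonal_level n S 1.
     \<alpha> ((canonical_shift n S ^^ k) x) =
       (canonical_shift n S ^^ (k - m)) (\<alpha> ((canonical_shift n S ^^ m) x)))"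

definition P_automorphisms :: "nat \<Rightarrow> (nat \<Rightarrow> 'a::cstar_algebra) \<Rightarrow> ('a \<Rightarrow> 'a) set" where
  "P_automorphisms n S = {\<alpha>. star_automorphism_on (diagonal n S) \<alpha> \<and>
     property_P n S \<alpha> \<and> property_P n S (inv_into (diagonal n S) \<alpha>)}"

end

theory Submission imports Defs begin

text \<open>
  Existence of \<open>\<lambda>\<^sub>u\<close> is Cuntz's uniqueness theorem, proved here without spectral theory: for a *-polynomial
  \<open>p\<close> in two families \<open>S\<close>, \<open>T\<close> each homogeneous component of \<open>p(T)\<close> has norm at most \<open>\<parallel>p(S)\<parallel>\<close>, as one sees on
  the Hilbert spaces spanned by the \<open>S\<^sub>\<mu>\<close> with \<open>\<mu>\<close> of fixed length. Hence \<open>\<parallel>p(T)\<parallel> \<le> C(p) \<parallel>p(S)\<parallel>\<close>, where \<open>C(p)\<close> is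
  linear in the degree, and passing to the powers of \<open>p\<^sup>* p\<close> gives \<open>\<parallel>p(T)\<parallel> \<le> \<parallel>p(S)\<parallel>\<close>.

  One has \<open>\<alpha> = \<lambda>\<^sub>u\<close> on the diagonal iff \<open>Ad u\<close> agrees there with an automorphism \<open>\<beta>\<close> built from \<open>\<alpha>\<close> and the shift.
  Property (P) of \<open>\<alpha>\<close> and \<open>\<alpha>\<^sup>-\<^sup>1\<close> says that \<open>\<beta>\<close> fixes the range of some power of the shift. So \<open>\<beta>\<close> permutes
  the minimal projections of some level of the diagonal, and \<open>u\<close> is the corresponding permutation unitary.

  If \<open>\<lambda>\<^sub>w\<close> extends \<open>\<alpha>\<close> and \<open>\<lambda>\<^sub>v\<close> extends \<open>\<alpha>\<^sup>-\<^sup>1\<close>, their compositions are the identity on the diagonal. Since the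
  diagonal is maximal abelian, an endomorphism \<open>\<lambda>\<^sub>z\<close> that fixes it has \<open>z\<close> in the diagonal and is inverted
  by \<open>\<lambda>\<close> of \<open>z\<^sup>*\<close>.
\<close>

section \<open>Square roots and contractivity in \<open>C\<^sup>*\<close>-algebras\<close>

text \<open>The obstacle throughout is that everything must be read off from the C*-identity: there
  is neither a Hilbert space to act on, nor functional calculus, nor a gauge action to average over.
  The gauge action in particular would presuppose the universal property. Binomial series supply
  square roots and hence contractivity. Words of one length span spaces on which
  \<open>adj v * w\<close> is a scalar. Vectors of different lengths have non-scalar inner products,
  and compression by the aperiodic word \<open>1...12\<close> removes these.

  Property (P) is used for both \<alpha> and its inverse because \<beta> applies the inverse first
  and \<alpha> afterwards: with enough shifts in the argument, the inverse produces an element that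
  still carries the shifts which \<alpha> requires.

  Maximal commutativity meets a further difficulty. A better polynomial approximant may have many
  more degrees, so small errors in the single degrees need not have a small sum. A Fejer mean whose
  order is fixed before the fine approximant is chosen bounds the number of degrees that
  survive.\<close>

interpretation scaleC: module "scaleC :: complex \<Rightarrow> 'a::cstar_algebra \<Rightarrow> 'a"
proof
  show "1 *\<^sub>C x = x" for x :: 'a by (metis of_real_1 scaleR_one scaleR_scaleC)
qed (simp_all add: scaleC_add_right scaleC_add_left scaleC_scaleC)

lemma scaleC_of_real: "complex_of_real r *\<^sub>C x = r *\<^sub>R (x::'a::cstar_algebra)"
  by (simp add: scaleR_scaleC)

lemma adj_zero [simp]: "adj (0::'a::cstar_algebra) = 0"
  using adj_add[of 0 "0::'a"] by simp

lemma adj_one [simp]: "adj (1::'a::cstar_algebra) = 1"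
  by (metis adj_adj adj_mult mult_1_left mult_1_right)

lemma adj_minus: "adj (- x) = - adj (x::'a::cstar_algebra)"
  by (metis add.right_inverse adj_add adj_zero neg_eq_iff_add_eq_0)

lemma adj_diff: "adj (x - y) = adj x - adj (y::'a::cstar_algebra)"
  by (metis adj_add adj_minus diff_conv_add_uminus)

lemma adj_sum: "adj (sum f A) = (\<Sum>i\<in>A. adj (f i :: 'a::cstar_algebra))"
  by (induction A rule: infinite_finite_induct) (auto simp: adj_add)

lemma adj_scaleR: "adj (r *\<^sub>R x) = r *\<^sub>R adj (x::'a::cstar_algebra)"
  by (simp add: scaleR_scaleC adj_scaleC)

lemma adj_power: "adj (x ^ k) = adj (x::'a::cstar_algebra) ^ k"
  by (induction k) (auto simp: adj_mult power_commutes)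

lemma norm_adj [simp]: "norm (adj x) = norm (x::'a::cstar_algebra)"
proof -
  have *: "norm y \<le> norm (adj y)" for y :: 'a
  proof (cases "y = 0")
    case False
    have "norm y * norm y \<le> norm (adj y) * norm y"
      using norm_mult_ineq[of "adj y" y] by (simp add: norm_adj_mult_self power2_eq_square)
    then show ?thesis using False by simp
  qed simp
  show ?thesis using *[of x] *[of "adj x"] by (simp add: adj_adj)
qed

lemma adj_eq_0_iff [simp]: "adj x = 0 \<longleftrightarrow> x = (0::'a::cstar_algebra)"
  by (metis adj_adj adj_zero)

lemma adj_mult_self_eq_0_iff [simp]: "adj x * x = 0 \<longleftrightarrow> x = (0::'a::cstar_algebra)"
  using norm_adj_mult_self[of x] by auto

lemma norm_mult_adj_self: "norm (x * adj x) = (norm (x::'a::cstar_algebra))\<^sup>2"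
  using norm_adj_mult_self[of "adj x"] by (simp add: adj_adj)

lemma isometry_norm: "isometry v \<Longrightarrow> norm (v::'a::cstar_algebra) = 1"
  using norm_adj_mult_self[of v] norm_ge_zero[of v] by (simp add: isometry_def power2_eq_1_iff)

lemma bounded_linear_adj: "bounded_linear (adj :: 'a::cstar_algebra \<Rightarrow> 'a)"
  by (rule bounded_linear_intro[where K=1]) (auto simp: adj_add adj_scaleR)

lemmas tendsto_adj [tendsto_intros] = bounded_linear.tendsto[OF bounded_linear_adj]

lemma bounded_linear_scaleC: "bounded_linear (scaleC c :: 'a::cstar_algebra \<Rightarrow> 'a)"
  by (rule bounded_linear_intro[where K="cmod c"])
     (auto simp: scaleC.scale_right_distrib scaleR_scaleC scaleC_scaleC norm_scaleC mult_ac)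

lemmas tendsto_scaleC [tendsto_intros] = bounded_linear.tendsto[OF bounded_linear_scaleC]

lemma norm_le_of_isometry:
  assumes "isometry (v::'a::cstar_algebra)"
  shows "norm (adj v * x * v) \<le> norm x"
  using norm_mult_ineq[of "adj v * x" v] norm_mult_ineq[of "adj v" x] isometry_norm[OF assms] by simp

lemma
  assumes "cstar_subalgebra B"
  shows cstar_subalgebra_zero: "0 \<in> B"
    and cstar_subalgebra_add: "x \<in> B \<Longrightarrow> y \<in> B \<Longrightarrow> x + y \<in> B"
    and cstar_subalgebra_mult: "x \<in> B \<Longrightarrow> y \<in> B \<Longrightarrow> x * y \<in> B"
    and cstar_subalgebra_scaleC: "x \<in> B \<Longrightarrow> c *\<^sub>C x \<in> B"
    and cstar_subalgebra_adj: "x \<in> B \<Longrightarrow> adj x \<in> B"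
    and cstar_subalgebra_closed: "closed B"
  using assms by (auto simp: cstar_subalgebra_def)

lemma cstar_subalgebra_UNIV: "cstar_subalgebra UNIV"
  by (simp add: cstar_subalgebra_def)

lemma cstar_subalgebra_scaleR: "cstar_subalgebra B \<Longrightarrow> x \<in> B \<Longrightarrow> r *\<^sub>R x \<in> B"
  by (simp add: scaleR_scaleC cstar_subalgebra_scaleC)

lemma cstar_subalgebra_minus: "cstar_subalgebra B \<Longrightarrow> x \<in> B \<Longrightarrow> - x \<in> B"
  using cstar_subalgebra_scaleR[of B x "-1"] by simp

lemma cstar_subalgebra_diff: "cstar_subalgebra B \<Longrightarrow> x \<in> B \<Longrightarrow> y \<in> B \<Longrightarrow> x - y \<in> B"
  by (metis cstar_subalgebra_add cstar_subalgebra_minus diff_conv_add_uminus)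

lemma cstar_subalgebra_sum: "cstar_subalgebra B \<Longrightarrow> (\<And>i. i \<in> A \<Longrightarrow> f i \<in> B) \<Longrightarrow> sum f A \<in> B"
  by (induction A rule: infinite_finite_induct) (auto simp: cstar_subalgebra_zero cstar_subalgebra_add)

lemma cstar_subalgebra_power: "cstar_subalgebra B \<Longrightarrow> 1 \<in> B \<Longrightarrow> x \<in> B \<Longrightarrow> x ^ k \<in> B"
  by (induction k) (auto simp: cstar_subalgebra_mult)

lemma cstar_subalgebra_generated: "cstar_subalgebra (cstar_generated X)"
  unfolding cstar_subalgebra_def cstar_generated_def by (auto intro!: closed_Inter)

lemma cstar_generated_superset: "X \<subseteq> cstar_generated X"
  unfolding cstar_generated_def by auto

lemma cstar_generated_minimal: "cstar_subalgebra B \<Longrightarrow> X \<subseteq> B \<Longrightarrow> cstar_generated X \<subseteq> B"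
  unfolding cstar_generated_def by auto

text \<open>Lets commutation with projections be tested on generators; taking adjoints of
  \<open>x * y = y * x\<close> stays within the condition because each \<open>y\<close> is
  self-adjoint.\<close>

lemma cstar_subalgebra_commutant:
  fixes Y :: "'a::cstar_algebra set"
  assumes "\<And>y. y \<in> Y \<Longrightarrow> adj y = y"
  shows "cstar_subalgebra {x. \<forall>y\<in>Y. x * y = y * x}"
proof -
  have "closed {x. \<forall>y\<in>Y. x * y = y * x}"
  proof -
    have "closed {x. x * y = y * x}" for y :: 'a
      by (intro closed_Collect_eq continuous_intros)
    then have "closed (\<Inter>y\<in>Y. {x. x * y = y * x})" by blast
    moreover have "(\<Inter>y\<in>Y. {x. x * y = y * x}) = {x. \<forall>y\<in>Y. x * y = y * x}" by auto
    ultimately show ?thesis by simp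
  qed
  moreover have "adj x * y = y * adj x" if "x * y = y * x" "y \<in> Y" for x y
    using arg_cong[OF that(1), of adj] assms[OF that(2)] by (simp add: adj_mult)
  moreover have "(x * x') * y = y * (x * x')" if "x * y = y * x" "x' * y = y * x'" for x x' y :: 'a
    by (metis mult.assoc that)
  ultimately show ?thesis
    unfolding cstar_subalgebra_def
    by (auto simp: distrib_left distrib_right mult_scaleC_left mult_scaleC_right)
qed

text \<open>This is the power series identity \<open>(1 + x)^(1/2) * (1 + x)^(1/2) = 1 + x\<close>,
  read off from Vandermonde at \<open>1/2 + 1/2\<close>.\<close>

lemma gbinomial_half_convolution:
  "(\<Sum>i\<le>k. ((1/2) gchoose i) * ((1/2::real) gchoose (k - i))) = (if k \<le> 1 then 1 else 0)"
proof -
  have "(\<Sum>i\<le>k. ((1/2) gchoose i) * ((1/2::real) gchoose (k - i))) = (1 gchoose k)"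
    using gbinomial_Vandermonde[of "1/2::real" "1/2" k] by (simp add: atMost_atLeast0)
  also have "\<dots> = of_nat (1 choose k)"
    using binomial_gbinomial[of 1 k, where 'a=real] by simp
  also have "\<dots> = (if k \<le> 1 then 1 else 0)"
    by (cases k) (auto simp: binomial_eq_0)
  finally show ?thesis .
qed

text \<open>The partial sums of the binomial series of \<open>(1 - t)^(1/2)\<close> are real
  polynomials in \<open>t\<close>, so the limit stays in the closed algebra \<open>B\<close>, is
  self-adjoint and commutes with whatever commutes with \<open>t\<close>. This stands in for the
  functional calculus.\<close>

lemma selfadjoint_sqrt:
  fixes t :: "'a::cstar_algebra"
  assumes B: "cstar_subalgebra B" "1 \<in> B" "t \<in> B" and t: "adj t = t" "norm t < 1"
  obtains k where "k \<in> B" "adj k = k" "k * k = 1 - t" "\<And>y. y * t = t * y \<Longrightarrow> y * k = k * y"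
proof -
  define c where "c j = ((1/2::real) gchoose j) * (-1) ^ j" for j
  define a where "a j = c j *\<^sub>R t ^ j" for j
  \<comment> \<open>An intermediate radius: convergence of the scalar series at \<open>z\<close>
    gives absolute convergence at the smaller \<open>norm t\<close>.\<close>
  obtain z where z: "norm t < z" "z < 1" using dense t(2) by blast
  have "0 < z" using z(1) norm_ge_zero[of t] by linarith
  have "summable (\<lambda>j. ((1/2::real) gchoose j) * z ^ j)"
    using gen_binomial_real[of z "1/2"] z \<open>0 < z\<close> by (auto simp: sums_iff)
  then have "summable (\<lambda>j. norm (((1/2::real) gchoose j) * (norm t) ^ j))"
    by (rule powser_insidea) (use z \<open>0 < z\<close> in auto)
  then have sn: "summable (\<lambda>j. norm (a j))"
  proof (rule summable_comparison_test'[where N=0])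
    fix j show "norm (norm (a j)) \<le> norm (((1/2::real) gchoose j) * (norm t) ^ j)"
      by (auto simp: a_def c_def abs_mult intro!: mult_left_mono norm_power_ineq)
  qed
  then have sa: "summable a" by (rule summable_norm_cancel)
  have conv: "(\<Sum>i\<le>k. a i * a (k - i)) = (if k = 0 then 1 else if k = 1 then - t else 0)" for k
  proof -
    have "(\<Sum>i\<le>k. a i * a (k - i)) = (\<Sum>i\<le>k. (((1/2) gchoose i) * ((1/2::real) gchoose (k - i)) * (-1) ^ k) *\<^sub>R t ^ k)"
    proof (rule sum.cong)
      fix i assume "i \<in> {..k}"
      then have "i + (k - i) = k" by simp
      then have e: "(-1) ^ k = (-1::real) ^ i * (-1) ^ (k - i)" "t ^ k = t ^ i * t ^ (k - i)"
        by (metis power_add)+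
      show "a i * a (k - i) = (((1/2) gchoose i) * ((1/2::real) gchoose (k - i)) * (-1) ^ k) *\<^sub>R t ^ k"
        unfolding e by (simp add: a_def c_def mult_ac)
    qed simp
    also have "\<dots> = ((if k \<le> 1 then 1 else 0) * (-1) ^ k) *\<^sub>R t ^ k"
      by (simp only: gbinomial_half_convolution[symmetric] sum_distrib_right scaleR_left.sum)
    also have "\<dots> = (if k = 0 then 1 else if k = 1 then - t else 0)" by (cases "k = 0"; cases "k = 1") auto
    finally show ?thesis .
  qed
  let ?k = "suminf a"
  have "(\<lambda>k. \<Sum>i\<le>k. a i * a (k - i)) sums (?k * ?k)"
    by (rule Cauchy_product_sums[OF sn sn])
  moreover have "(\<lambda>k. \<Sum>i\<le>k. a i * a (k - i)) sums (1 - t)"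
    unfolding conv using sums_finite[of "{0,1}" "\<lambda>k. if k = 0 then 1 else if k = 1 then - t else 0"] by simp
  ultimately have sq: "?k * ?k = 1 - t" by (rule sums_unique2)
  have "a j \<in> B" for j
    unfolding a_def by (intro cstar_subalgebra_scaleR cstar_subalgebra_power B)
  then have "(\<Sum>j<m. a j) \<in> B" for m by (intro cstar_subalgebra_sum B)
  then have kB: "?k \<in> B"
    by (rule closed_sequentially[OF cstar_subalgebra_closed[OF B(1)] _ summable_LIMSEQ[OF sa]])
  have "adj (a j) = a j" for j by (simp add: a_def adj_scaleR adj_power t)
  then have adjk: "adj ?k = ?k"
    using bounded_linear.suminf[OF bounded_linear_adj sa] by simp
  have comm: "y * ?k = ?k * y" if "y * t = t * y" for y
  proof -
    have "y * t ^ j = t ^ j * y" for j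
      using power_commuting_commutes[OF that[symmetric], of j] by simp
    then have "y * a j = a j * y" for j by (simp add: a_def)
    then show ?thesis using suminf_mult[OF sa, of y] suminf_mult2[OF sa, of y] by simp
  qed
  show thesis using that[OF kB adjk sq comm] by blast
qed

text \<open>\<open>h\<close> is the real part of \<open>u = h + i k\<close>, and
  \<open>adj u * u = h * h + k * k\<close> since \<open>h\<close> and \<open>k\<close> commute. This
  plays the role of monotonicity of the norm on positive elements.\<close>

lemma norm_selfadjoint_le:
  fixes h k :: "'a::cstar_algebra"
  assumes "adj h = h" "adj k = k" "h * k = k * h"
  shows "(norm h)\<^sup>2 \<le> norm (h * h + k * k)"
proof -
  let ?u = "h + \<i> *\<^sub>C k"
  have a: "adj ?u = h - \<i> *\<^sub>C k" using assms by (simp add: adj_add adj_scaleC)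
  have "adj ?u * ?u = h * h + k * k"
    unfolding a using assms(3)
    by (simp add: algebra_simps mult_scaleC_left mult_scaleC_right scaleC_scaleC)
  then have n: "norm (h * h + k * k) = (norm ?u)\<^sup>2" by (metis norm_adj_mult_self)
  have "2 * norm h = norm (?u + adj ?u)" unfolding a by (simp add: scaleR_2[symmetric])
  also have "\<dots> \<le> norm ?u + norm (adj ?u)" by (rule norm_triangle_ineq)
  finally have "norm h \<le> norm ?u" by simp
  then show ?thesis unfolding n by (rule power_mono) simp
qed

text \<open>For self-adjoint \<open>a\<close> with \<open>norm a < 1\<close> and \<open>k\<close> a
  square root of \<open>1 - a * a\<close> in \<open>B\<close>, the identity
  \<open>a * a + k * k = 1\<close> is carried over by \<open>f\<close>, and
  \<open>norm_selfadjoint_le\<close> bounds \<open>f a\<close> by 1. Scaling and passing to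
  \<open>adj x * x\<close> give the rest.\<close>

lemma star_hom_contractive:
  fixes f :: "'a::cstar_algebra \<Rightarrow> 'a"
  assumes B: "cstar_subalgebra B" "1 \<in> B" and f: "star_hom_on B f" "f 1 = 1" and x: "x \<in> B"
  shows "norm (f x) \<le> norm x"
proof -
  have fadd: "f (a + b) = f a + f b" and fmult: "f (a * b) = f a * f b" if "a \<in> B" "b \<in> B" for a b
    using f(1) that by (auto simp: star_hom_on_def)
  have fsc: "f (c *\<^sub>C a) = c *\<^sub>C f a" and fadj: "f (adj a) = adj (f a)" if "a \<in> B" for a c
    using f(1) that by (auto simp: star_hom_on_def)
  have unit: "norm (f a) \<le> 1" if a: "a \<in> B" "adj a = a" "norm a < 1" for a
  proof -
    have "norm (a * a) < 1"
      using norm_adj_mult_self[of a] a by (simp add: power_less_one_iff)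
    moreover have "a * a \<in> B" "adj (a * a) = a * a" using a B by (auto simp: cstar_subalgebra_mult adj_mult)
    ultimately obtain k where k: "k \<in> B" "adj k = k" "k * k = 1 - a * a"
      and comm: "\<And>y. y * (a * a) = (a * a) * y \<Longrightarrow> y * k = k * y"
      using selfadjoint_sqrt[OF B, of "a * a"] by blast
    have "a * k = k * a" by (rule comm) (simp add: mult.assoc)
    then have "f a * f k = f k * f a" using fmult a k by metis
    moreover have "adj (f a) = f a" "adj (f k) = f k" using fadj a k by metis+
    ultimately have "(norm (f a))\<^sup>2 \<le> norm (f a * f a + f k * f k)" by (intro norm_selfadjoint_le)
    also have "f a * f a + f k * f k = f (a * a + k * k)"
      using a k(1) B by (simp only: fadd fmult cstar_subalgebra_mult)
    also have "\<dots> = 1" using k f by simp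
    finally show ?thesis by (simp add: power_le_one_iff abs_square_le_1)
  qed
  have sa: "norm (f a) \<le> norm a" if a: "a \<in> B" "adj a = a" for a
  proof (rule field_le_epsilon)
    fix e :: real assume "0 < e"
    define r where "r = norm a + e"
    have r: "r > 0" using \<open>0 < e\<close> norm_ge_zero[of a] by (simp add: r_def add_nonneg_pos)
    let ?b = "(1 / r) *\<^sub>R a"
    have "norm (f ?b) \<le> 1"
      using a B r \<open>0 < e\<close> by (intro unit) (auto simp: cstar_subalgebra_scaleR adj_scaleR r_def)
    moreover have "f ?b = (1 / r) *\<^sub>R f a"
      using fsc[OF a(1), of "complex_of_real (1 / r)"] by (simp only: scaleC_of_real)
    ultimately have "norm (f a) \<le> r" using r by (simp add: field_simps)
    then show "norm (f a) \<le> norm a + e" by (simp add: r_def)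
  qed
  have "(norm (f x))\<^sup>2 = norm (f (adj x * x))"
    using x B by (simp add: fmult fadj cstar_subalgebra_adj norm_adj_mult_self)
  also have "\<dots> \<le> norm (adj x * x)"
    using x B by (intro sa) (auto simp: cstar_subalgebra_mult cstar_subalgebra_adj adj_mult adj_adj)
  also have "\<dots> = (norm x)\<^sup>2" by (rule norm_adj_mult_self)
  finally show ?thesis by (rule power2_le_imp_le) simp
qed

lemma star_hom_on_diff:
  fixes f :: "'a::cstar_algebra \<Rightarrow> 'a"
  assumes "cstar_subalgebra B" "star_hom_on B f" "x \<in> B" "y \<in> B"
  shows "f (x - y) = f x - f y"
proof -
  have "f (x - y + y) = f (x - y) + f y"
    using assms(2,4) cstar_subalgebra_diff[OF assms(1,3,4)] unfolding star_hom_on_def by blast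
  then show ?thesis by simp
qed

lemma star_hom_on_zero:
  fixes f :: "'a::cstar_algebra \<Rightarrow> 'a"
  assumes "cstar_subalgebra B" "star_hom_on B f"
  shows "f 0 = 0"
  using star_hom_on_diff[OF assms cstar_subalgebra_zero cstar_subalgebra_zero] assms by simp

lemma star_hom_on_sum:
  fixes f :: "'a::cstar_algebra \<Rightarrow> 'a"
  assumes "cstar_subalgebra B" "star_hom_on B f" "\<And>i. i \<in> A \<Longrightarrow> g i \<in> B"
  shows "f (sum g A) = (\<Sum>i\<in>A. f (g i))"
  using assms(3)
proof (induction A rule: infinite_finite_induct)
  case (insert i A)
  have "sum g A \<in> B" using insert.prems by (intro cstar_subalgebra_sum assms(1)) auto
  then show ?case using insert assms(2) by (simp add: star_hom_on_def)
qed (simp_all add: star_hom_on_zero[OF assms(1,2)])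

text \<open>The set of agreement is a C*-subalgebra. Its closedness comes from contractivity on the
  generated algebra, as the values of \<open>f\<close> and \<open>g\<close> elsewhere are
  arbitrary.\<close>

lemma star_hom_agree:
  fixes f g :: "'a::cstar_algebra \<Rightarrow> 'a"
  assumes "1 \<in> cstar_generated X"
    and f: "star_hom_on (cstar_generated X) f" "f 1 = 1"
    and g: "star_hom_on (cstar_generated X) g" "g 1 = 1"
    and eq: "\<And>x. x \<in> X \<Longrightarrow> f x = g x" and x: "x \<in> cstar_generated X"
  shows "f x = g x"
proof -
  let ?B = "cstar_generated X"
  note B = cstar_subalgebra_generated[of X]
  have "closed {x\<in>?B. f x = g x}"
  proof (subst closed_sequential_limits, intro allI impI)
    fix xs l assume xs: "(\<forall>m. xs m \<in> {x\<in>?B. f x = g x}) \<and> xs \<longlonglongrightarrow> l"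
    then have lB: "l \<in> ?B" using closed_sequentially[OF cstar_subalgebra_closed[OF B]] by blast
    have *: "norm (f l - g l) \<le> 2 * norm (l - xs m)" for m
    proof -
      have m: "xs m \<in> ?B" "f (xs m) = g (xs m)" using xs by auto
      then have "f l - g l = f (l - xs m) - g (l - xs m)"
        using star_hom_on_diff[OF B f(1) lB m(1)] star_hom_on_diff[OF B g(1) lB m(1)] by simp
      also have "norm \<dots> \<le> norm (f (l - xs m)) + norm (g (l - xs m))" by (rule norm_triangle_ineq4)
      also have "\<dots> \<le> norm (l - xs m) + norm (l - xs m)"
        using m lB B assms(1) f g by (intro add_mono star_hom_contractive[OF B]) (auto simp: cstar_subalgebra_diff)
      finally show ?thesis by simp
    qed
    have "(\<lambda>m. 2 * norm (l - xs m)) \<longlonglongrightarrow> 2 * norm (l - l)" using xs by (intro tendsto_intros) auto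
    then have "norm (f l - g l) \<le> 2 * norm (l - l)"
      by (rule LIMSEQ_le_const) (use * in auto)
    then show "l \<in> {x\<in>?B. f x = g x}" using lB by simp
  qed
  then have "cstar_subalgebra {x\<in>?B. f x = g x}"
    using B f(1) g(1) star_hom_on_zero[OF B f(1)] star_hom_on_zero[OF B g(1)]
    unfolding cstar_subalgebra_def star_hom_on_def by auto
  moreover have "X \<subseteq> {x\<in>?B. f x = g x}" using eq cstar_generated_superset by auto
  ultimately show ?thesis using cstar_generated_minimal x by blast
qed

text \<open>If \<open>r > s\<close>, then \<open>(r / s) ^ (2 ^ k)\<close> outgrows every multiple
  of \<open>2 ^ k\<close>. This removes a constant from a norm estimate once it is known for
  iterated squares.\<close>

lemma le_of_powers_le:
  fixes r s C :: real
  assumes "0 \<le> r" "0 \<le> s" and le: "\<And>k::nat. r ^ (2 ^ k) \<le> C * 2 ^ k * s ^ (2 ^ k)"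
  shows "r \<le> s"
proof (rule ccontr)
  assume "\<not> r \<le> s"
  show False
  proof (cases "s = 0")
    case True
    then show False using le[of 0] \<open>\<not> r \<le> s\<close> assms by auto
  next
    case False
    then have s: "s > 0" using assms by simp
    define d where "d = r / s - 1"
    have d: "d > 0" using \<open>\<not> r \<le> s\<close> s by (simp add: d_def)
    have b: "(1 + d) ^ (2 ^ k) \<le> C * 2 ^ k" for k
      using le[of k] s by (simp add: d_def power_divide field_simps)
    \<comment> \<open>Bernoulli's bound is only linear in \<open>2 ^ k\<close>, like the right-hand
      side; squaring it passes to the exponent \<open>2 ^ Suc k\<close> and makes it
      quadratic.\<close>
    have "2 ^ k * d\<^sup>2 \<le> 2 * C" for k :: nat
    proof -
      have "2 ^ k * d \<le> (1 + d) ^ (2 ^ k)"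
        using Bernoulli_inequality[of d "2 ^ k"] d by simp
      then have "(2 ^ k * d)\<^sup>2 \<le> ((1 + d) ^ (2 ^ k))\<^sup>2" using d by (intro power_mono) auto
      also have "\<dots> = (1 + d) ^ (2 ^ Suc k)" by (simp add: power_mult[symmetric] mult.commute)
      also have "\<dots> \<le> C * 2 ^ Suc k" by (rule b)
      finally have "2 ^ k * (2 ^ k * d\<^sup>2) \<le> 2 ^ k * (2 * C)" by (simp add: power2_eq_square mult_ac)
      then show ?thesis by simp
    qed
    moreover obtain k :: nat where "2 * C / d\<^sup>2 < 2 ^ k" using real_arch_pow[of 2] by auto
    moreover have "2 * C < 2 ^ k * d\<^sup>2" if "2 * C / d\<^sup>2 < 2 ^ k" for k :: nat
      using that d by (simp add: pos_divide_less_eq)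
    ultimately show False using linorder_not_le by blast
  qed
qed

text \<open>By the first orthogonality, squaring the sum leaves only the terms
  \<open>adj (b i) * b i\<close>; by the second these are orthogonal again, with the square of
  \<open>L\<close> as bound. After \<open>k\<close> rounds the triangle inequality costs no more
  than the fixed factor \<open>card I\<close>.\<close>

lemma norm_orthogonal_sum_le:
  fixes b :: "'i \<Rightarrow> 'a::cstar_algebra"
  assumes fin: "finite I" and L: "0 \<le> L"
    and orth: "\<And>i j. i \<in> I \<Longrightarrow> j \<in> I \<Longrightarrow> i \<noteq> j \<Longrightarrow> adj (b i) * b j = 0"
      "\<And>i j. i \<in> I \<Longrightarrow> j \<in> I \<Longrightarrow> i \<noteq> j \<Longrightarrow> b i * adj (b j) = 0"
    and bd: "\<And>i. i \<in> I \<Longrightarrow> norm (b i) \<le> L"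
  shows "norm (sum b I) \<le> L"
proof -
  have "norm (sum b I) ^ (2 ^ k) \<le> card I * L ^ (2 ^ k)" for k
    using L orth bd
  proof (induction k arbitrary: b L)
    case 0
    have "norm (sum b I) \<le> (\<Sum>i\<in>I. L)" by (rule sum_norm_le) (use 0 in auto)
    then show ?case by simp
  next
    case (Suc k)
    let ?h = "\<lambda>i. adj (b i) * b i"
    have "adj (sum b I) * sum b I = (\<Sum>i\<in>I. \<Sum>j\<in>I. adj (b i) * b j)"
      by (simp add: adj_sum sum_product)
    also have "\<dots> = (\<Sum>i\<in>I. \<Sum>j\<in>I. if j = i then ?h i else 0)"
      using Suc.prems(2) by (intro sum.cong) auto
    also have "\<dots> = sum ?h I" using fin by simp
    finally have e: "norm (sum ?h I) = (norm (sum b I))\<^sup>2" by (metis norm_adj_mult_self)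
    have z: "?h i * ?h j = 0" if "i \<in> I" "j \<in> I" "i \<noteq> j" for i j
    proof -
      have "?h i * ?h j = adj (b i) * (b i * adj (b j)) * b j" by (simp only: mult.assoc)
      then show ?thesis using Suc.prems(3)[OF that] by simp
    qed
    have "norm (sum ?h I) ^ (2 ^ k) \<le> card I * (L\<^sup>2) ^ (2 ^ k)"
      using Suc.prems by (intro Suc.IH) (auto simp: z adj_mult adj_adj norm_adj_mult_self intro!: power_mono)
    then show ?case unfolding e by (simp add: power_mult[symmetric] mult.commute)
  qed
  moreover have "card I * L ^ (2 ^ k) \<le> real (card I) * 2 ^ k * L ^ (2 ^ k)" for k :: nat
    using L by (intro mult_right_mono) (auto simp: mult_le_cancel_left1)
  ultimately have "norm (sum b I) ^ (2 ^ k) \<le> real (card I) * 2 ^ k * L ^ (2 ^ k)" for k :: nat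
    by (rule order_trans)
  then show ?thesis by (rule le_of_powers_le[OF norm_ge_zero L])
qed

section \<open>Words in Cuntz isometries\<close>

lemma norm_projection_le:
  fixes q :: "'a::cstar_algebra"
  assumes "adj q = q" "q * q = q"
  shows "norm q \<le> 1"
proof -
  have "(norm q)\<^sup>2 = norm q" using norm_adj_mult_self[of q] assms by simp
  then show ?thesis by (auto simp: power2_eq_square)
qed

text \<open>The norm bounds say that both \<open>b\<close> and \<open>- b\<close> are positive.\<close>

lemma selfadjoint_eq_0:
  fixes b :: "'a::cstar_algebra"
  assumes b: "adj b = b" and le: "norm (1 - b) \<le> 1" "norm (m *\<^sub>R 1 + b) \<le> m"
  shows "b = 0"
proof -
  have m: "0 \<le> m" using le(2) norm_ge_zero order_trans by blast
  have "norm b \<le> 3 * e" if e: "e > 0" for e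
  proof -
    \<comment> \<open>Chosen so that rescaled roots of \<open>1 - t\<close> and
      \<open>1 - t'\<close> become square roots of \<open>b + e\<close> and \<open>e - b\<close>,
      whose squares add up to \<open>2 * e\<close>. The added \<open>e\<close> makes both norms
      strictly less than 1, as the binomial series demands.\<close>
    define t where "t = (1 / (1 + e)) *\<^sub>R (1 - b)"
    define t' where "t' = (1 / (m + e)) *\<^sub>R (m *\<^sub>R 1 + b)"
    have t: "adj t = t" "adj t' = t'" using b by (auto simp: t_def t'_def adj_scaleR adj_diff adj_add)
    have "norm t < 1" "norm t' < 1" using e le m by (auto simp: t_def t'_def divide_simps)
    then obtain k0 l0 where k0: "adj k0 = k0" "k0 * k0 = 1 - t" "\<And>y. y * t = t * y \<Longrightarrow> y * k0 = k0 * y"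
      and l0: "adj l0 = l0" "l0 * l0 = 1 - t'" "\<And>y. y * t' = t' * y \<Longrightarrow> y * l0 = l0 * y"
      using selfadjoint_sqrt[OF cstar_subalgebra_UNIV UNIV_I UNIV_I t(1)]
        selfadjoint_sqrt[OF cstar_subalgebra_UNIV UNIV_I UNIV_I t(2)] by metis
    have "b * l0 = l0 * b" by (rule l0) (simp add: t'_def algebra_simps)
    then have "l0 * t = t * l0" by (simp add: t_def algebra_simps)
    then have comm: "l0 * k0 = k0 * l0" by (rule k0)
    define k where "k = sqrt (1 + e) *\<^sub>R k0"
    define l where "l = sqrt (m + e) *\<^sub>R l0"
    have "k * k = (1 + e) *\<^sub>R (1 - t)" using e by (simp add: k_def k0(2))
    also have "\<dots> = b + e *\<^sub>R 1" using e by (simp add: t_def scaleR_diff_right algebra_simps)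
    finally have kk: "k * k = b + e *\<^sub>R 1" .
    have "l * l = (m + e) *\<^sub>R (1 - t')" using e m by (simp add: l_def l0(2))
    also have "\<dots> = e *\<^sub>R 1 - b" using e m
      by (simp add: t'_def scaleR_diff_right) (simp add: algebra_simps)
    finally have ll: "l * l = e *\<^sub>R 1 - b" .
    have "(norm k)\<^sup>2 \<le> norm (k * k + l * l)"
      by (rule norm_selfadjoint_le) (auto simp: k_def l_def adj_scaleR k0 l0 comm)
    also have "k * k + l * l = (2 * e) *\<^sub>R 1" by (simp add: kk ll scaleR_add_left[symmetric])
    finally have "(norm k)\<^sup>2 \<le> 2 * e" using e by simp
    moreover have "(norm k)\<^sup>2 = norm (b + e *\<^sub>R 1)"
    proof -
      have "adj k = k" by (simp add: k_def adj_scaleR k0(1))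
      then show ?thesis using norm_adj_mult_self[of k] by (simp only: kk)
    qed
    moreover have "norm b \<le> norm (b + e *\<^sub>R 1) + norm (e *\<^sub>R (1::'a))"
      by (metis add_diff_cancel_right' norm_triangle_ineq4)
    ultimately show ?thesis using e by simp
  qed
  then have "norm b \<le> 0 + e" if "e > 0" for e using that[THEN divide_pos_pos[of _ 3]] by fastforce
  then show ?thesis using field_le_epsilon[of "norm b" 0] by simp
qed

section \<open>Words of fixed length as matrix units and as orthonormal vectors\<close>

lemma finite_words [simp]: "finite (words n k)"
  unfolding words_def using finite_lists_length_eq[of "{1..n}" k] by (simp add: conj_commute)

lemma words_0 [simp]: "words n 0 = {[]}"
  by (auto simp: words_def)

lemma length_words: "\<mu> \<in> words n k \<Longrightarrow> length \<mu> = k"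
  by (simp add: words_def)

lemma Cons_words_iff [simp]: "i # \<mu> \<in> words n (Suc k) \<longleftrightarrow> i \<in> {1..n} \<and> \<mu> \<in> words n k"
  by (auto simp: words_def)

lemma append_words: "\<mu> \<in> words n j \<Longrightarrow> \<nu> \<in> words n k \<Longrightarrow> \<mu> @ \<nu> \<in> words n (j + k)"
  by (auto simp: words_def)

lemma take_words: "\<mu> \<in> words n (j + k) \<Longrightarrow> take j \<mu> \<in> words n j"
  using set_take_subset[of j \<mu>] by (auto simp: words_def)

lemma drop_words: "\<mu> \<in> words n (j + k) \<Longrightarrow> drop j \<mu> \<in> words n k"
  using set_drop_subset[of j \<mu>] by (auto simp: words_def)

lemma sum_words_add: "(\<Sum>\<mu>\<in>words n (j + k). f \<mu>) = (\<Sum>\<mu>\<in>words n j. \<Sum>\<nu>\<in>words n k. f (\<mu> @ \<nu>))"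
proof -
  have "(\<Sum>\<mu>\<in>words n j. \<Sum>\<nu>\<in>words n k. f (\<mu> @ \<nu>)) = (\<Sum>(\<mu>, \<nu>)\<in>words n j \<times> words n k. f (\<mu> @ \<nu>))"
    by (simp add: sum.cartesian_product)
  also have "\<dots> = (\<Sum>\<mu>\<in>words n (j + k). f \<mu>)"
    by (rule sum.reindex_bij_witness[where j="\<lambda>(\<mu>, \<nu>). \<mu> @ \<nu>" and i="\<lambda>\<mu>. (take j \<mu>, drop j \<mu>)"])
       (auto simp: append_words take_words drop_words length_words)
  finally show ?thesis by simp
qed

lemma sum_words_1: "(\<Sum>\<mu>\<in>words n (Suc 0). f \<mu>) = (\<Sum>i=1..n. f [i])"
proof -
  have "words n (Suc 0) = (\<lambda>i. [i]) ` {1..n}" by (auto simp: words_def length_Suc_conv)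
  then show ?thesis by (simp add: sum.reindex inj_on_def)
qed

lemma sum_words_Suc: "(\<Sum>\<mu>\<in>words n (Suc k). f \<mu>) = (\<Sum>i=1..n. \<Sum>\<mu>\<in>words n k. f (i # \<mu>))"
  using sum_words_add[of f n "Suc 0" k] by (simp add: sum_words_1)

lemma word_isometry_Nil [simp]: "word_isometry S [] = 1"
  by (simp add: word_isometry_def)

lemma word_isometry_Cons [simp]: "word_isometry S (i # \<mu>) = S i * word_isometry S \<mu>"
  by (simp add: word_isometry_def)

lemma word_isometry_append: "word_isometry S (\<mu> @ \<nu>) = word_isometry S \<mu> * word_isometry S \<nu>"
  by (simp add: word_isometry_def)

text \<open>Fixing both word lengths turns products into matrix products, and \<open>a - b\<close>
  is the degree under the gauge action.\<close>

definition word_mat ::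
    "nat \<Rightarrow> (nat \<Rightarrow> 'a::cstar_algebra) \<Rightarrow> nat \<Rightarrow> nat \<Rightarrow> (nat list \<Rightarrow> nat list \<Rightarrow> complex) \<Rightarrow> 'a" where
  "word_mat n S a b c = (\<Sum>\<mu>\<in>words n a. \<Sum>\<nu>\<in>words n b. c \<mu> \<nu> *\<^sub>C (word_isometry S \<mu> * adj (word_isometry S \<nu>)))"

text \<open>A finite-dimensional Hilbert space inside the algebra: its norm is the Euclidean norm of
  the coefficients \<open>v\<close>.\<close>

definition word_vec :: "nat \<Rightarrow> (nat \<Rightarrow> 'a::cstar_algebra) \<Rightarrow> nat \<Rightarrow> (nat list \<Rightarrow> complex) \<Rightarrow> 'a" where
  "word_vec n S a v = (\<Sum>\<mu>\<in>words n a. v \<mu> *\<^sub>C word_isometry S \<mu>)"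

text \<open>Coefficients of the same element written with words that are longer by \<open>j\<close>, using \<open>\<Sum>\<^sub>\<mu> S\<^sub>\<mu> S\<^sub>\<mu>\<^sup>* = 1\<close>.\<close>

definition raise_coeffs :: "nat \<Rightarrow> nat \<Rightarrow> (nat list \<Rightarrow> nat list \<Rightarrow> complex) \<Rightarrow> nat list \<Rightarrow> nat list \<Rightarrow> complex" where
  "raise_coeffs a b c \<mu> \<nu> = (if drop a \<mu> = drop b \<nu> then c (take a \<mu>) (take b \<nu>) else 0)"

locale cuntz_family =
  fixes n :: nat and S :: "nat \<Rightarrow> 'a::cstar_algebra"
  assumes two_le: "2 \<le> n"
    and isom: "i \<in> {1..n} \<Longrightarrow> isometry (S i)"
    and ranges: "(\<Sum>i=1..n. S i * adj (S i)) = 1"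
begin

abbreviation "sw \<equiv> word_isometry S"
abbreviation "W \<equiv> words n"
abbreviation "wmat \<equiv> word_mat n S"
abbreviation "wvec \<equiv> word_vec n S"

lemma adj_mult_same [simp]: "1 \<le> i \<Longrightarrow> i \<le> n \<Longrightarrow> adj (S i) * S i = 1"
  using isom[of i] by (auto simp: isometry_def)

text \<open>Sandwiching \<open>\<Sum>\<^sub>j S\<^sub>j S\<^sub>j\<^sup>* = 1\<close> between \<open>S\<^sub>i\<^sup>*\<close> and \<open>S\<^sub>i\<close> leaves positive elements with sum zero.\<close>

lemma adj_mult_distinct:
  assumes "i \<in> {1..n}" "j \<in> {1..n}" "i \<noteq> j"
  shows "adj (S j) * S i = 0"
proof -
  define b where "b k = adj (S i) * (S k * adj (S k)) * S i" for k
  have sa: "adj (b k) = b k" for k by (simp add: b_def adj_mult adj_adj mult.assoc)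
  have bn: "norm (1 - b k) \<le> 1" if k: "k \<in> {1..n}" for k
  proof -
    let ?q = "1 - S k * adj (S k)"
    have p: "(S k * adj (S k)) * (S k * adj (S k)) = S k * adj (S k)"
      using k by (metis adj_mult_same atLeastAtMost_iff mult.assoc mult_1_left)
    have "norm ?q \<le> 1"
      by (rule norm_projection_le) (auto simp: adj_diff adj_mult adj_adj algebra_simps p[unfolded mult.assoc])
    moreover have "1 - b k = adj (S i) * ?q * S i" using assms by (simp add: b_def algebra_simps)
    ultimately show ?thesis using norm_le_of_isometry[OF isom[OF assms(1)], of ?q] by simp
  qed
  let ?R = "{1..n} - {i} - {j}"
  have "(\<Sum>k=1..n. b k) = adj (S i) * (\<Sum>k=1..n. S k * adj (S k)) * S i"
    by (simp add: b_def sum_distrib_left sum_distrib_right)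
  also have "\<dots> = 1" unfolding ranges using assms by simp
  finally have "(\<Sum>k=1..n. b k) = 1" .
  moreover have "b i = 1" using assms by (simp add: b_def mult.assoc[symmetric])
  ultimately have "(\<Sum>k\<in>{1..n} - {i}. b k) = 0" using assms by (simp add: sum.remove[of _ i])
  then have bj: "b j + (\<Sum>k\<in>?R. b k) = 0" using assms sum.remove[of "{1..n} - {i}" j b] by simp
  \<comment> \<open>The other \<open>b k\<close> sum to \<open>- b j\<close>, so this bound controls
    \<open>b j\<close> from the opposite side; it is the second hypothesis of
    \<open>selfadjoint_eq_0\<close> with \<open>m = card ?R\<close>.\<close>
  have "real (card ?R) *\<^sub>R 1 + b j = (\<Sum>k\<in>?R. 1 - b k)"
    using bj by (simp add: sum_subtractf eq_neg_iff_add_eq_0 of_nat_def[symmetric] scaleR_conv_of_real)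
  also have "norm \<dots> \<le> (\<Sum>k\<in>?R. 1)" using bn by (intro sum_norm_le) auto
  finally have "norm (real (card ?R) *\<^sub>R 1 + b j) \<le> card ?R" by simp
  then have "b j = 0" using selfadjoint_eq_0[OF sa bn[OF assms(2)]] by blast
  moreover have "b j = adj (adj (S j) * S i) * (adj (S j) * S i)"
    by (simp add: b_def adj_mult adj_adj mult.assoc)
  ultimately show ?thesis by (metis adj_mult_self_eq_0_iff)
qed

lemma sw_orth: "\<mu> \<in> W k \<Longrightarrow> \<nu> \<in> W k \<Longrightarrow> adj (sw \<mu>) * sw \<nu> = (if \<mu> = \<nu> then 1 else 0)"
proof (induction k arbitrary: \<mu> \<nu>)
  case (Suc k)
  obtain i \<mu>' where \<mu>: "\<mu> = i # \<mu>'" using Suc.prems(1) by (cases \<mu>) (auto simp: words_def)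
  obtain j \<nu>' where \<nu>: "\<nu> = j # \<nu>'" using Suc.prems(2) by (cases \<nu>) (auto simp: words_def)
  have "adj (sw \<mu>) * sw \<nu> = adj (sw \<mu>') * (adj (S i) * S j) * sw \<nu>'"
    by (simp add: \<mu> \<nu> adj_mult mult.assoc)
  also have "\<dots> = (if i = j then adj (sw \<mu>') * sw \<nu>' else 0)"
    using Suc.prems adj_mult_distinct[of j i] by (auto simp: \<mu> \<nu>)
  finally show ?case using Suc by (auto simp: \<mu> \<nu>)
qed simp

lemma sw_isometry: "\<mu> \<in> W k \<Longrightarrow> isometry (sw \<mu>)"
  by (simp add: isometry_def sw_orth)

lemma norm_sw: "\<mu> \<in> W k \<Longrightarrow> norm (sw \<mu>) = 1"
  using isometry_norm[OF sw_isometry] .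

lemma sw_ranges: "(\<Sum>\<mu>\<in>W k. sw \<mu> * adj (sw \<mu>)) = 1"
proof (induction k)
  case (Suc k)
  have "(\<Sum>\<mu>\<in>W (Suc k). sw \<mu> * adj (sw \<mu>)) = (\<Sum>i=1..n. S i * (\<Sum>\<mu>\<in>W k. sw \<mu> * adj (sw \<mu>)) * adj (S i))"
    by (simp add: sum_words_Suc adj_mult sum_distrib_left sum_distrib_right mult.assoc)
  then show ?case using ranges by (simp add: Suc.IH)
qed simp

lemma adj_sw_mult_sw:
  assumes "\<mu> \<in> W a" "\<nu> \<in> W (a + b)"
  shows "adj (sw \<mu>) * sw \<nu> = (if take a \<nu> = \<mu> then sw (drop a \<nu>) else 0)"
proof -
  have "sw \<nu> = sw (take a \<nu>) * sw (drop a \<nu>)" by (metis append_take_drop_id word_isometry_append)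
  then show ?thesis
    using sw_orth[OF assms(1) take_words[OF assms(2)]] by (auto simp flip: mult.assoc)
qed

text \<open>The word \<open>1\<dots>12\<close> has no period, so it is never a prefix of \<open>\<nu>1\<dots>12\<close>.\<close>

lemma aperiodic_sandwich:
  assumes "\<nu> \<in> W d" "1 \<le> d" "d \<le> M"
  shows "adj (sw (replicate M 1 @ [2])) * sw \<nu> * sw (replicate M 1 @ [2]) = 0"
proof -
  let ?\<kappa> = "replicate M 1 @ [2::nat]"
  have k: "?\<kappa> \<in> W (M + 1)" using two_le by (auto simp: words_def)
  have "\<nu> @ ?\<kappa> \<in> W (M + 1 + d)" using append_words[OF assms(1) k] by (simp add: ac_simps)
  then have "adj (sw ?\<kappa>) * sw (\<nu> @ ?\<kappa>) = (if take (M + 1) (\<nu> @ ?\<kappa>) = ?\<kappa> then sw (drop (M + 1) (\<nu> @ ?\<kappa>)) else 0)"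
    by (rule adj_sw_mult_sw[OF k])
  moreover have "take (M + 1) (\<nu> @ ?\<kappa>) \<noteq> ?\<kappa>"
  proof
    assume eq: "take (M + 1) (\<nu> @ ?\<kappa>) = ?\<kappa>"
    have len: "length \<nu> = d" using assms by (simp add: length_words)
    have "take (M + 1) (\<nu> @ ?\<kappa>) ! M = (\<nu> @ ?\<kappa>) ! M" by (rule nth_take) simp
    also have "\<dots> = ?\<kappa> ! (M - d)" using assms len by (simp add: nth_append)
    also have "\<dots> = 1" using assms by (simp add: nth_append)
    finally show False unfolding eq by (simp add: nth_append)
  qed
  ultimately show ?thesis by (simp add: word_isometry_append mult.assoc)
qed

lemma mat_mult: "wmat a b c * wmat b e c' = wmat a e (\<lambda>\<mu> \<rho>. \<Sum>\<nu>\<in>W b. c \<mu> \<nu> * c' \<nu> \<rho>)"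
proof -
  have 1: "adj (sw \<nu>) * wmat b e c' = (\<Sum>\<rho>\<in>W e. c' \<nu> \<rho> *\<^sub>C adj (sw \<rho>))" if "\<nu> \<in> W b" for \<nu>
  proof -
    have "adj (sw \<nu>) * wmat b e c' = (\<Sum>\<nu>'\<in>W b. \<Sum>\<rho>\<in>W e. c' \<nu>' \<rho> *\<^sub>C ((adj (sw \<nu>) * sw \<nu>') * adj (sw \<rho>)))"
      by (simp add: word_mat_def sum_distrib_left mult_scaleC_right mult.assoc)
    also have "\<dots> = (\<Sum>\<nu>'\<in>W b. if \<nu>' = \<nu> then (\<Sum>\<rho>\<in>W e. c' \<nu> \<rho> *\<^sub>C adj (sw \<rho>)) else 0)"
      using that by (intro sum.cong) (auto simp: sw_orth)
    finally show ?thesis using that by simp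
  qed
  have "wmat a b c * wmat b e c' = (\<Sum>\<mu>\<in>W a. \<Sum>\<nu>\<in>W b. c \<mu> \<nu> *\<^sub>C (sw \<mu> * (adj (sw \<nu>) * wmat b e c')))"
    by (subst word_mat_def) (simp add: sum_distrib_right mult_scaleC_left mult.assoc)
  also have "\<dots> = (\<Sum>\<mu>\<in>W a. \<Sum>\<nu>\<in>W b. \<Sum>\<rho>\<in>W e. (c \<mu> \<nu> * c' \<nu> \<rho>) *\<^sub>C (sw \<mu> * adj (sw \<rho>)))"
    by (intro sum.cong) (auto simp: 1 scaleC.scale_sum_right sum_distrib_left mult_scaleC_right scaleC_scaleC)
  also have "\<dots> = wmat a e (\<lambda>\<mu> \<rho>. \<Sum>\<nu>\<in>W b. c \<mu> \<nu> * c' \<nu> \<rho>)"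
    unfolding word_mat_def scaleC.scale_sum_left
    by (intro sum.cong refl sum.swap)
  finally show ?thesis .
qed

lemma mat_adj: "adj (wmat a b c) = wmat b a (\<lambda>\<mu> \<nu>. cnj (c \<nu> \<mu>))"
  by (simp add: word_mat_def adj_sum adj_scaleC adj_mult adj_adj sum.swap[of _ "W a"])

lemma mat_add: "wmat a b c + wmat a b c' = wmat a b (\<lambda>\<mu> \<nu>. c \<mu> \<nu> + c' \<mu> \<nu>)"
  by (simp add: word_mat_def sum.distrib scaleC_add_left)

lemma mat_scale: "k *\<^sub>C wmat a b c = wmat a b (\<lambda>\<mu> \<nu>. k * c \<mu> \<nu>)"
  by (simp add: word_mat_def scaleC.scale_sum_right scaleC_scaleC)

lemma mat_raise: "wmat a b c = wmat (a + j) (b + j) (raise_coeffs a b c)"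
proof -
  have "wmat (a + j) (b + j) (raise_coeffs a b c) = (\<Sum>\<mu>\<in>W a. \<Sum>\<rho>\<in>W j. \<Sum>\<nu>\<in>W b. \<Sum>\<rho>'\<in>W j.
      raise_coeffs a b c (\<mu> @ \<rho>) (\<nu> @ \<rho>') *\<^sub>C (sw (\<mu> @ \<rho>) * adj (sw (\<nu> @ \<rho>'))))"
    by (simp add: word_mat_def sum_words_add)
  also have "\<dots> = (\<Sum>\<mu>\<in>W a. \<Sum>\<rho>\<in>W j. \<Sum>\<nu>\<in>W b. \<Sum>\<rho>'\<in>W j.
      if \<rho>' = \<rho> then c \<mu> \<nu> *\<^sub>C (sw (\<mu> @ \<rho>) * adj (sw (\<nu> @ \<rho>))) else 0)"
    by (intro sum.cong) (auto simp: raise_coeffs_def length_words)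
  also have "\<dots> = (\<Sum>\<mu>\<in>W a. \<Sum>\<rho>\<in>W j. \<Sum>\<nu>\<in>W b. c \<mu> \<nu> *\<^sub>C (sw (\<mu> @ \<rho>) * adj (sw (\<nu> @ \<rho>))))"
    by simp
  also have "\<dots> = (\<Sum>\<mu>\<in>W a. \<Sum>\<nu>\<in>W b. \<Sum>\<rho>\<in>W j. c \<mu> \<nu> *\<^sub>C (sw (\<mu> @ \<rho>) * adj (sw (\<nu> @ \<rho>))))"
    by (intro sum.cong refl sum.swap)
  also have "\<dots> = (\<Sum>\<mu>\<in>W a. \<Sum>\<nu>\<in>W b. c \<mu> \<nu> *\<^sub>C (sw \<mu> * (\<Sum>\<rho>\<in>W j. sw \<rho> * adj (sw \<rho>)) * adj (sw \<nu>)))"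
    by (simp add: word_isometry_append adj_mult sum_distrib_left sum_distrib_right scaleC.scale_sum_right mult.assoc)
  also have "\<dots> = wmat a b c" by (simp add: sw_ranges word_mat_def)
  finally show ?thesis by simp
qed

lemma mat_vec: "wmat a b c * wvec b v = wvec a (\<lambda>\<mu>. \<Sum>\<nu>\<in>W b. c \<mu> \<nu> * v \<nu>)"
proof -
  have 1: "adj (sw \<nu>) * wvec b v = v \<nu> *\<^sub>C 1" if "\<nu> \<in> W b" for \<nu>
  proof -
    have "adj (sw \<nu>) * wvec b v = (\<Sum>\<nu>'\<in>W b. if \<nu>' = \<nu> then v \<nu> *\<^sub>C 1 else 0)"
      unfolding word_vec_def sum_distrib_left using that
      by (intro sum.cong) (auto simp: sw_orth mult_scaleC_right)
    then show ?thesis using that by simp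
  qed
  have "wmat a b c * wvec b v = (\<Sum>\<mu>\<in>W a. \<Sum>\<nu>\<in>W b. c \<mu> \<nu> *\<^sub>C (sw \<mu> * (adj (sw \<nu>) * wvec b v)))"
    by (subst word_mat_def) (simp add: sum_distrib_right mult_scaleC_left mult.assoc)
  also have "\<dots> = (\<Sum>\<mu>\<in>W a. \<Sum>\<nu>\<in>W b. (c \<mu> \<nu> * v \<nu>) *\<^sub>C sw \<mu>)"
    by (intro sum.cong) (auto simp: 1 mult_scaleC_right scaleC_scaleC)
  finally show ?thesis by (simp add: word_vec_def scaleC.scale_sum_left)
qed

lemma adj_vec_mult_vec: "adj (wvec a v) * wvec a w = (\<Sum>\<mu>\<in>W a. cnj (v \<mu>) * w \<mu>) *\<^sub>C 1"
proof -
  have "adj (wvec a v) * wvec a w = (\<Sum>\<mu>\<in>W a. \<Sum>\<nu>\<in>W a. (cnj (v \<mu>) * w \<nu>) *\<^sub>C (adj (sw \<mu>) * sw \<nu>))"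
    by (simp add: word_vec_def adj_sum adj_scaleC sum_product mult_scaleC_left mult_scaleC_right scaleC_scaleC mult.commute)
  also have "\<dots> = (\<Sum>\<mu>\<in>W a. \<Sum>\<nu>\<in>W a. if \<nu> = \<mu> then (cnj (v \<mu>) * w \<mu>) *\<^sub>C 1 else 0)"
    by (intro sum.cong) (auto simp: sw_orth)
  finally show ?thesis by (simp add: scaleC.scale_sum_left)
qed

lemma adj_vec_mult_self: "adj (wvec a v) * wvec a v = (\<Sum>\<mu>\<in>W a. (cmod (v \<mu>))\<^sup>2) *\<^sub>R 1"
  by (simp add: adj_vec_mult_vec scaleR_scaleC complex_norm_square mult.commute del: of_real_power)

lemma norm_vec: "(norm (wvec a v))\<^sup>2 = (\<Sum>\<mu>\<in>W a. (cmod (v \<mu>))\<^sup>2)"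
  using norm_adj_mult_self[of "wvec a v"] by (simp add: adj_vec_mult_self sum_nonneg)

lemma sw_eq_vec: "\<mu> \<in> W a \<Longrightarrow> sw \<mu> = wvec a (\<lambda>\<nu>. if \<nu> = \<mu> then 1 else 0)"
  by (simp add: word_vec_def if_distrib[of "\<lambda>c. c *\<^sub>C _"] cong: if_cong)

lemma mat_eq_sum_vec: "x = (\<Sum>\<nu>\<in>W b. (x * sw \<nu>) * adj (sw \<nu>))"
  using sw_ranges[of b] by (metis (no_types, lifting) mult.assoc mult_1_right sum.cong sum_distrib_left)

end

section \<open>The universal property\<close>

context cuntz_family begin

text \<open>The trivial estimate by \<open>n\<^sup>b L\<close>, applied to the powers of \<open>y\<^sup>* y\<close>, removes its constant.\<close>

lemma norm_mat_le:
  assumes "0 \<le> L" "\<And>v. norm (wmat a b c * wvec b v) \<le> L * norm (wvec b v)"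
  shows "norm (wmat a b c) \<le> L"
proof -
  have "norm (wmat a b c) ^ (2 ^ k) \<le> card (W b) * L ^ (2 ^ k)" for k
    using assms
  proof (induction k arbitrary: a c L)
    case 0
    have "norm (wmat a b c * sw \<nu> * adj (sw \<nu>)) \<le> L" if "\<nu> \<in> W b" for \<nu>
      using norm_mult_ineq[of "wmat a b c * sw \<nu>" "adj (sw \<nu>)"] 0(2)[of "\<lambda>\<rho>. if \<rho> = \<nu> then 1 else 0"] norm_sw[OF that]
      by (simp flip: sw_eq_vec[OF that])
    then have "norm (\<Sum>\<nu>\<in>W b. wmat a b c * sw \<nu> * adj (sw \<nu>)) \<le> (\<Sum>\<nu>\<in>W b. L)"
      by (intro sum_norm_le) auto
    then show ?case by (simp flip: mat_eq_sum_vec[of "wmat a b c"])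
  next
    case (Suc k)
    let ?y = "wmat a b c"
    \<comment> \<open>As for operators on a Hilbert space, the adjoint obeys the same bound on
      vectors. Hence \<open>adj ?y * ?y\<close> obeys it with the square of \<open>L\<close>, and
      the induction can proceed.\<close>
    have adj_le: "norm (adj ?y * wvec a v) \<le> L * norm (wvec a v)" for v
    proof -
      let ?h = "adj ?y * wvec a v"
      have "(norm ?h)\<^sup>2 = norm (adj (wvec a v) * (?y * ?h))"
        using norm_adj_mult_self[of ?h] by (simp add: adj_mult adj_adj mult.assoc)
      also have "\<dots> \<le> norm (wvec a v) * norm (?y * ?h)"
        using norm_mult_ineq[of "adj (wvec a v)" "?y * ?h"] by simp
      also have "\<dots> \<le> norm (wvec a v) * (L * norm ?h)"
        unfolding mat_adj mat_vec[of b] by (intro mult_left_mono Suc.prems(2)) simp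
      finally have "norm ?h * norm ?h \<le> (L * norm (wvec a v)) * norm ?h"
        by (simp add: power2_eq_square mult_ac)
      then show ?thesis using Suc.prems(1) by (cases "norm ?h = 0") (auto simp: mult_le_cancel_right)
    qed
    obtain c' where c': "adj ?y * ?y = wmat b b c'" by (simp add: mat_adj mat_mult)
    have "norm (wmat b b c' * wvec b v) \<le> L\<^sup>2 * norm (wvec b v)" for v
    proof -
      have "norm (wmat b b c' * wvec b v) = norm (adj ?y * (?y * wvec b v))" by (simp only: c'[symmetric] mult.assoc)
      also have "\<dots> \<le> L * norm (?y * wvec b v)" unfolding mat_vec by (rule adj_le)
      also have "\<dots> \<le> L * (L * norm (wvec b v))" by (intro mult_left_mono Suc.prems)
      finally show ?thesis by (simp add: power2_eq_square mult_ac)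
    qed
    then have "norm (wmat b b c') ^ (2 ^ k) \<le> card (W b) * (L\<^sup>2) ^ (2 ^ k)" by (intro Suc.IH) simp_all
    then show ?case
      unfolding c'[symmetric] norm_adj_mult_self by (simp add: power_mult[symmetric] mult.commute)
  qed
  moreover have "card (W b) * L ^ (2 ^ k) \<le> real (card (W b)) * 2 ^ k * L ^ (2 ^ k)" for k :: nat
    using assms(1) by (intro mult_right_mono) (auto simp: mult_le_cancel_left1)
  ultimately have "norm (wmat a b c) ^ (2 ^ k) \<le> real (card (W b)) * 2 ^ k * L ^ (2 ^ k)" for k :: nat
    by (rule order_trans)
  then show ?thesis by (rule le_of_powers_le[OF norm_ge_zero assms(1)])
qed

text \<open>For words with \<open>a < b\<close> the product \<open>adj (sw \<mu>) * sw \<nu>\<close>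
  is zero or the isometry of a word of length \<open>b - a\<close>, which lies between 1 and
  \<open>M\<close> and is killed by the aperiodic word. The case \<open>b < a\<close> follows by
  adjoints.\<close>

lemma aperiodic_sandwich_vec:
  assumes "a \<noteq> b" "a \<le> M" "b \<le> M"
  shows "adj (sw (replicate M 1 @ [2])) * (adj (wvec a v) * wvec b w) * sw (replicate M 1 @ [2]) = 0"
proof -
  let ?z = "sw (replicate M 1 @ [2])"
  have less: "adj ?z * (adj (wvec a v) * wvec b w) * ?z = 0" if ab: "a < b" "b \<le> M" for a b v w
  proof -
    have "adj ?z * (adj (sw \<mu>) * sw \<nu>) * ?z = 0" if "\<mu> \<in> W a" "\<nu> \<in> W b" for \<mu> \<nu>
    proof -
      have \<nu>: "\<nu> \<in> W (a + (b - a))" using that ab by simp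
      show ?thesis
        using adj_sw_mult_sw[OF that(1) \<nu>] aperiodic_sandwich[OF drop_words[OF \<nu>], of M] ab by auto
    qed
    moreover have "adj ?z * (adj (wvec a v) * wvec b w) * ?z =
        (\<Sum>\<mu>\<in>W a. \<Sum>\<nu>\<in>W b. (w \<nu> * cnj (v \<mu>)) *\<^sub>C (adj ?z * (adj (sw \<mu>) * sw \<nu>) * ?z))"
      unfolding word_vec_def adj_sum sum_product adj_scaleC sum_distrib_left sum_distrib_right
      by (simp add: mult_scaleC_left mult_scaleC_right scaleC_scaleC) (rule sum.swap)
    ultimately show ?thesis by simp
  qed
  show ?thesis
  proof (cases "a < b")
    case False
    then have "adj ?z * (adj (wvec b w) * wvec a v) * ?z = 0" using assms by (intro less) auto
    then have "adj (adj ?z * (adj (wvec b w) * wvec a v) * ?z) = 0" by (simp only: adj_zero)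
    then show ?thesis by (simp add: adj_mult adj_adj mult.assoc)
  qed (use less assms in blast)
qed

text \<open>A Pythagorean argument: compression by a long aperiodic word kills the cross terms and
  turns \<open>adj g * g\<close>, for the sum \<open>g\<close>, into the scalar sum of the squared
  norms, while an isometric compression does not increase norms.\<close>

lemma norm_sum_vec_ge:
  assumes fin: "finite I" and inj: "inj_on l I" and e: "e \<in> I"
  shows "norm (wvec (l e) (v e)) \<le> norm (\<Sum>d\<in>I. wvec (l d) (v d))"
proof -
  define M where "M = sum l I"
  have M: "l d \<le> M" if "d \<in> I" for d using that fin by (auto simp: M_def intro: member_le_sum)
  let ?z = "sw (replicate M 1 @ [2])" and ?g = "\<lambda>d. wvec (l d) (v d)"
  have "replicate M 1 @ [2] \<in> W (M + 1)" using two_le by (auto simp: words_def)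
  note z = sw_isometry[OF this]
  have "adj ?z * (adj (sum ?g I) * sum ?g I) * ?z = (\<Sum>d\<in>I. \<Sum>d'\<in>I. adj ?z * (adj (?g d) * ?g d') * ?z)"
    by (simp add: adj_sum sum_product sum_distrib_left sum_distrib_right) (rule sum.swap)
  also have "\<dots> = (\<Sum>d\<in>I. \<Sum>d'\<in>I. if d' = d then (norm (?g d))\<^sup>2 *\<^sub>R 1 else 0)"
  proof (intro sum.cong refl)
    fix d d' assume d: "d \<in> I" "d' \<in> I"
    show "adj ?z * (adj (?g d) * ?g d') * ?z = (if d' = d then (norm (?g d))\<^sup>2 *\<^sub>R 1 else 0)"
    proof (cases "d' = d")
      case True
      then show ?thesis using z by (simp add: adj_vec_mult_self norm_vec isometry_def)
    next
      case False
      then have "l d \<noteq> l d'" using inj d by (auto simp: inj_on_def)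
      then show ?thesis using aperiodic_sandwich_vec M d False by simp
    qed
  qed
  also have "\<dots> = (\<Sum>d\<in>I. (norm (?g d))\<^sup>2) *\<^sub>R 1" using fin by (simp add: scaleR_left.sum)
  finally have eq: "adj ?z * (adj (sum ?g I) * sum ?g I) * ?z = (\<Sum>d\<in>I. (norm (?g d))\<^sup>2) *\<^sub>R 1" .
  have "(norm (?g e))\<^sup>2 \<le> (\<Sum>d\<in>I. (norm (?g d))\<^sup>2)" using fin e by (intro member_le_sum) auto
  also have "\<dots> = norm (adj ?z * (adj (sum ?g I) * sum ?g I) * ?z)" unfolding eq by (simp add: sum_nonneg)
  also have "\<dots> \<le> norm (adj (sum ?g I) * sum ?g I)" by (rule norm_le_of_isometry[OF z])
  also have "\<dots> = (norm (sum ?g I))\<^sup>2" by (rule norm_adj_mult_self)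
  finally show ?thesis by (rule power2_le_imp_le) simp
qed

end

section \<open>Evaluating one *-polynomial in two Cuntz families\<close>

definition homogeneous_pair ::
    "nat \<Rightarrow> (nat \<Rightarrow> 'a::cstar_algebra) \<Rightarrow> (nat \<Rightarrow> 'a) \<Rightarrow> int \<Rightarrow> 'a \<Rightarrow> 'a \<Rightarrow> bool" where
  "homogeneous_pair n S T d x y \<longleftrightarrow>
     (\<exists>a b c. int a - int b = d \<and> x = word_mat n S a b c \<and> y = word_mat n T a b c)"

text \<open>\<open>x\<close> and \<open>y\<close> are the values of one polynomial at
  \<open>S\<close> and at \<open>T\<close>. This is a relation because only the norm estimate below
  shows that \<open>x\<close> determines \<open>y\<close>. The degree bound \<open>D\<close> is
  explicit because its growth under multiplication enters that estimate.\<close>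

definition graded_pair ::
    "nat \<Rightarrow> (nat \<Rightarrow> 'a::cstar_algebra) \<Rightarrow> (nat \<Rightarrow> 'a) \<Rightarrow> nat \<Rightarrow> 'a \<Rightarrow> 'a \<Rightarrow> bool" where
  "graded_pair n S T D x y \<longleftrightarrow>
     (\<exists>X Y. (\<forall>d. homogeneous_pair n S T d (X d) (Y d)) \<and> (\<forall>d. \<bar>d\<bar> > int D \<longrightarrow> X d = 0 \<and> Y d = 0) \<and>
       x = (\<Sum>d\<in>{-int D..int D}. X d) \<and> y = (\<Sum>d\<in>{-int D..int D}. Y d))"

locale cuntz_pair = S: cuntz_family n S + T: cuntz_family n T
  for n and S T :: "nat \<Rightarrow> 'a::cstar_algebra"
begin

abbreviation "hom \<equiv> homogeneous_pair n S T"
abbreviation "graded \<equiv> graded_pair n S T"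

text \<open>Supplies arbitrarily long representations with unchanged degree, so that two pairs can
  be brought to matching word lengths.\<close>

lemma hom_raise:
  assumes "hom d x y"
  obtains a b c where "int a - int b = d" "\<And>j. \<exists>c'. x = word_mat n S (a + j) (b + j) c' \<and> y = word_mat n T (a + j) (b + j) c'"
proof -
  obtain a b c where "int a - int b = d" "x = word_mat n S a b c" "y = word_mat n T a b c"
    using assms by (auto simp: homogeneous_pair_def)
  then show thesis using that[of a b] S.mat_raise T.mat_raise by metis
qed

lemma hom_zero: "hom d 0 0"
proof -
  have "int (nat d) - int (nat (- d)) = d" by simp
  moreover have "word_mat n R a b (\<lambda>_ _. 0) = 0" for R :: "nat \<Rightarrow> 'a" and a b by (simp add: word_mat_def)
  ultimately show ?thesis unfolding homogeneous_pair_def by metis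
qed

lemma hom_add:
  assumes "hom d x y" "hom d x' y'"
  shows "hom d (x + x') (y + y')"
proof -
  obtain a b where ab: "int a - int b = d"
    and 1: "\<And>j. \<exists>c'. x = word_mat n S (a + j) (b + j) c' \<and> y = word_mat n T (a + j) (b + j) c'"
    using hom_raise[OF assms(1)] by metis
  obtain a' b' where ab': "int a' - int b' = d"
    and 2: "\<And>j. \<exists>c'. x' = word_mat n S (a' + j) (b' + j) c' \<and> y' = word_mat n T (a' + j) (b' + j) c'"
    using hom_raise[OF assms(2)] by metis
  \<comment> \<open>Since the degrees are equal, raising crosswise makes both lengths agree.\<close>
  have e: "a' + a = a + a'" "b' + a = b + a'" using ab ab' by auto
  obtain c c' where "x = word_mat n S (a + a') (b + a') c" "y = word_mat n T (a + a') (b + a') c"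
    "x' = word_mat n S (a + a') (b + a') c'" "y' = word_mat n T (a + a') (b + a') c'"
    using 1[of a'] 2[of a] unfolding e by auto
  then have "x + x' = word_mat n S (a + a') (b + a') (\<lambda>\<mu> \<nu>. c \<mu> \<nu> + c' \<mu> \<nu>)"
    "y + y' = word_mat n T (a + a') (b + a') (\<lambda>\<mu> \<nu>. c \<mu> \<nu> + c' \<mu> \<nu>)"
    by (simp_all add: S.mat_add T.mat_add)
  moreover have "int (a + a') - int (b + a') = d" using ab by simp
  ultimately show ?thesis unfolding homogeneous_pair_def by blast
qed

lemma hom_scaleC:
  assumes "hom d x y"
  shows "hom d (k *\<^sub>C x) (k *\<^sub>C y)"
proof -
  obtain a b c where "int a - int b = d" "x = word_mat n S a b c" "y = word_mat n T a b c"
    using assms by (auto simp: homogeneous_pair_def)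
  then show ?thesis unfolding homogeneous_pair_def
    by (intro exI[of _ a] exI[of _ b] exI[of _ "\<lambda>\<mu> \<nu>. k * c \<mu> \<nu>"]) (simp add: S.mat_scale T.mat_scale)
qed

lemma hom_adj:
  assumes "hom d x y"
  shows "hom (- d) (adj x) (adj y)"
proof -
  obtain a b c where "int a - int b = d" "x = word_mat n S a b c" "y = word_mat n T a b c"
    using assms by (auto simp: homogeneous_pair_def)
  then have "int b - int a = - d" "adj x = word_mat n S b a (\<lambda>\<mu> \<nu>. cnj (c \<nu> \<mu>))"
    "adj y = word_mat n T b a (\<lambda>\<mu> \<nu>. cnj (c \<nu> \<mu>))" by (simp_all add: S.mat_adj T.mat_adj)
  then show ?thesis unfolding homogeneous_pair_def by blast
qed

lemma hom_mult:
  assumes "hom d x y" "hom d' x' y'"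
  shows "hom (d + d') (x * x') (y * y')"
proof -
  obtain a b where ab: "int a - int b = d"
    and 1: "\<And>j. \<exists>c'. x = word_mat n S (a + j) (b + j) c' \<and> y = word_mat n T (a + j) (b + j) c'"
    using hom_raise[OF assms(1)] by metis
  obtain a' b' where ab': "int a' - int b' = d'"
    and 2: "\<And>j. \<exists>c'. x' = word_mat n S (a' + j) (b' + j) c' \<and> y' = word_mat n T (a' + j) (b' + j) c'"
    using hom_raise[OF assms(2)] by metis
  \<comment> \<open>Raising the first factor by \<open>a'\<close> and the second by \<open>b\<close>
    gives both the inner length \<open>b + a'\<close>, so that they multiply as matrices.\<close>
  obtain c where c: "x = word_mat n S (a + a') (b + a') c" "y = word_mat n T (a + a') (b + a') c"
    using 1 by blast
  obtain c' where c': "x' = word_mat n S (b + a') (b' + b) c'" "y' = word_mat n T (b + a') (b' + b) c'"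
    using 2[of b] by (auto simp: add.commute)
  have "int (a + a') - int (b' + b) = d + d'" using ab ab' by simp
  then show ?thesis unfolding homogeneous_pair_def c c' S.mat_mult T.mat_mult by blast
qed

lemma hom_sum: "(\<And>i. i \<in> A \<Longrightarrow> hom d (X i) (Y i)) \<Longrightarrow> hom d (sum X A) (sum Y A)"
  by (induction A rule: infinite_finite_induct) (auto simp: hom_zero hom_add)

lemma hom_gen: "i \<in> {1..n} \<Longrightarrow> hom 1 (S i) (T i)"
proof -
  assume i: "i \<in> {1..n}"
  have e: "word_mat n R 1 0 (\<lambda>\<mu> \<nu>. if \<mu> = [i] then 1 else 0) = R i" for R :: "nat \<Rightarrow> 'a"
    using i by (simp add: word_mat_def sum_words_1 if_distrib[of "\<lambda>c. c *\<^sub>C _"] cong: if_cong)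
  have "int 1 - int 0 = 1" by simp
  then show ?thesis unfolding homogeneous_pair_def by (metis e)
qed

lemma hom_one: "hom 0 1 1"
proof -
  have "word_mat n R 0 0 (\<lambda>_ _. 1) = 1" for R :: "nat \<Rightarrow> 'a" by (simp add: word_mat_def)
  moreover have "int 0 - int 0 = 0" by simp
  ultimately show ?thesis unfolding homogeneous_pair_def by metis
qed

lemma gradedI:
  assumes "\<And>d. hom d (X d) (Y d)" "\<And>d. \<bar>d\<bar> > int D \<Longrightarrow> X d = 0 \<and> Y d = 0" "int D \<le> M"
    "x = (\<Sum>d\<in>{-M..M}. X d)" "y = (\<Sum>d\<in>{-M..M}. Y d)"
  shows "graded D x y"
proof -
  have "(\<Sum>d\<in>{-M..M}. X d) = (\<Sum>d\<in>{-int D..int D}. X d)" "(\<Sum>d\<in>{-M..M}. Y d) = (\<Sum>d\<in>{-int D..int D}. Y d)"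
    using assms(2,3) by (intro sum.mono_neutral_right; force)+
  then show ?thesis unfolding graded_pair_def using assms by metis
qed

lemma gradedE:
  assumes "graded D x y"
  obtains X Y where "\<And>d. hom d (X d) (Y d)" "\<And>d. \<bar>d\<bar> > int D \<Longrightarrow> X d = 0 \<and> Y d = 0"
    "\<And>M. int D \<le> M \<Longrightarrow> x = (\<Sum>d\<in>{-M..M}. X d) \<and> y = (\<Sum>d\<in>{-M..M}. Y d)"
proof -
  obtain X Y where 1: "\<And>d. hom d (X d) (Y d)" "\<And>d. \<bar>d\<bar> > int D \<Longrightarrow> X d = 0 \<and> Y d = 0"
    "x = (\<Sum>d\<in>{-int D..int D}. X d)" "y = (\<Sum>d\<in>{-int D..int D}. Y d)"
    using assms unfolding graded_pair_def by metis
  have "(\<Sum>d\<in>{-int D..int D}. X d) = (\<Sum>d\<in>{-M..M}. X d)" "(\<Sum>d\<in>{-int D..int D}. Y d) = (\<Sum>d\<in>{-M..M}. Y d)"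
    if "int D \<le> M" for M
    using 1(2) that by (intro sum.mono_neutral_left; force)+
  then show thesis using that[OF 1(1,2)] trans[OF 1(3)] trans[OF 1(4)] by blast
qed

lemma graded_hom:
  assumes "hom d x y"
  shows "graded (nat \<bar>d\<bar>) x y"
proof (rule gradedI)
  show "hom e (if e = d then x else 0) (if e = d then y else 0)" for e using assms hom_zero by simp
  show "x = (\<Sum>e\<in>{-\<bar>d\<bar>..\<bar>d\<bar>}. if e = d then x else 0)" "y = (\<Sum>e\<in>{-\<bar>d\<bar>..\<bar>d\<bar>}. if e = d then y else 0)"
    by auto
qed auto

lemma graded_add:
  assumes "graded D x y" "graded E x' y'"
  shows "graded (max D E) (x + x') (y + y')"
proof -
  obtain X Y where 1: "\<And>d. hom d (X d) (Y d)" "\<And>d. \<bar>d\<bar> > int D \<Longrightarrow> X d = 0 \<and> Y d = 0"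
    "\<And>M. int D \<le> M \<Longrightarrow> x = (\<Sum>d\<in>{-M..M}. X d) \<and> y = (\<Sum>d\<in>{-M..M}. Y d)" using gradedE[OF assms(1)] by metis
  obtain X' Y' where 2: "\<And>d. hom d (X' d) (Y' d)" "\<And>d. \<bar>d\<bar> > int E \<Longrightarrow> X' d = 0 \<and> Y' d = 0"
    "\<And>M. int E \<le> M \<Longrightarrow> x' = (\<Sum>d\<in>{-M..M}. X' d) \<and> y' = (\<Sum>d\<in>{-M..M}. Y' d)" using gradedE[OF assms(2)] by metis
  show ?thesis
    by (rule gradedI[where X="\<lambda>d. X d + X' d" and Y="\<lambda>d. Y d + Y' d" and M="int (max D E)"])
       (use 1(1,2) 1(3)[of "int (max D E)"] 2(1,2) 2(3)[of "int (max D E)"] in \<open>auto simp: sum.distrib hom_add\<close>)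
qed

lemma graded_scaleC:
  assumes "graded D x y"
  shows "graded D (k *\<^sub>C x) (k *\<^sub>C y)"
proof -
  obtain X Y where 1: "\<And>d. hom d (X d) (Y d)" "\<And>d. \<bar>d\<bar> > int D \<Longrightarrow> X d = 0 \<and> Y d = 0"
    "\<And>M. int D \<le> M \<Longrightarrow> x = (\<Sum>d\<in>{-M..M}. X d) \<and> y = (\<Sum>d\<in>{-M..M}. Y d)" using gradedE[OF assms(1)] by metis
  show ?thesis
    by (rule gradedI[where X="\<lambda>d. k *\<^sub>C X d" and Y="\<lambda>d. k *\<^sub>C Y d" and M="int D"])
       (use 1 in \<open>auto simp: hom_scaleC simp flip: scaleC.scale_sum_right\<close>)
qed

lemma graded_adj:
  assumes "graded D x y"
  shows "graded D (adj x) (adj y)"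
proof -
  obtain X Y where 1: "\<And>d. hom d (X d) (Y d)" "\<And>d. \<bar>d\<bar> > int D \<Longrightarrow> X d = 0 \<and> Y d = 0"
    "\<And>M. int D \<le> M \<Longrightarrow> x = (\<Sum>d\<in>{-M..M}. X d) \<and> y = (\<Sum>d\<in>{-M..M}. Y d)" using gradedE[OF assms(1)] by metis
  have "(\<Sum>d\<in>{-int D..int D}. adj (F d)) = (\<Sum>d\<in>{-int D..int D}. adj (F (- d)))" for F :: "int \<Rightarrow> 'a"
    by (rule sum.reindex_bij_witness[where i=uminus and j=uminus]) auto
  moreover have "hom d (adj (X (- d))) (adj (Y (- d)))" for d using hom_adj[OF 1(1)[of "- d"]] by simp
  ultimately show ?thesis
    using 1(2) 1(3)[of "int D"]
    by (intro gradedI[where X="\<lambda>d. adj (X (- d))" and Y="\<lambda>d. adj (Y (- d))" and M="int D"]) (auto simp: adj_sum)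
qed

lemma graded_mult:
  assumes "graded D x y" "graded E x' y'"
  shows "graded (D + E) (x * x') (y * y')"
proof -
  obtain X Y where 1: "\<And>d. hom d (X d) (Y d)" "\<And>d. \<bar>d\<bar> > int D \<Longrightarrow> X d = 0 \<and> Y d = 0"
    "\<And>M. int D \<le> M \<Longrightarrow> x = (\<Sum>d\<in>{-M..M}. X d) \<and> y = (\<Sum>d\<in>{-M..M}. Y d)" using gradedE[OF assms(1)] by metis
  obtain X' Y' where 2: "\<And>d. hom d (X' d) (Y' d)" "\<And>d. \<bar>d\<bar> > int E \<Longrightarrow> X' d = 0 \<and> Y' d = 0"
    "\<And>M. int E \<le> M \<Longrightarrow> x' = (\<Sum>d\<in>{-M..M}. X' d) \<and> y' = (\<Sum>d\<in>{-M..M}. Y' d)" using gradedE[OF assms(2)] by metis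
  let ?I = "{-int D..int D}" and ?J = "{-int (D + E)..int (D + E)}"
  \<comment> \<open>The window \<open>?J\<close> is wide enough that a translation by a degree from
    \<open>?I\<close> loses no nonzero term.\<close>
  have shift: "(\<Sum>f\<in>?J. F (f - d)) = (\<Sum>e\<in>{-int E..int E}. F e)"
    if "d \<in> ?I" "\<And>e. \<bar>e\<bar> > int E \<Longrightarrow> F e = 0" for F :: "int \<Rightarrow> 'a" and d
  proof -
    have "(\<Sum>f\<in>?J. F (f - d)) = (\<Sum>e\<in>{-int (D + E) - d..int (D + E) - d}. F e)"
      by (rule sum.reindex_bij_witness[where i="\<lambda>e. e + d" and j="\<lambda>f. f - d"]) auto
    also have "\<dots> = (\<Sum>e\<in>{-int E..int E}. F e)"
      using that by (intro sum.mono_neutral_right) force+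
    finally show ?thesis .
  qed
  have prod: "(\<Sum>d\<in>?I. F d) * (\<Sum>e\<in>{-int E..int E}. G e) = (\<Sum>f\<in>?J. \<Sum>d\<in>?I. F d * G (f - d))"
    if "\<And>e. \<bar>e\<bar> > int E \<Longrightarrow> G e = 0" for F G :: "int \<Rightarrow> 'a"
  proof -
    have "(\<Sum>f\<in>?J. \<Sum>d\<in>?I. F d * G (f - d)) = (\<Sum>d\<in>?I. F d * (\<Sum>f\<in>?J. G (f - d)))"
      by (subst sum.swap) (simp add: sum_distrib_left)
    then show ?thesis using shift[of _ G] that by (simp add: sum_distrib_right)
  qed
  show ?thesis
  proof (rule gradedI[where X="\<lambda>f. \<Sum>d\<in>?I. X d * X' (f - d)" and Y="\<lambda>f. \<Sum>d\<in>?I. Y d * Y' (f - d)" and M="int (D + E)"])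
    show "hom f (\<Sum>d\<in>?I. X d * X' (f - d)) (\<Sum>d\<in>?I. Y d * Y' (f - d))" for f
      by (rule hom_sum) (use hom_mult[OF 1(1) 2(1)] in \<open>metis add_diff_cancel_left' add_diff_inverse diff_add_cancel add.commute\<close>)
    show "(\<Sum>d\<in>?I. X d * X' (f - d)) = 0 \<and> (\<Sum>d\<in>?I. Y d * Y' (f - d)) = 0" if "\<bar>f\<bar> > int (D + E)" for f
    proof -
      have "X' (f - d) = 0 \<and> Y' (f - d) = 0" if "d \<in> ?I" for d
        using that \<open>\<bar>f\<bar> > int (D + E)\<close> by (intro 2(2)) auto
      then show ?thesis by simp
    qed
    show "x * x' = (\<Sum>f\<in>?J. \<Sum>d\<in>?I. X d * X' (f - d))"
      using prod[of X' X] 1(3)[of "int D"] 2(2) 2(3)[of "int E"] by simp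
    show "y * y' = (\<Sum>f\<in>?J. \<Sum>d\<in>?I. Y d * Y' (f - d))"
      using prod[of Y' Y] 1(3)[of "int D"] 2(2) 2(3)[of "int E"] by simp
  qed simp
qed

text \<open>At a common column length \<open>K\<close> all components act on the same vectors, and
  their results have pairwise distinct lengths \<open>l d\<close>. So \<open>norm_sum_vec_ge\<close>
  bounds one component by the whole sum on each vector, and \<open>norm_mat_le\<close> turns this
  into a bound on the element.\<close>

lemma graded_component_le:
  assumes hom: "\<And>d. hom d (X d) (Y d)" and e: "e \<in> {-int D..int D}"
  shows "norm (Y e) \<le> norm (\<Sum>d\<in>{-int D..int D}. X d)"
proof -
  let ?I = "{-int D..int D}" and ?x = "\<Sum>d\<in>{-int D..int D}. X d"
  have "\<forall>d. \<exists>a b. int a - int b = d \<and>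
      (\<forall>j. \<exists>c'. X d = word_mat n S (a + j) (b + j) c' \<and> Y d = word_mat n T (a + j) (b + j) c')"
    using hom_raise[OF hom] by metis
  then obtain a b where ab: "\<And>d. int (a d) - int (b d) = d"
    and raise: "\<And>d j. \<exists>c'. X d = word_mat n S (a d + j) (b d + j) c' \<and> Y d = word_mat n T (a d + j) (b d + j) c'"
    by metis
  define K where "K = (\<Sum>d\<in>?I. b d)"
  define l where "l d = a d + (K - b d)" for d
  have bK: "b d \<le> K" if "d \<in> ?I" for d unfolding K_def using that by (intro member_le_sum) auto
  have "\<exists>c. X d = word_mat n S (l d) K c \<and> Y d = word_mat n T (l d) K c" if "d \<in> ?I" for d
    using raise[of d "K - b d"] bK[OF that] by (auto simp: l_def)
  then obtain c where c: "\<And>d. d \<in> ?I \<Longrightarrow> X d = word_mat n S (l d) K (c d)"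
    "\<And>d. d \<in> ?I \<Longrightarrow> Y d = word_mat n T (l d) K (c d)" by metis
  have ld: "int (l d) = d + int K" if "d \<in> ?I" for d
    using ab[of d] bK[OF that] by (simp add: l_def)
  then have inj: "inj_on l ?I" by (metis (no_types, lifting) add_right_cancel inj_onI)
  \<comment> \<open>Both sides are the Euclidean norm of \<open>v\<close>; this is where the
    estimate passes from \<open>S\<close> to \<open>T\<close>.\<close>
  have nv: "norm (word_vec n T m v) = norm (word_vec n S m v)" for m v
    by (rule power2_eq_imp_eq) (simp_all add: S.norm_vec T.norm_vec)
  have "norm (word_mat n T (l e) K (c e)) \<le> norm ?x"
  proof (rule T.norm_mat_le)
    fix v
    let ?w = "\<lambda>d \<mu>. \<Sum>\<nu>\<in>words n K. c d \<mu> \<nu> * v \<nu>"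
    have "norm (word_mat n T (l e) K (c e) * word_vec n T K v) = norm (word_vec n S (l e) (?w e))"
      by (simp add: T.mat_vec nv)
    also have "\<dots> \<le> norm (\<Sum>d\<in>?I. word_vec n S (l d) (?w d))"
      using inj e by (intro S.norm_sum_vec_ge) auto
    also have "(\<Sum>d\<in>?I. word_vec n S (l d) (?w d)) = ?x * word_vec n S K v"
      by (simp add: sum_distrib_right c(1) S.mat_vec)
    also have "norm \<dots> \<le> norm ?x * norm (word_vec n S K v)" by (rule norm_mult_ineq)
    finally show "norm (word_mat n T (l e) K (c e) * word_vec n T K v) \<le> norm ?x * norm (word_vec n T K v)"
      by (simp add: nv)
  qed simp
  then show ?thesis using c e by simp
qed

text \<open>The number of degrees in the powers of \<open>x\<^sup>* x\<close> grows only linearly, so taking roots improves the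
  bound \<open>2 D + 1\<close> to 1.\<close>

lemma graded_norm_le:
  assumes "graded D x y"
  shows "norm y \<le> norm x"
proof -
  have "norm y ^ (2 ^ k) \<le> (2 * D * 2 ^ k + 1) * norm x ^ (2 ^ k)" for k
    using assms
  proof (induction k arbitrary: D x y)
    case 0
    obtain X Y where 1: "\<And>d. hom d (X d) (Y d)"
      "x = (\<Sum>d\<in>{-int D..int D}. X d)" "y = (\<Sum>d\<in>{-int D..int D}. Y d)"
      using 0 unfolding graded_pair_def by metis
    have "norm y \<le> (\<Sum>d\<in>{-int D..int D}. norm x)"
      unfolding 1(3) using graded_component_le[OF 1(1)] 1(2) by (intro sum_norm_le) simp
    then show ?case by (simp add: add.commute)
  next
    case (Suc k)
    have "graded (D + D) (adj x * x) (adj y * y)"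
      using Suc.prems by (intro graded_mult graded_adj)
    from Suc.IH[OF this] show ?case
      by (simp add: norm_adj_mult_self power_mult[symmetric] mult.commute mult.left_commute)
  qed
  moreover have "(2 * D * 2 ^ k + 1) * norm x ^ (2 ^ k) \<le> (2 * real D + 1) * 2 ^ k * norm x ^ (2 ^ k)" for k :: nat
    by (intro mult_right_mono) (auto simp: algebra_simps)
  ultimately have "norm y ^ (2 ^ k) \<le> (2 * real D + 1) * 2 ^ k * norm x ^ (2 ^ k)" for k :: nat
    using order_trans by blast
  then show ?thesis by (rule le_of_powers_le[OF norm_ge_zero norm_ge_zero])
qed

lemma closure_graded:
  assumes "cstar_generated (S ` {1..n}) = UNIV"
  shows "closure {x. \<exists>D y. graded D x y} = UNIV"
proof -
  let ?X = "{x. \<exists>D y. graded D x y}"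
  have ex: "\<exists>s. (\<forall>i. s i \<in> ?X) \<and> s \<longlonglongrightarrow> x" if "x \<in> closure ?X" for x
    using that closure_sequential by blast
  have lim: "x \<in> closure ?X" if "\<And>i. s i \<in> ?X" "s \<longlonglongrightarrow> x" for s x
    using that closure_sequential[of x ?X] by blast
  have "cstar_subalgebra (closure ?X)"
    unfolding cstar_subalgebra_def
  proof (intro conjI ballI allI)
    have "0 \<in> ?X" using graded_hom[OF hom_zero[of 0]] by blast
    then show "0 \<in> closure ?X" by (rule subsetD[OF closure_subset])
    show "closed (closure ?X)" by simp
    fix x assume x: "x \<in> closure ?X"
    then obtain s where s: "\<And>i. s i \<in> ?X" "s \<longlonglongrightarrow> x" using ex by blast
    have "adj (s i) \<in> ?X" for i using s(1)[of i] graded_adj by blast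
    moreover have "(\<lambda>i. adj (s i)) \<longlonglongrightarrow> adj x" by (intro tendsto_intros s)
    ultimately show "adj x \<in> closure ?X" by (rule lim)
    have "c *\<^sub>C s i \<in> ?X" for i c using s(1)[of i] graded_scaleC by blast
    moreover have "(\<lambda>i. c *\<^sub>C s i) \<longlonglongrightarrow> c *\<^sub>C x" for c by (intro tendsto_intros s)
    ultimately show "c *\<^sub>C x \<in> closure ?X" for c by (rule lim)
    fix x' assume "x' \<in> closure ?X"
    then obtain s' where s': "\<And>i. s' i \<in> ?X" "s' \<longlonglongrightarrow> x'" using ex by blast
    have "s i + s' i \<in> ?X" "s i * s' i \<in> ?X" for i
      using s(1)[of i] s'(1)[of i] graded_add graded_mult by blast+
    then show "x + x' \<in> closure ?X" "x * x' \<in> closure ?X"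
      using lim[OF _ tendsto_add[OF s(2) s'(2)]] lim[OF _ tendsto_mult[OF s(2) s'(2)]] by blast+
  qed
  moreover have "S ` {1..n} \<subseteq> closure ?X"
    using graded_hom[OF hom_gen] closure_subset[of ?X] by blast
  ultimately show ?thesis using cstar_generated_minimal assms by blast
qed

text \<open>Applied to differences, the norm estimate makes \<open>S\<close>-values determine
  \<open>T\<close>-values and makes the resulting map 1-Lipschitz, so it extends to the closure of
  the polynomials, which is everything. The algebraic identities pass to limits.\<close>

theorem universal_hom:
  assumes gen: "cstar_generated (S ` {1..n}) = UNIV"
  shows "\<exists>f. star_hom_on UNIV f \<and> f 1 = 1 \<and> (\<forall>i\<in>{1..n}. f (S i) = T i)"
proof -
  let ?X = "{x. \<exists>D y. graded D x y}"
  have diff: "norm (y - y') \<le> norm (x - x')" if "graded D x y" "graded D' x' y'" for x y x' y' D D'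
    using graded_norm_le[OF graded_add[OF that(1) graded_scaleC[OF that(2), of "complex_of_real (-1)"]]]
    unfolding scaleC_of_real by simp
  define F where "F x = (THE y. \<exists>D. graded D x y)" for x
  have F: "F x = y" if "graded D x y" for x y D
  proof -
    have "y' = y" if "graded D' x y'" for y' D' using diff[OF that \<open>graded D x y\<close>] by simp
    then show ?thesis unfolding F_def using that by blast
  qed
  have "uniformly_continuous_on ?X F"
    unfolding uniformly_continuous_on_def
  proof (intro allI impI exI conjI ballI)
    fix e :: real and x x' assume "e > 0" "x \<in> ?X" "x' \<in> ?X" "dist x' x < e"
    then show "dist (F x') (F x) < e" using diff F by (fastforce simp: dist_norm)
  qed
  then obtain g where "uniformly_continuous_on (closure ?X) g" and gF: "\<And>x. x \<in> ?X \<Longrightarrow> F x = g x"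
    by (rule uniformly_continuous_on_extension_on_closure) blast
  then have cont: "continuous_on UNIV g"
    using closure_graded[OF gen] uniformly_continuous_imp_continuous by metis
  have g: "g x = y" if "graded D x y" for x y D
  proof -
    have "x \<in> ?X" using that by blast
    then show ?thesis using F[OF that] gF by simp
  qed
  have lim: "(\<lambda>i. g (s i)) \<longlonglongrightarrow> g x" if "s \<longlonglongrightarrow> x" for s x
    using cont that by (simp add: continuous_on_tendsto_compose)
  have approx: "\<exists>s t. (\<forall>i. \<exists>D. graded D (s i) (t i)) \<and> s \<longlonglongrightarrow> x \<and> t \<longlonglongrightarrow> g x" for x
  proof -
    have "x \<in> closure ?X" using closure_graded[OF gen] by simp
    then obtain s where s: "\<And>i. \<exists>D y. graded D (s i) y" "s \<longlonglongrightarrow> x" unfolding closure_sequential by blast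
    have "\<forall>i. \<exists>D. graded D (s i) (g (s i))" using s(1) g by metis
    then show ?thesis using s(2) lim[OF s(2)] by (intro exI[of _ s] exI[of _ "\<lambda>i. g (s i)"]) simp
  qed
  have "star_hom_on UNIV g"
    unfolding star_hom_on_def
  proof (intro conjI ballI allI)
    fix x x' :: 'a and c :: complex
    obtain s t where s: "\<And>i. \<exists>D. graded D (s i) (t i)" "s \<longlonglongrightarrow> x" "t \<longlonglongrightarrow> g x" using approx by metis
    obtain s' t' where s': "\<And>i. \<exists>D. graded D (s' i) (t' i)" "s' \<longlonglongrightarrow> x'" "t' \<longlonglongrightarrow> g x'" using approx by metis
    have "g (s i + s' i) = t i + t' i" for i using s(1) s'(1) graded_add g by metis
    then show "g (x + x') = g x + g x'"
      using LIMSEQ_unique[OF lim[OF tendsto_add[OF s(2) s'(2)]]] tendsto_add[OF s(3) s'(3)] by simp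
    have "g (s i * s' i) = t i * t' i" for i using s(1) s'(1) graded_mult g by metis
    then show "g (x * x') = g x * g x'"
      using LIMSEQ_unique[OF lim[OF tendsto_mult[OF s(2) s'(2)]]] tendsto_mult[OF s(3) s'(3)] by simp
    have "g (c *\<^sub>C s i) = c *\<^sub>C t i" for i using s(1) graded_scaleC g by metis
    then show "g (c *\<^sub>C x) = c *\<^sub>C g x"
      using LIMSEQ_unique[OF lim[OF tendsto_scaleC[OF s(2), of c]]] tendsto_scaleC[OF s(3), of c] by simp
    have "g (adj (s i)) = adj (t i)" for i using s(1) graded_adj g by metis
    then show "g (adj x) = adj (g x)"
      using LIMSEQ_unique[OF lim[OF tendsto_adj[OF s(2)]]] tendsto_adj[OF s(3)] by simp
  qed
  moreover have "g 1 = 1" using g graded_hom[OF hom_one] by blast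
  moreover have "g (S i) = T i" if "i \<in> {1..n}" for i using g graded_hom[OF hom_gen[OF that]] by blast
  ultimately show ?thesis by blast
qed

end

section \<open>Endomorphisms and the diagonal\<close>

lemma star_hom_UNIVD:
  assumes "star_hom_on UNIV f"
  shows "f (x + y) = f x + f y" "f (x * y) = f x * f y" "f (c *\<^sub>C x) = c *\<^sub>C f x" "f (adj x) = adj (f x)"
  using assms by (auto simp: star_hom_on_def)

lemma star_hom_on_subset: "star_hom_on B f \<Longrightarrow> A \<subseteq> B \<Longrightarrow> star_hom_on A f"
  unfolding star_hom_on_def by (meson subsetD)

lemma cstar_subalgebra_vimage:
  assumes A: "cstar_subalgebra A" and B: "cstar_subalgebra B" and f: "star_hom_on A f" "continuous_on A f"
  shows "cstar_subalgebra {x\<in>A. f x \<in> B}"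
proof -
  have "closed {x\<in>A. f x \<in> B}"
    using continuous_closed_preimage[OF f(2) cstar_subalgebra_closed[OF A] cstar_subalgebra_closed[OF B]]
    by (simp add: vimage_def Int_def)
  then show ?thesis
    using A B f(1) star_hom_on_zero[OF A f(1)] unfolding cstar_subalgebra_def star_hom_on_def by auto
qed

context cuntz_family begin

abbreviation "P \<equiv> word_projection S"
abbreviation "\<D> \<equiv> diagonal n S"
abbreviation "\<phi> \<equiv> canonical_shift n S"
abbreviation "diag_sum k c \<equiv> (\<Sum>\<mu>\<in>W k. c \<mu> *\<^sub>C P \<mu>)"

section \<open>Cylinder projections and the finite levels of the diagonal\<close>

lemma adj_P [simp]: "adj (P \<mu>) = P \<mu>"
  by (simp add: word_projection_def adj_mult adj_adj)

lemma P_Nil [simp]: "P [] = 1"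
  by (simp add: word_projection_def)

lemma P_append: "P (\<mu> @ \<nu>) = sw \<mu> * P \<nu> * adj (sw \<mu>)"
  by (simp add: word_projection_def word_isometry_append adj_mult mult.assoc)

lemma P_Cons: "P (i # \<mu>) = S i * P \<mu> * adj (S i)"
  by (simp add: word_projection_def adj_mult mult.assoc)

lemma P_mult: "\<mu> \<in> W k \<Longrightarrow> \<nu> \<in> W k \<Longrightarrow> P \<mu> * P \<nu> = (if \<mu> = \<nu> then P \<mu> else 0)"
proof -
  assume "\<mu> \<in> W k" "\<nu> \<in> W k"
  moreover have "P \<mu> * P \<nu> = sw \<mu> * (adj (sw \<mu>) * sw \<nu>) * adj (sw \<nu>)"
    by (simp add: word_projection_def mult.assoc)
  ultimately show ?thesis by (auto simp: sw_orth word_projection_def)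
qed

lemma P_sum: "(\<Sum>\<mu>\<in>W k. P \<mu>) = 1"
  by (simp add: word_projection_def sw_ranges)

lemma P_extend: "P \<mu> = (\<Sum>\<tau>\<in>W j. P (\<mu> @ \<tau>))"
proof -
  have "(\<Sum>\<tau>\<in>W j. P (\<mu> @ \<tau>)) = sw \<mu> * (\<Sum>\<tau>\<in>W j. P \<tau>) * adj (sw \<mu>)"
    by (simp add: P_append sum_distrib_left sum_distrib_right)
  then show ?thesis unfolding P_sum by (simp only: mult_1_right word_projection_def[of S \<mu>])
qed

lemma norm_P: "\<mu> \<in> W k \<Longrightarrow> norm (P \<mu>) = 1"
  using norm_mult_adj_self[of "sw \<mu>"] by (simp add: word_projection_def norm_sw)

lemma P_mult_extension:
  assumes "\<mu> \<in> W k"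
  shows "P \<mu> * P (\<mu> @ \<tau>) = P (\<mu> @ \<tau>)"
proof -
  have "P \<mu> * P (\<mu> @ \<tau>) = sw \<mu> * (adj (sw \<mu>) * sw \<mu>) * P \<tau> * adj (sw \<mu>)"
    by (simp add: P_append) (simp add: word_projection_def mult.assoc)
  then show ?thesis using sw_orth[OF assms assms] by (simp add: P_append)
qed

lemma P_take_mult:
  assumes "\<mu> \<in> W (k + j)"
  shows "P (take k \<mu>) * P \<mu> = P \<mu>"
  using P_mult_extension[OF take_words[OF assms], of "drop k \<mu>"] by simp

lemma sum_mult_P: "x = (\<Sum>\<mu>\<in>W k. x * P \<mu>)"
  by (simp only: sum_distrib_left[symmetric] P_sum mult_1_right)

lemma cstar_subalgebra_diagonal: "cstar_subalgebra \<D>"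
  unfolding diagonal_def by (rule cstar_subalgebra_generated)

lemma P_in_diagonal: "\<mu> \<in> W k \<Longrightarrow> P \<mu> \<in> \<D>"
  unfolding diagonal_def by (rule subsetD[OF cstar_generated_superset]) blast

lemma one_in_diagonal: "1 \<in> \<D>"
  using P_in_diagonal[of "[]" 0] by simp

lemma diagonal_subset:
  assumes "cstar_subalgebra B" "\<And>k \<mu>. \<mu> \<in> W k \<Longrightarrow> P \<mu> \<in> B"
  shows "\<D> \<subseteq> B"
  unfolding diagonal_def using assms by (intro cstar_generated_minimal) auto

lemma diagonal_hom_agree:
  assumes "star_hom_on \<D> f" "f 1 = 1" "star_hom_on \<D> g" "g 1 = 1"
    and "\<And>k \<mu>. \<mu> \<in> W k \<Longrightarrow> f (P \<mu>) = g (P \<mu>)" "x \<in> \<D>"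
  shows "f x = g x"
proof -
  note one = one_in_diagonal[unfolded diagonal_def] and assms' = assms[unfolded diagonal_def]
  show ?thesis
    by (rule star_hom_agree[OF one assms'(1-4)]) (use assms' in blast)+
qed

lemma diagonal_commute: "x \<in> \<D> \<Longrightarrow> \<mu> \<in> W k \<Longrightarrow> x * P \<mu> = P \<mu> * x"
proof -
  assume x: "x \<in> \<D>" and \<mu>: "\<mu> \<in> W k"
  have long: "P \<mu> * P \<nu> = P \<nu> * P \<mu>" if "\<mu> \<in> W k" "\<nu> \<in> W (k + j)" for \<mu> \<nu> k j
  proof -
    have \<nu>: "P \<nu> = P (take k \<nu>) * P \<nu>" using P_take_mult[OF that(2)] by simp
    then have \<nu>': "P \<nu> = P \<nu> * P (take k \<nu>)" by (metis adj_P adj_mult)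
    have "P \<mu> * P \<nu> = (if \<mu> = take k \<nu> then P \<nu> else 0)"
      using P_mult[OF that(1) take_words[OF that(2)]] \<nu> by (metis mult.assoc mult_zero_left)
    moreover have "P \<nu> * P \<mu> = (if \<mu> = take k \<nu> then P \<nu> else 0)"
      using P_mult[OF take_words[OF that(2)] that(1)] \<nu>' by (metis mult.assoc mult_zero_right)
    ultimately show ?thesis by simp
  qed
  have "P \<mu> * P \<nu> = P \<nu> * P \<mu>" if "\<mu> \<in> W k" "\<nu> \<in> W l" for \<mu> \<nu> k l
  proof (cases "k \<le> l")
    case True
    then show ?thesis using long[of \<mu> k \<nu> "l - k"] that by simp
  next
    case False
    then show ?thesis using long[of \<nu> l \<mu> "k - l"] that by simp
  qed
  then have "\<D> \<subseteq> {x. \<forall>y\<in>(\<Union>k. P ` W k). x * y = y * x}"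
    by (intro diagonal_subset cstar_subalgebra_commutant) auto
  then show ?thesis using x \<mu> by blast
qed

lemma diag_sum_mult: "diag_sum k c * diag_sum k c' = diag_sum k (\<lambda>\<mu>. c \<mu> * c' \<mu>)"
proof -
  have "diag_sum k c * diag_sum k c' = (\<Sum>\<mu>\<in>W k. \<Sum>\<nu>\<in>W k. if \<nu> = \<mu> then (c \<mu> * c' \<mu>) *\<^sub>C P \<mu> else 0)"
    unfolding sum_product
    by (intro sum.cong) (auto simp: mult_scaleC_left mult_scaleC_right scaleC_scaleC P_mult mult.commute)
  then show ?thesis by simp
qed

lemma diag_sum_mult_P: "\<mu> \<in> W k \<Longrightarrow> diag_sum k c * P \<mu> = c \<mu> *\<^sub>C P \<mu>"
proof -
  assume \<mu>: "\<mu> \<in> W k"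
  have "diag_sum k c * P \<mu> = (\<Sum>\<nu>\<in>W k. if \<nu> = \<mu> then c \<mu> *\<^sub>C P \<mu> else 0)"
    unfolding sum_distrib_right using \<mu> by (intro sum.cong) (auto simp: mult_scaleC_left P_mult)
  then show ?thesis using \<mu> by simp
qed

lemma norm_diag_sum_le:
  assumes "0 \<le> L" "\<And>\<mu>. \<mu> \<in> W k \<Longrightarrow> cmod (c \<mu>) \<le> L"
  shows "norm (diag_sum k c) \<le> L"
proof (rule norm_orthogonal_sum_le)
  show "norm (c \<mu> *\<^sub>C P \<mu>) \<le> L" if "\<mu> \<in> W k" for \<mu>
    using assms(2)[OF that] by (simp add: norm_scaleC norm_P[OF that])
  show "adj (c \<mu> *\<^sub>C P \<mu>) * (c \<nu> *\<^sub>C P \<nu>) = 0" "c \<mu> *\<^sub>C P \<mu> * adj (c \<nu> *\<^sub>C P \<nu>) = 0"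
    if "\<mu> \<in> W k" "\<nu> \<in> W k" "\<mu> \<noteq> \<nu>" for \<mu> \<nu>
    using P_mult[OF that(1,2)] that(3) by (simp_all add: adj_scaleC mult_scaleC_left mult_scaleC_right)
qed (simp_all add: assms(1))

lemma diag_sum_raise: "diag_sum k c = diag_sum (k + j) (\<lambda>\<mu>. c (take k \<mu>))"
proof -
  have "diag_sum (k + j) (\<lambda>\<mu>. c (take k \<mu>)) = (\<Sum>\<mu>\<in>W k. \<Sum>\<tau>\<in>W j. c \<mu> *\<^sub>C P (\<mu> @ \<tau>))"
    unfolding sum_words_add by (intro sum.cong) (auto simp: length_words)
  also have "\<dots> = (\<Sum>\<mu>\<in>W k. c \<mu> *\<^sub>C (\<Sum>\<tau>\<in>W j. P (\<mu> @ \<tau>)))" by (simp add: scaleC.scale_sum_right)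
  finally show ?thesis by (simp flip: P_extend)
qed

lemma diag_sum_in_diagonal: "diag_sum k c \<in> \<D>"
  by (intro cstar_subalgebra_sum cstar_subalgebra_scaleC cstar_subalgebra_diagonal P_in_diagonal)

text \<open>Each level embeds in the later ones by \<open>diag_sum_raise\<close>, so the union of
  all levels is a *-algebra that contains the generators.\<close>

lemma diagonal_approx:
  assumes x: "x \<in> \<D>" and e: "e > 0"
  shows "\<exists>k c. norm (x - diag_sum k c) < e"
proof -
  let ?X = "{x. \<exists>k c. x = diag_sum k c}"
  have lim: "x \<in> closure ?X" if "\<And>i. s i \<in> ?X" "s \<longlonglongrightarrow> x" for s x
    using that closure_sequential[of x ?X] by blast
  have ex: "\<exists>s. (\<forall>i. s i \<in> ?X) \<and> s \<longlonglongrightarrow> x" if "x \<in> closure ?X" for x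
    using that closure_sequential by blast
  have common: "\<exists>k c c'. x = diag_sum k c \<and> y = diag_sum k c'" if xy: "x \<in> ?X" "y \<in> ?X" for x y
  proof -
    obtain k c l c' where "x = diag_sum k c" "y = diag_sum l c'" using xy by blast
    then have "x = diag_sum (k + l) (\<lambda>\<mu>. c (take k \<mu>))" "y = diag_sum (k + l) (\<lambda>\<mu>. c' (take l \<mu>))"
      using diag_sum_raise[where k=k and c=c and j=l] diag_sum_raise[where k=l and c=c' and j=k] by (simp_all add: add.commute)
    then show ?thesis
      by (intro exI[of _ "k + l"] exI[of _ "\<lambda>\<mu>. c (take k \<mu>)"] exI[of _ "\<lambda>\<mu>. c' (take l \<mu>)"]) simp
  qed
  have XI: "diag_sum k c \<in> ?X" for k c by blast
  have add: "x + y \<in> ?X" if xy: "x \<in> ?X" "y \<in> ?X" for x y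
  proof -
    obtain k c c' where "x = diag_sum k c" "y = diag_sum k c'" using common[OF xy] by blast
    then have e: "x + y = diag_sum k (\<lambda>\<mu>. c \<mu> + c' \<mu>)" by (simp add: scaleC_add_left sum.distrib)
    show ?thesis unfolding e by (rule XI)
  qed
  have mult: "x * y \<in> ?X" if xy: "x \<in> ?X" "y \<in> ?X" for x y
  proof -
    obtain k c c' where "x = diag_sum k c" "y = diag_sum k c'" using common[OF xy] by blast
    then have e: "x * y = diag_sum k (\<lambda>\<mu>. c \<mu> * c' \<mu>)" by (simp add: diag_sum_mult)
    show ?thesis unfolding e by (rule XI)
  qed
  have scl: "a *\<^sub>C x \<in> ?X" if x: "x \<in> ?X" for x a
  proof -
    obtain k c where "x = diag_sum k c" using x by blast
    then have e: "a *\<^sub>C x = diag_sum k (\<lambda>\<mu>. a * c \<mu>)" by (simp add: scaleC.scale_sum_right scaleC_scaleC)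
    show ?thesis unfolding e by (rule XI)
  qed
  have adj: "adj x \<in> ?X" if x: "x \<in> ?X" for x
  proof -
    obtain k c where "x = diag_sum k c" using x by blast
    then have e: "adj x = diag_sum k (\<lambda>\<mu>. cnj (c \<mu>))" by (simp add: adj_sum adj_scaleC)
    show ?thesis unfolding e by (rule XI)
  qed
  have "cstar_subalgebra (closure ?X)"
    unfolding cstar_subalgebra_def
  proof (intro conjI ballI allI)
    have "0 \<in> ?X" using XI[of "\<lambda>_. 0" 0] by simp
    then show "0 \<in> closure ?X" by (rule subsetD[OF closure_subset])
    show "closed (closure ?X)" by simp
    fix x assume "x \<in> closure ?X"
    then obtain s where s: "\<And>i. s i \<in> ?X" "s \<longlonglongrightarrow> x" using ex by blast
    show "adj x \<in> closure ?X" by (rule lim[OF adj[OF s(1)] tendsto_adj[OF s(2)]])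
    show "c *\<^sub>C x \<in> closure ?X" for c by (rule lim[OF scl[OF s(1)] tendsto_scaleC[OF s(2)]])
    fix x' assume "x' \<in> closure ?X"
    then obtain s' where s': "\<And>i. s' i \<in> ?X" "s' \<longlonglongrightarrow> x'" using ex by blast
    show "x + x' \<in> closure ?X" by (rule lim[OF add[OF s(1) s'(1)] tendsto_add[OF s(2) s'(2)]])
    show "x * x' \<in> closure ?X" by (rule lim[OF mult[OF s(1) s'(1)] tendsto_mult[OF s(2) s'(2)]])
  qed
  moreover have "P \<mu> \<in> closure ?X" if "\<mu> \<in> W k" for \<mu> k
  proof -
    have e: "P \<mu> = diag_sum k (\<lambda>\<nu>. if \<nu> = \<mu> then 1 else 0)"
      using that by (simp add: if_distrib[of "\<lambda>c. c *\<^sub>C _"] cong: if_cong)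
    have "P \<mu> \<in> ?X" by (subst e) (rule XI)
    then show ?thesis by (rule subsetD[OF closure_subset])
  qed
  ultimately have "\<D> \<subseteq> closure ?X" by (rule diagonal_subset)
  then obtain y where "y \<in> ?X" "dist y x < e" using x e closure_approachable by blast
  then show ?thesis by (auto simp: dist_norm norm_minus_commute)
qed

text \<open>A projection of the diagonal is the indicator of a clopen set. Approximate
  \<open>p\<close> within 1/2 at level \<open>k\<close>: if a cylinder met both \<open>p\<close> and
  its complement, the coefficient there would be at distance less than 1/2 from both 1 and
  0.\<close>

lemma diagonal_projection:
  assumes p: "p \<in> \<D>" "adj p = p" "p * p = p"
  shows "\<exists>k. \<forall>k'\<ge>k. \<forall>\<mu>\<in>W k'. p * P \<mu> = 0 \<or> p * P \<mu> = P \<mu>"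
proof -
  obtain k c where kc: "norm (p - diag_sum k c) < 1/2" using diagonal_approx[OF p(1), of "1/2"] by auto
  have norm1: "norm q = 1" if "adj q = q" "q * q = q" "q \<noteq> 0" for q :: 'a
    using norm_adj_mult_self[of q] that by (auto simp: power2_eq_square)
  have base: "p * P \<mu> = 0 \<or> p * P \<mu> = P \<mu>" if \<mu>: "\<mu> \<in> W k" for \<mu>
  proof (rule ccontr)
    assume "\<not> ?thesis"
    then have ne: "p * P \<mu> \<noteq> 0" "P \<mu> - p * P \<mu> \<noteq> 0" by auto
    let ?q = "p * P \<mu>" and ?r = "P \<mu> - p * P \<mu>"
    note comm = diagonal_commute[OF p(1) \<mu>]
    have PP: "P \<mu> * P \<mu> = P \<mu>" using P_mult[OF \<mu> \<mu>] by simp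
    have qq: "?q * ?q = ?q" by (metis PP comm mult.assoc p(3))
    have Pq: "P \<mu> * ?q = ?q" "?q * P \<mu> = ?q" by (metis PP comm mult.assoc)+
    have q: "adj ?q = ?q" by (metis adj_P adj_mult comm p(2))
    have r: "adj ?r = ?r" "?r * ?r = ?r" using q qq Pq PP by (simp_all add: adj_diff algebra_simps)
    have pr: "p * ?r = 0" by (simp add: right_diff_distrib p(3) flip: mult.assoc)
    have n: "norm ((p - diag_sum k c) * P \<mu> * y) < 1/2" if "norm y = 1" for y
    proof -
      have "norm ((p - diag_sum k c) * P \<mu> * y) \<le> norm (p - diag_sum k c) * norm (P \<mu>) * norm y"
        by (meson mult_right_mono norm_ge_zero norm_mult_ineq order_trans)
      then show ?thesis using kc that by (simp add: norm_P[OF \<mu>])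
    qed
    have e: "(p - diag_sum k c) * P \<mu> = ?q - c \<mu> *\<^sub>C P \<mu>" by (simp add: left_diff_distrib diag_sum_mult_P[OF \<mu>])
    have "(p - diag_sum k c) * P \<mu> * ?q = (1 - c \<mu>) *\<^sub>C ?q"
      unfolding e by (simp add: left_diff_distrib qq mult_scaleC_left Pq scaleC.scale_left_diff_distrib)
    with n[OF norm1[OF q qq ne(1)]] have 1: "cmod (1 - c \<mu>) < 1/2" by (simp add: norm_scaleC norm1[OF q qq ne(1)])
    have "?q * ?r = 0" by (simp add: right_diff_distrib Pq qq)
    moreover have "P \<mu> * ?r = ?r" by (simp add: right_diff_distrib Pq PP)
    ultimately have "(p - diag_sum k c) * P \<mu> * ?r = - (c \<mu> *\<^sub>C ?r)"
      unfolding e by (simp add: left_diff_distrib mult_scaleC_left)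
    with n[OF norm1[OF r ne(2)]] have 2: "cmod (c \<mu>) < 1/2" by (simp add: norm_scaleC norm1[OF r ne(2)])
    have "1 \<le> cmod (1 - c \<mu>) + cmod (c \<mu>)" using norm_triangle_ineq[of "1 - c \<mu>" "c \<mu>"] by simp
    then show False using 1 2 by simp
  qed
  have "p * P \<mu> = 0 \<or> p * P \<mu> = P \<mu>" if "k \<le> k'" "\<mu> \<in> W k'" for k' \<mu>
  proof -
    have \<mu>: "\<mu> \<in> W (k + (k' - k))" using that by simp
    have "p * P \<mu> = p * P (take k \<mu>) * P \<mu>" using P_take_mult[OF \<mu>] by (simp add: mult.assoc)
    then show ?thesis using base[OF take_words[OF \<mu>]] P_take_mult[OF \<mu>] by auto
  qed
  then show ?thesis by blast
qed

section \<open>The canonical shift and the maps between cylinders\<close>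

lemma adj_S_mult_S: "i \<in> {1..n} \<Longrightarrow> j \<in> {1..n} \<Longrightarrow> adj (S i) * S j = (if i = j then 1 else 0)"
  using adj_mult_distinct[of j i] by auto

lemma shift_mult_S: "i \<in> {1..n} \<Longrightarrow> \<phi> x * S i = S i * x"
proof -
  assume i: "i \<in> {1..n}"
  have "\<phi> x * S i = (\<Sum>j=1..n. if j = i then S i * x else 0)"
    unfolding canonical_shift_def sum_distrib_right using i
    by (intro sum.cong) (auto simp: mult.assoc adj_S_mult_S)
  then show ?thesis using i by simp
qed

lemma compress_shift: "i \<in> {1..n} \<Longrightarrow> adj (S i) * \<phi> x * S i = x"
proof -
  assume i: "i \<in> {1..n}"
  have "adj (S i) * \<phi> x * S i = adj (S i) * S i * x" using shift_mult_S[OF i] by (simp add: mult.assoc)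
  then show ?thesis using i by (simp add: adj_S_mult_S)
qed

lemma shift_hom: "star_hom_on UNIV \<phi>"
  unfolding star_hom_on_def
proof (intro conjI ballI allI)
  fix x y :: 'a and c
  show "\<phi> (x + y) = \<phi> x + \<phi> y" by (simp add: canonical_shift_def algebra_simps sum.distrib)
  show "\<phi> (c *\<^sub>C x) = c *\<^sub>C \<phi> x"
    by (simp add: canonical_shift_def mult_scaleC_left mult_scaleC_right scaleC.scale_sum_right)
  show "\<phi> (adj x) = adj (\<phi> x)" by (simp add: canonical_shift_def adj_sum adj_mult adj_adj mult.assoc)
  have "\<phi> x * \<phi> y = (\<Sum>i=1..n. \<phi> x * S i * y * adj (S i))"
    unfolding canonical_shift_def[of n S y] by (simp add: sum_distrib_left mult.assoc)
  also have "\<dots> = (\<Sum>i=1..n. S i * x * y * adj (S i))" by (intro sum.cong) (auto simp: shift_mult_S)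
  also have "\<dots> = \<phi> (x * y)" by (simp add: canonical_shift_def mult.assoc)
  finally show "\<phi> (x * y) = \<phi> x * \<phi> y" by simp
qed

lemma shift_one: "\<phi> 1 = 1"
  using ranges by (simp add: canonical_shift_def)

lemma funpow_shift: "(\<phi> ^^ k) x = (\<Sum>\<mu>\<in>W k. sw \<mu> * x * adj (sw \<mu>))"
proof (induction k)
  case (Suc k)
  have "(\<phi> ^^ Suc k) x = (\<Sum>i=1..n. \<Sum>\<mu>\<in>W k. S i * (sw \<mu> * x * adj (sw \<mu>)) * adj (S i))"
    by (simp add: Suc canonical_shift_def sum_distrib_left sum_distrib_right)
  then show ?case by (simp add: sum_words_Suc adj_mult mult.assoc)
qed simp

lemma funpow_shift_P: "(\<phi> ^^ k) (P \<tau>) = (\<Sum>\<mu>\<in>W k. P (\<mu> @ \<tau>))"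
  by (simp add: funpow_shift P_append)

text \<open>Splits a cylinder into a condition on its first \<open>k\<close> letters and one on the
  remaining letters. A homomorphism that fixes the range of the shift power leaves the second factor
  alone.\<close>

lemma P_mult_funpow_shift:
  assumes "\<mu> \<in> W k"
  shows "P \<mu> * (\<phi> ^^ k) (P \<tau>) = P (\<mu> @ \<tau>)"
proof -
  have "P \<mu> * (\<phi> ^^ k) (P \<tau>) = (\<Sum>\<nu>\<in>W k. if \<nu> = \<mu> then P (\<mu> @ \<tau>) else 0)"
    unfolding funpow_shift_P sum_distrib_left
  proof (intro sum.cong refl)
    fix \<nu> assume \<nu>: "\<nu> \<in> W k"
    have "P \<mu> * P (\<nu> @ \<tau>) = P \<mu> * P \<nu> * P (\<nu> @ \<tau>)" using P_mult_extension[OF \<nu>] by (simp add: mult.assoc)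
    then show "P \<mu> * P (\<nu> @ \<tau>) = (if \<nu> = \<mu> then P (\<mu> @ \<tau>) else 0)"
      using P_mult[OF assms \<nu>] P_mult_extension[OF assms] by auto
  qed
  then show ?thesis using assms by simp
qed

lemma conj_hom:
  assumes "isometry v"
  shows "star_hom_on UNIV (\<lambda>x. v * x * adj v)"
proof -
  have "v * (x * y) * adj v = (v * x * adj v) * (v * y * adj v)" for x y
  proof -
    have "(v * x * adj v) * (v * y * adj v) = v * x * (adj v * v) * y * adj v" by (simp add: mult.assoc)
    also have "\<dots> = v * (x * y) * adj v" using assms by (simp add: isometry_def) (simp add: mult.assoc)
    finally show ?thesis by simp
  qed
  then show ?thesis
    by (auto simp: star_hom_on_def algebra_simps mult_scaleC_left mult_scaleC_right adj_mult adj_adj)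
qed

text \<open>Multiplicativity holds on the diagonal because \<open>S i * adj (S i)\<close> commutes
  with its elements and can be moved out of the middle of the product.\<close>

lemma compress_hom:
  assumes i: "i \<in> {1..n}"
  shows "star_hom_on \<D> (\<lambda>x. adj (S i) * x * S i)"
proof -
  have "adj (S i) * (x * y) * S i = (adj (S i) * x * S i) * (adj (S i) * y * S i)" if x: "x \<in> \<D>" for x y
  proof -
    have "x * P [i] = P [i] * x" by (rule diagonal_commute[OF x, of _ 1]) (use i in \<open>simp add: words_def\<close>)
    then have c: "x * (S i * adj (S i)) = (S i * adj (S i)) * x" by (simp add: word_projection_def)
    have "(adj (S i) * x * S i) * (adj (S i) * y * S i) = adj (S i) * (x * (S i * adj (S i))) * y * S i"
      by (simp only: mult.assoc)
    also have "\<dots> = adj (S i) * (S i * adj (S i)) * x * y * S i" by (simp only: c mult.assoc)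
    also have "\<dots> = (adj (S i) * S i) * adj (S i) * x * y * S i" by (simp only: mult.assoc)
    finally show ?thesis using i by (simp add: adj_S_mult_S) (simp add: mult.assoc)
  qed
  then show ?thesis
    by (auto simp: star_hom_on_def algebra_simps mult_scaleC_left mult_scaleC_right adj_mult adj_adj)
qed

lemma conj_diagonal:
  assumes i: "i \<in> {1..n}" and x: "x \<in> \<D>"
  shows "S i * x * adj (S i) \<in> \<D>"
proof -
  have "cstar_subalgebra {x\<in>UNIV. S i * x * adj (S i) \<in> \<D>}"
    by (intro cstar_subalgebra_vimage cstar_subalgebra_UNIV cstar_subalgebra_diagonal conj_hom isom i continuous_intros)
  moreover have "S i * P \<mu> * adj (S i) \<in> \<D>" if "\<mu> \<in> W k" for \<mu> k
    using P_in_diagonal[of "i # \<mu>" "Suc k"] that i by (simp add: P_Cons)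
  ultimately have "\<D> \<subseteq> {x\<in>UNIV. S i * x * adj (S i) \<in> \<D>}" by (intro diagonal_subset) auto
  then show ?thesis using x by blast
qed

lemma compress_diagonal:
  assumes i: "i \<in> {1..n}" and x: "x \<in> \<D>"
  shows "adj (S i) * x * S i \<in> \<D>"
proof -
  have "cstar_subalgebra {x\<in>\<D>. adj (S i) * x * S i \<in> \<D>}"
    by (intro cstar_subalgebra_vimage cstar_subalgebra_diagonal compress_hom i continuous_intros)
  moreover have "adj (S i) * P \<mu> * S i \<in> \<D>" if "\<mu> \<in> W k" for \<mu> k
  proof (cases \<mu>)
    case Nil
    then show ?thesis using i one_in_diagonal by simp
  next
    case (Cons j \<nu>)
    then have j: "j \<in> {1..n}" "\<nu> \<in> W (k - 1)" using that by (auto simp: words_def)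
    have "adj (S i) * P \<mu> * S i = (adj (S i) * S j) * P \<nu> * (adj (S j) * S i)"
      by (simp add: Cons P_Cons mult.assoc)
    then show ?thesis
      using P_in_diagonal[OF j(2)] i j(1) by (auto simp: adj_S_mult_S cstar_subalgebra_zero[OF cstar_subalgebra_diagonal])
  qed
  ultimately have "\<D> \<subseteq> {x\<in>\<D>. adj (S i) * x * S i \<in> \<D>}" using P_in_diagonal by (intro diagonal_subset) auto
  then show ?thesis using x by blast
qed

lemma shift_diagonal: "x \<in> \<D> \<Longrightarrow> \<phi> x \<in> \<D>"
  unfolding canonical_shift_def by (intro cstar_subalgebra_sum cstar_subalgebra_diagonal conj_diagonal) auto

lemma funpow_shift_diagonal: "x \<in> \<D> \<Longrightarrow> (\<phi> ^^ k) x \<in> \<D>"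
  by (induction k) (auto simp: shift_diagonal)

end

section \<open>Endomorphisms determined by a unitary\<close>

locale cuntz_generated = cuntz_family +
  assumes generates: "cstar_generated (S ` {1..n}) = UNIV"
begin

abbreviation "lam \<equiv> cuntz_endomorphism n S"

lemma hom_ext:
  assumes "star_hom_on UNIV f" "f 1 = 1" "star_hom_on UNIV g" "g 1 = 1" "\<And>i. i \<in> {1..n} \<Longrightarrow> f (S i) = g (S i)"
  shows "f = g"
proof
  fix x show "f x = g x"
    by (rule star_hom_agree[of "S ` {1..n}", unfolded generates, OF UNIV_I assms(1-4) _ UNIV_I])
      (use assms(5) in blast)
qed

text \<open>One unitarity equation makes the \<open>u * S i\<close> isometries and the other makes
  their ranges sum to 1, so the universal property applies; generation gives the uniqueness behind
  \<open>THE\<close>.\<close>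

lemma cuntz_endomorphism:
  assumes u: "unitary u"
  shows "star_hom_on UNIV (lam u)" "lam u 1 = 1" "\<And>i. i \<in> {1..n} \<Longrightarrow> lam u (S i) = u * S i"
proof -
  have fam: "cuntz_family n (\<lambda>i. u * S i)"
  proof
    show "2 \<le> n" by (rule two_le)
    show "isometry (u * S i)" if "i \<in> {1..n}" for i
    proof -
      have "adj (u * S i) * (u * S i) = adj (S i) * (adj u * u) * S i" by (simp add: adj_mult mult.assoc)
      then show ?thesis using u isom[OF that] by (simp add: isometry_def unitary_def)
    qed
    have "(\<Sum>i=1..n. u * S i * adj (u * S i)) = u * (\<Sum>i=1..n. S i * adj (S i)) * adj u"
      by (simp add: adj_mult sum_distrib_left sum_distrib_right mult.assoc)
    then show "(\<Sum>i=1..n. u * S i * adj (u * S i)) = 1" unfolding ranges using u by (simp add: unitary_def)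
  qed
  interpret cuntz_pair n S "\<lambda>i. u * S i"
    by (rule cuntz_pair.intro[OF cuntz_family_axioms fam])
  let ?P = "\<lambda>f. star_hom_on UNIV f \<and> f 1 = 1 \<and> (\<forall>i\<in>{1..n}. f (S i) = u * S i)"
  have "\<exists>f. ?P f" by (rule universal_hom[OF generates])
  then have "\<exists>!f. ?P f" using hom_ext by (metis (mono_tags, lifting))
  from theI'[OF this] have "?P (lam u)" unfolding cuntz_endomorphism_def .
  then show "star_hom_on UNIV (lam u)" "lam u 1 = 1" "\<And>i. i \<in> {1..n} \<Longrightarrow> lam u (S i) = u * S i" by auto
qed

text \<open>This recursion on the first letter is how conjugation by \<open>u\<close> determines the
  endomorphism on the whole diagonal.\<close>

lemma lam_P_Cons:
  assumes "unitary u" "i \<in> {1..n}"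
  shows "lam u (P (i # \<mu>)) = u * (S i * lam u (P \<mu>) * adj (S i)) * adj u"
  unfolding P_Cons star_hom_UNIVD(2,4)[OF cuntz_endomorphism(1)[OF assms(1)]] cuntz_endomorphism(3)[OF assms]
    adj_mult mult.assoc ..

end

section \<open>Property (P) and permutation unitaries\<close>

lemma star_hom_comp:
  assumes "star_hom_on A f" "\<And>x. x \<in> A \<Longrightarrow> f x \<in> B" "star_hom_on B g"
  shows "star_hom_on A (\<lambda>x. g (f x))"
  using assms unfolding star_hom_on_def by simp

lemma star_automorphism_one:
  assumes "star_automorphism_on B f" "1 \<in> B"
  shows "f 1 = 1"
proof -
  obtain x where x: "x \<in> B" "f x = 1"
    using assms unfolding star_automorphism_on_def bij_betw_def by (metis imageE)
  then have "f (1 * x) = f 1 * f x" using assms unfolding star_automorphism_on_def star_hom_on_def by blast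
  then show ?thesis using x by simp
qed

lemma star_automorphism_inv:
  assumes B: "cstar_subalgebra B" and f: "star_automorphism_on B f"
  shows "star_automorphism_on B (inv_into B f)"
proof -
  have bij: "bij_betw f B B" and hom: "star_hom_on B f" using f by (auto simp: star_automorphism_on_def)
  let ?g = "inv_into B f"
  have g: "?g x \<in> B" "f (?g x) = x" if "x \<in> B" for x
    using bij that by (auto simp: bij_betw_def inv_into_into f_inv_into_f)
  have eq: "?g y = x" if "x \<in> B" "f x = y" for x y
    using bij that by (auto simp: bij_betw_def)
  have "star_hom_on B ?g"
    unfolding star_hom_on_def
  proof (intro conjI ballI allI)
    fix x c assume x: "x \<in> B"
    show "?g (c *\<^sub>C x) = c *\<^sub>C ?g x" using hom g[OF x] B
      by (intro eq cstar_subalgebra_scaleC) (auto simp: star_hom_on_def)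
    show "?g (adj x) = adj (?g x)" using hom g[OF x] B
      by (intro eq cstar_subalgebra_adj) (auto simp: star_hom_on_def)
    fix y assume y: "y \<in> B"
    show "?g (x + y) = ?g x + ?g y" using hom g[OF x] g[OF y] B
      by (intro eq cstar_subalgebra_add) (auto simp: star_hom_on_def)
    show "?g (x * y) = ?g x * ?g y" using hom g[OF x] g[OF y] B
      by (intro eq cstar_subalgebra_mult) (auto simp: star_hom_on_def)
  qed
  then show ?thesis using bij_betw_inv_into[OF bij] by (simp add: star_automorphism_on_def)
qed

context cuntz_family begin

lemma funpow_shift_hom: "star_hom_on UNIV (\<phi> ^^ k)"
proof (induction k)
  case (Suc k)
  then show ?case using star_hom_comp[OF Suc _ shift_hom] by (simp add: comp_def)
qed (simp add: star_hom_on_def)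

lemma funpow_shift_one: "(\<phi> ^^ k) 1 = 1"
  by (induction k) (auto simp: shift_one)

lemma P_Cons_eq: "i \<in> {1..n} \<Longrightarrow> P (i # \<mu>) = P [i] * \<phi> (P \<mu>)"
  using P_mult_funpow_shift[of "[i]" 1 \<mu>] by (simp add: words_def)

lemma P_in_diagonal_level: "i \<in> {1..n} \<Longrightarrow> P [i] \<in> diagonal_level n S 1"
  unfolding diagonal_level_def by (intro scaleC.span_base imageI) (simp add: words_def)

lemma diagonal_level_subset: "diagonal_level n S k \<subseteq> \<D>"
  unfolding diagonal_level_def
proof (rule scaleC.span_minimal)
  show "scaleC.subspace \<D>"
    using cstar_subalgebra_diagonal by (auto simp: scaleC.subspace_def cstar_subalgebra_def)
qed (auto simp: P_in_diagonal)

text \<open>Property (P) concerns single letters. It spreads to all words through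
  \<open>P_Cons_eq\<close>, which writes a cylinder as a letter times a shifted shorter cylinder,
  and then to the diagonal because both sides are unital homomorphisms.\<close>

lemma property_P_diagonal:
  assumes \<alpha>: "star_hom_on \<D> \<alpha>" "\<And>x. x \<in> \<D> \<Longrightarrow> \<alpha> x \<in> \<D>" "\<alpha> 1 = 1" and P: "property_P n S \<alpha>"
  shows "\<exists>m. \<forall>j. \<forall>x\<in>\<D>. \<alpha> ((\<phi> ^^ (m + j)) x) = (\<phi> ^^ j) (\<alpha> ((\<phi> ^^ m) x))"
proof -
  obtain m where m: "\<And>k x. k \<ge> m \<Longrightarrow> x \<in> diagonal_level n S 1 \<Longrightarrow>
      \<alpha> ((\<phi> ^^ k) x) = (\<phi> ^^ (k - m)) (\<alpha> ((\<phi> ^^ m) x))"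
    using P unfolding property_P_def by blast
  have hom: "star_hom_on \<D> (\<lambda>x. \<alpha> ((\<phi> ^^ k) x))" for k
    by (rule star_hom_comp[OF star_hom_on_subset[OF funpow_shift_hom subset_UNIV] funpow_shift_diagonal \<alpha>(1)])
  have words: "\<alpha> ((\<phi> ^^ (m + j)) (P \<mu>)) = (\<phi> ^^ j) (\<alpha> ((\<phi> ^^ m) (P \<mu>)))" if "\<mu> \<in> W k" for \<mu> j k
    using that
  proof (induction \<mu> arbitrary: j k)
    case Nil
    then show ?case by (simp add: funpow_shift_one \<alpha>)
  next
    case (Cons i \<mu>)
    then have i: "i \<in> {1..n}" and \<mu>: "\<mu> \<in> W (k - 1)" by (auto simp: words_def)
    note IH = Cons.IH[OF \<mu>]
    have D: "(\<phi> ^^ l) (P [i]) \<in> \<D>" "(\<phi> ^^ l) (P \<mu>) \<in> \<D>" for l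
      using i \<mu> by (auto intro!: funpow_shift_diagonal P_in_diagonal[of _ 1] P_in_diagonal simp: words_def)
    have step: "\<alpha> ((\<phi> ^^ l) (P (i # \<mu>))) = \<alpha> ((\<phi> ^^ l) (P [i])) * \<alpha> ((\<phi> ^^ (l + 1)) (P \<mu>))" for l
    proof -
      have "(\<phi> ^^ l) (P (i # \<mu>)) = (\<phi> ^^ l) (P [i]) * (\<phi> ^^ (l + 1)) (P \<mu>)"
        unfolding P_Cons_eq[OF i, of \<mu>] star_hom_UNIVD(2)[OF funpow_shift_hom]
        by (simp add: funpow_swap1)
      then show ?thesis using \<alpha>(1) D unfolding star_hom_on_def by metis
    qed
    have "\<alpha> ((\<phi> ^^ (m + j)) (P (i # \<mu>))) = (\<phi> ^^ j) (\<alpha> ((\<phi> ^^ m) (P [i]))) * (\<phi> ^^ (j + 1)) (\<alpha> ((\<phi> ^^ m) (P \<mu>)))"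
      using m[OF _ P_in_diagonal_level[OF i], of "m + j"] IH[of "j + 1"] unfolding step by (simp add: add.assoc)
    \<comment> \<open>The tail carries one extra shift: the induction hypothesis at
      \<open>j + 1\<close> took all shifts beyond \<open>m\<close> out of \<alpha>, and at
      \<open>1\<close> it puts one back, so that just \<open>j\<close> stay outside.\<close>
    also have "(\<phi> ^^ (j + 1)) (\<alpha> ((\<phi> ^^ m) (P \<mu>))) = (\<phi> ^^ j) (\<alpha> ((\<phi> ^^ (m + 1)) (P \<mu>)))"
      using IH[of 1] by (simp add: funpow_swap1)
    finally show ?case unfolding step star_hom_UNIVD(2)[OF funpow_shift_hom] .
  qed
  have "\<alpha> ((\<phi> ^^ (m + j)) x) = (\<phi> ^^ j) (\<alpha> ((\<phi> ^^ m) x))" if "x \<in> \<D>" for j x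
  proof (rule diagonal_hom_agree[OF hom _ _ _ words that])
    show "star_hom_on \<D> (\<lambda>x. (\<phi> ^^ j) (\<alpha> ((\<phi> ^^ m) x)))"
      by (rule star_hom_comp[OF hom UNIV_I funpow_shift_hom])
  qed (simp_all add: funpow_shift_one \<alpha>)
  then show ?thesis by blast
qed

section \<open>Permutation unitaries and permutations of cylinders\<close>

abbreviation "perm_unitary k \<sigma> \<equiv> (\<Sum>\<mu>\<in>W k. sw (\<sigma> \<mu>) * adj (sw \<mu>))"

lemma perm_unitary_mult_sw:
  assumes "\<nu> \<in> W k"
  shows "perm_unitary k \<sigma> * sw \<nu> = sw (\<sigma> \<nu>)"
proof -
  have "perm_unitary k \<sigma> * sw \<nu> = (\<Sum>\<mu>\<in>W k. if \<mu> = \<nu> then sw (\<sigma> \<nu>) else 0)"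
    unfolding sum_distrib_right using assms by (intro sum.cong) (auto simp: mult.assoc sw_orth)
  then show ?thesis using assms by simp
qed

lemma unitary_perm_unitary:
  assumes \<sigma>: "\<sigma> permutes W k"
  shows "unitary (perm_unitary k \<sigma>)"
proof -
  let ?u = "perm_unitary k \<sigma>"
  have adju: "adj ?u * sw (\<sigma> \<mu>) = sw \<mu>" if \<mu>: "\<mu> \<in> W k" for \<mu>
  proof -
    have "adj ?u * sw (\<sigma> \<mu>) = (\<Sum>\<nu>\<in>W k. sw \<nu> * (adj (sw (\<sigma> \<nu>)) * sw (\<sigma> \<mu>)))"
      by (simp add: adj_sum adj_mult adj_adj sum_distrib_right mult.assoc)
    also have "\<dots> = (\<Sum>\<nu>\<in>W k. if \<nu> = \<mu> then sw \<mu> else 0)"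
    proof (intro sum.cong refl)
      fix \<nu> assume \<nu>: "\<nu> \<in> W k"
      have "\<sigma> \<nu> \<in> W k" "\<sigma> \<mu> \<in> W k" "\<sigma> \<nu> = \<sigma> \<mu> \<longleftrightarrow> \<nu> = \<mu>"
        using \<sigma> \<mu> \<nu> permutes_in_image permutes_inj by (metis, metis, metis injD)
      then show "sw \<nu> * (adj (sw (\<sigma> \<nu>)) * sw (\<sigma> \<mu>)) = (if \<nu> = \<mu> then sw \<mu> else 0)"
        by (simp add: sw_orth)
    qed
    finally show ?thesis using \<mu> by simp
  qed
  have "adj ?u * ?u = (\<Sum>\<mu>\<in>W k. (adj ?u * sw (\<sigma> \<mu>)) * adj (sw \<mu>))"
    by (simp add: sum_distrib_left mult.assoc)
  also have "\<dots> = (\<Sum>\<mu>\<in>W k. sw \<mu> * adj (sw \<mu>))" by (intro sum.cong) (simp_all add: adju)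
  finally have 1: "adj ?u * ?u = 1" by (simp add: sw_ranges)
  have "?u * adj ?u = (\<Sum>\<mu>\<in>W k. (?u * sw \<mu>) * adj (sw (\<sigma> \<mu>)))"
    by (simp add: adj_sum adj_mult adj_adj sum_distrib_left mult.assoc)
  also have "\<dots> = (\<Sum>\<mu>\<in>W k. sw (\<sigma> \<mu>) * adj (sw (\<sigma> \<mu>)))" by (intro sum.cong) (simp_all add: perm_unitary_mult_sw)
  also have "\<dots> = (\<Sum>\<mu>\<in>W k. sw \<mu> * adj (sw \<mu>))"
    by (rule sum.permute[OF \<sigma>, of "\<lambda>\<mu>. sw \<mu> * adj (sw \<mu>)", symmetric, unfolded comp_def])
  finally show ?thesis using 1 by (simp add: unitary_def sw_ranges)
qed

text \<open>Such a \<open>\<beta>\<close> maps a level \<open>L \<ge> M\<close> of the diagonal into itself, and it permutes the minimal projections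
  of that level by a counting argument.\<close>

lemma inner_permutation:
  assumes \<beta>: "star_hom_on \<D> \<beta>" "\<And>x. x \<in> \<D> \<Longrightarrow> \<beta> x \<in> \<D>" "\<beta> 1 = 1"
    and nz: "\<And>k \<mu>. \<mu> \<in> W k \<Longrightarrow> \<beta> (P \<mu>) \<noteq> 0"
    and fix_shift: "\<And>x. x \<in> \<D> \<Longrightarrow> \<beta> ((\<phi> ^^ M) x) = (\<phi> ^^ M) x"
  shows "\<exists>L \<sigma>. \<sigma> permutes W L \<and> (\<forall>x\<in>\<D>. \<beta> x = perm_unitary L \<sigma> * x * adj (perm_unitary L \<sigma>))"
proof -
  have \<beta>mult: "\<beta> (x * y) = \<beta> x * \<beta> y" and \<beta>adj: "\<beta> (adj x) = adj (\<beta> x)" if "x \<in> \<D>" "y \<in> \<D>" for x y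
    using \<beta>(1) that by (auto simp: star_hom_on_def)
  have proj: "\<exists>k. \<forall>k'\<ge>k. \<forall>\<kappa>\<in>W k'. \<beta> (P \<mu>) * P \<kappa> = 0 \<or> \<beta> (P \<mu>) * P \<kappa> = P \<kappa>" if \<mu>: "\<mu> \<in> W M" for \<mu>
  proof (rule diagonal_projection)
    note D = P_in_diagonal[OF \<mu>]
    show "\<beta> (P \<mu>) \<in> \<D>" by (rule \<beta>(2)[OF D])
    show "adj (\<beta> (P \<mu>)) = \<beta> (P \<mu>)" using \<beta>adj[OF D D] by simp
    show "\<beta> (P \<mu>) * \<beta> (P \<mu>) = \<beta> (P \<mu>)" using \<beta>mult[OF D D] P_mult[OF \<mu> \<mu>] by simp
  qed
  then obtain K where K: "\<And>\<mu> k' \<kappa>. \<mu> \<in> W M \<Longrightarrow> K \<mu> \<le> k' \<Longrightarrow> \<kappa> \<in> W k' \<Longrightarrow>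
      \<beta> (P \<mu>) * P \<kappa> = 0 \<or> \<beta> (P \<mu>) * P \<kappa> = P \<kappa>" by metis
  \<comment> \<open>At least \<open>M\<close>, and beyond every threshold \<open>K \<mu>\<close>, so
    that one level decides the images of all cylinders of length \<open>M\<close>.\<close>
  define L where "L = M + (\<Sum>\<mu>\<in>W M. K \<mu>)"
  have KL: "K \<mu> \<le> L" if "\<mu> \<in> W M" for \<mu>
    using member_le_sum[of \<mu> "W M" K] that by (simp add: L_def)
  have LM: "L = M + (L - M)" by (simp add: L_def)
  \<comment> \<open>Since \<beta> fixes the tail factor, its values on words of length
    \<open>M\<close> determine it on level \<open>L\<close>.\<close>
  have split: "\<beta> (P \<nu>) = \<beta> (P (take M \<nu>)) * (\<phi> ^^ M) (P (drop M \<nu>))" if \<nu>: "\<nu> \<in> W L" for \<nu>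
  proof -
    have t: "take M \<nu> \<in> W M" "drop M \<nu> \<in> W (L - M)" using \<nu> LM take_words drop_words by metis+
    have "P \<nu> = P (take M \<nu>) * (\<phi> ^^ M) (P (drop M \<nu>))" using P_mult_funpow_shift[OF t(1)] by simp
    then show ?thesis
      using \<beta>mult[OF P_in_diagonal[OF t(1)] funpow_shift_diagonal[OF P_in_diagonal[OF t(2)]]]
        fix_shift[OF P_in_diagonal[OF t(2)]] by metis
  qed
  have shift01: "(\<phi> ^^ M) (P \<rho>) * P \<kappa> = 0 \<or> (\<phi> ^^ M) (P \<rho>) * P \<kappa> = P \<kappa>"
    if "\<rho> \<in> W (L - M)" "\<kappa> \<in> W L" for \<rho> \<kappa>
  proof -
    have "(\<phi> ^^ M) (P \<rho>) * P \<kappa> = (\<Sum>\<mu>\<in>W M. if \<mu> = take M \<kappa> then (if drop M \<kappa> = \<rho> then P \<kappa> else 0) else 0)"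
      unfolding funpow_shift_P sum_distrib_right
    proof (intro sum.cong refl)
      fix \<mu> assume \<mu>: "\<mu> \<in> W M"
      then have "\<mu> @ \<rho> \<in> W L" using append_words[OF \<mu> that(1)] LM by simp
      moreover have "\<mu> @ \<rho> = \<kappa> \<longleftrightarrow> \<mu> = take M \<kappa> \<and> drop M \<kappa> = \<rho>"
        using \<mu> by (auto simp: length_words)
      ultimately show "P (\<mu> @ \<rho>) * P \<kappa> = (if \<mu> = take M \<kappa> then (if drop M \<kappa> = \<rho> then P \<kappa> else 0) else 0)"
        using P_mult[OF _ that(2)] by auto
    qed
    then show ?thesis by simp
  qed
  have dich: "\<beta> (P \<nu>) * P \<kappa> = 0 \<or> \<beta> (P \<nu>) * P \<kappa> = P \<kappa>" if \<nu>: "\<nu> \<in> W L" and \<kappa>: "\<kappa> \<in> W L" for \<nu> \<kappa>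
  proof -
    have t: "take M \<nu> \<in> W M" "drop M \<nu> \<in> W (L - M)" using \<nu> LM take_words drop_words by metis+
    show ?thesis
      unfolding split[OF \<nu>] mult.assoc using shift01[OF t(2) \<kappa>] K[OF t(1) KL[OF t(1)] \<kappa>] by auto
  qed
  have orth: "\<nu> = \<nu>'" if "\<nu> \<in> W L" "\<nu>' \<in> W L" "\<kappa> \<in> W L" "\<beta> (P \<nu>) * P \<kappa> = P \<kappa>" "\<beta> (P \<nu>') * P \<kappa> = P \<kappa>" for \<nu> \<nu>' \<kappa>
  proof (rule ccontr)
    assume "\<nu> \<noteq> \<nu>'"
    then have "\<beta> (P \<nu>) * \<beta> (P \<nu>') = \<beta> 0"
      using \<beta>mult[OF P_in_diagonal[OF that(1)] P_in_diagonal[OF that(2)]] P_mult[OF that(1,2)] by simp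
    then have "\<beta> (P \<nu>) * (\<beta> (P \<nu>') * P \<kappa>) = 0"
      using star_hom_on_zero[OF cstar_subalgebra_diagonal \<beta>(1)] by (simp flip: mult.assoc)
    then show False using that(4,5) norm_P[OF that(3)] by auto
  qed
  have "\<exists>\<kappa>\<in>W L. \<beta> (P \<nu>) * P \<kappa> = P \<kappa>" if \<nu>: "\<nu> \<in> W L" for \<nu>
  proof (rule ccontr)
    assume "\<not> ?thesis"
    then have "\<beta> (P \<nu>) * P \<kappa> = 0" if "\<kappa> \<in> W L" for \<kappa> using dich[OF \<nu> that] that by blast
    then have "\<beta> (P \<nu>) = 0" using sum_mult_P[of "\<beta> (P \<nu>)" L] by simp
    then show False using nz[OF \<nu>] by simp
  qed
  then obtain s where s: "\<And>\<nu>. \<nu> \<in> W L \<Longrightarrow> s \<nu> \<in> W L \<and> \<beta> (P \<nu>) * P (s \<nu>) = P (s \<nu>)" by metis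
  \<comment> \<open>The images are nonzero and pairwise orthogonal, so distinct words choose
    distinct cylinders. There are as many words as cylinders, so each image consists of the chosen
    cylinder only.\<close>
  have inj: "inj_on s (W L)" using s orth by (metis inj_onI)
  then have bij: "bij_betw s (W L) (W L)"
    using endo_inj_surj[of "W L" s] s by (auto simp: bij_betw_def)
  have \<beta>P: "\<beta> (P \<nu>) = P (s \<nu>)" if \<nu>: "\<nu> \<in> W L" for \<nu>
  proof -
    have "\<beta> (P \<nu>) * P \<kappa> = (if \<kappa> = s \<nu> then P \<kappa> else 0)" if \<kappa>: "\<kappa> \<in> W L" for \<kappa>
    proof (cases "\<kappa> = s \<nu>")
      case False
      obtain \<nu>' where \<nu>': "\<nu>' \<in> W L" "\<kappa> = s \<nu>'" using bij \<kappa> by (auto simp: bij_betw_def)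
      then have "\<beta> (P \<nu>) * P \<kappa> \<noteq> P \<kappa>" using orth[OF \<nu> \<nu>'(1) \<kappa>] s[OF \<nu>'(1)] False by auto
      then show ?thesis using dich[OF \<nu> \<kappa>] False by auto
    qed (use s[OF \<nu>] in simp)
    then have "(\<Sum>\<kappa>\<in>W L. \<beta> (P \<nu>) * P \<kappa>) = P (s \<nu>)" using s[OF \<nu>] by simp
    then show ?thesis using sum_mult_P[of "\<beta> (P \<nu>)" L] by simp
  qed
  \<comment> \<open>\<open>permutes\<close> requires the identity outside
    \<open>W L\<close>.\<close>
  define \<sigma> where "\<sigma> \<nu> = (if \<nu> \<in> W L then s \<nu> else \<nu>)" for \<nu>
  have "bij_betw \<sigma> (W L) (W L)" using bij by (subst bij_betw_cong[of _ _ s]) (simp_all add: \<sigma>_def)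
  then have perm: "\<sigma> permutes W L" by (rule bij_imp_permutes) (simp add: \<sigma>_def)
  let ?u = "perm_unitary L \<sigma>"
  note u = unitary_perm_unitary[OF perm]
  have long: "\<beta> (P (\<nu> @ \<rho>)) = ?u * P (\<nu> @ \<rho>) * adj ?u" if \<nu>: "\<nu> \<in> W L" and \<rho>: "\<rho> \<in> W k" for \<nu> \<rho> k
  proof -
    have D: "(\<phi> ^^ (L - M)) (P \<rho>) \<in> \<D>" by (intro funpow_shift_diagonal P_in_diagonal[OF \<rho>])
    have e: "(\<phi> ^^ L) (P \<rho>) = (\<phi> ^^ M) ((\<phi> ^^ (L - M)) (P \<rho>))" using LM by (metis comp_apply funpow_add)
    have "\<beta> (P (\<nu> @ \<rho>)) = \<beta> (P \<nu>) * \<beta> ((\<phi> ^^ L) (P \<rho>))"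
      unfolding P_mult_funpow_shift[OF \<nu>, symmetric]
      by (rule \<beta>mult[OF P_in_diagonal[OF \<nu>] funpow_shift_diagonal[OF P_in_diagonal[OF \<rho>]]])
    also have "\<dots> = P (\<sigma> \<nu>) * (\<phi> ^^ L) (P \<rho>)" unfolding e fix_shift[OF D] using \<beta>P[OF \<nu>] \<nu> by (simp add: \<sigma>_def)
    also have "\<dots> = P (\<sigma> \<nu> @ \<rho>)" by (rule P_mult_funpow_shift) (use s[OF \<nu>] \<nu> in \<open>simp add: \<sigma>_def\<close>)
    also have "\<dots> = (?u * sw \<nu>) * P \<rho> * adj (?u * sw \<nu>)" by (simp only: perm_unitary_mult_sw[OF \<nu>] P_append)
    finally show ?thesis by (simp only: P_append adj_mult mult.assoc)
  qed
  have words: "\<beta> (P \<mu>) = ?u * P \<mu> * adj ?u" if \<mu>: "\<mu> \<in> W k" for \<mu> k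
  proof -
    \<comment> \<open>Words shorter than \<open>L\<close> have to be covered too: appending
      \<open>L\<close> letters to any word makes it long enough, and \<open>P \<mu>\<close> is the
      sum of these extensions.\<close>
    have "\<beta> (P (\<mu> @ \<tau>)) = ?u * P (\<mu> @ \<tau>) * adj ?u" if \<tau>: "\<tau> \<in> W L" for \<tau>
    proof -
      have w: "\<mu> @ \<tau> \<in> W (L + k)" using append_words[OF \<mu> \<tau>] by (simp add: add.commute)
      show ?thesis using long[OF take_words[OF w] drop_words[OF w]] by (simp only: append_take_drop_id)
    qed
    moreover have "\<beta> (P \<mu>) = (\<Sum>\<tau>\<in>W L. \<beta> (P (\<mu> @ \<tau>)))"
      by (subst P_extend[of _ L], rule star_hom_on_sum[OF cstar_subalgebra_diagonal \<beta>(1)])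
        (use append_words[OF \<mu>] P_in_diagonal in blast)
    ultimately have "\<beta> (P \<mu>) = ?u * (\<Sum>\<tau>\<in>W L. P (\<mu> @ \<tau>)) * adj ?u" by (simp add: sum_distrib_left sum_distrib_right)
    then show ?thesis by (simp only: P_extend[of \<mu> L, symmetric])
  qed
  have "\<beta> x = ?u * x * adj ?u" if "x \<in> \<D>" for x
  proof (rule diagonal_hom_agree[OF \<beta>(1,3) _ _ words that])
    have "isometry ?u" using u by (simp add: isometry_def unitary_def)
    then show "star_hom_on \<D> (\<lambda>x. ?u * x * adj ?u)"
      by (rule star_hom_on_subset[OF conj_hom subset_UNIV])
    show "?u * 1 * adj ?u = 1" using u by (simp add: unitary_def)
  qed
  then show ?thesis using perm by blast
qed

lemma block_mult:
  "(\<Sum>i=1..n. S i * a i * adj (S i)) * (\<Sum>i=1..n. S i * b i * adj (S i)) = (\<Sum>i=1..n. S i * (a i * b i) * adj (S i))"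
proof -
  have "(\<Sum>i=1..n. S i * a i * adj (S i)) * (\<Sum>i=1..n. S i * b i * adj (S i))
      = (\<Sum>i=1..n. \<Sum>j=1..n. S i * a i * (adj (S i) * S j) * b j * adj (S j))"
    by (simp add: sum_product mult.assoc)
  also have "\<dots> = (\<Sum>i=1..n. \<Sum>j=1..n. if j = i then S i * (a i * b i) * adj (S i) else 0)"
    by (intro sum.cong refl) (simp add: adj_S_mult_S mult.assoc)
  finally show ?thesis by simp
qed

end

context cuntz_generated begin

text \<open>Inverting twice by \<open>inv_into\<close> gives back \<alpha> on the diagonal only,
  where all arguments in property (P) lie.\<close>

lemma P_automorphism_inv:
  assumes "\<alpha> \<in> P_automorphisms n S"
  shows "inv_into \<D> \<alpha> \<in> P_automorphisms n S"
proof -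
  let ?\<alpha>' = "inv_into \<D> \<alpha>"
  have \<alpha>: "star_automorphism_on \<D> \<alpha>" "property_P n S \<alpha>" "property_P n S ?\<alpha>'"
    using assms by (auto simp: P_automorphisms_def)
  have inv_inv: "inv_into \<D> ?\<alpha>' x = \<alpha> x" if "x \<in> \<D>" for x
    using \<alpha>(1) that inv_into_inv_into_eq[of \<alpha> \<D> \<D> x] by (simp add: star_automorphism_on_def)
  have "property_P n S (inv_into \<D> ?\<alpha>')"
  proof -
    obtain m where m: "\<And>k x. k \<ge> m \<Longrightarrow> x \<in> diagonal_level n S 1 \<Longrightarrow>
        \<alpha> ((\<phi> ^^ k) x) = (\<phi> ^^ (k - m)) (\<alpha> ((\<phi> ^^ m) x))"
      using \<alpha>(2) unfolding property_P_def by blast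
    have D: "(\<phi> ^^ k) x \<in> \<D>" if "x \<in> diagonal_level n S 1" for k x
      by (rule funpow_shift_diagonal[OF subsetD[OF diagonal_level_subset that]])
    show ?thesis
      unfolding property_P_def
    proof (intro exI[of _ m] allI impI ballI)
      fix k x assume k: "m \<le> k" and x: "x \<in> diagonal_level n S 1"
      show "inv_into \<D> ?\<alpha>' ((\<phi> ^^ k) x) = (\<phi> ^^ (k - m)) (inv_into \<D> ?\<alpha>' ((\<phi> ^^ m) x))"
        unfolding inv_inv[OF D[OF x]] by (rule m[OF k x])
    qed
  qed
  then show ?thesis
    using \<alpha> star_automorphism_inv[OF cstar_subalgebra_diagonal \<alpha>(1)] by (simp add: P_automorphisms_def)
qed

text \<open>\<open>\<lambda>\<^sub>u\<close> extends \<open>\<alpha>\<close> iff \<open>Ad u\<close> extends \<open>\<beta> = \<alpha> \<circ> (\<Oplus>\<^sub>i Ad S\<^sub>i \<circ> \<alpha>\<^sup>-\<^sup>1 \<circ> Ad S\<^sub>i\<^sup>*)\<close>. Property (P) for \<open>\<alpha>\<close> and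
  \<open>\<alpha>\<^sup>-\<^sup>1\<close> makes \<open>\<beta>\<close> the identity on the range of a power of the shift.\<close>

theorem ex_permutation_unitary:
  assumes P_aut: "\<alpha> \<in> P_automorphisms n S"
  shows "\<exists>u\<in>permutation_unitaries n S. unitary u \<and> (\<forall>x\<in>\<D>. \<alpha> x = lam u x)"
proof -
  define \<alpha>' where "\<alpha>' = inv_into \<D> \<alpha>"
  have \<alpha>: "star_automorphism_on \<D> \<alpha>" "property_P n S \<alpha>" "property_P n S \<alpha>'"
    using P_aut by (auto simp: P_automorphisms_def \<alpha>'_def)
  have \<alpha>': "star_automorphism_on \<D> \<alpha>'"
    unfolding \<alpha>'_def by (rule star_automorphism_inv[OF cstar_subalgebra_diagonal \<alpha>(1)])
  have bij: "bij_betw \<alpha> \<D> \<D>" "bij_betw \<alpha>' \<D> \<D>" and hom: "star_hom_on \<D> \<alpha>" "star_hom_on \<D> \<alpha>'"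
    using \<alpha>(1) \<alpha>' by (auto simp: star_automorphism_on_def)
  have D: "\<alpha> x \<in> \<D>" "\<alpha>' x \<in> \<D>" "\<alpha> (\<alpha>' x) = x" "\<alpha>' (\<alpha> x) = x" if "x \<in> \<D>" for x
    using bij that bij_betw_inv_into_right[OF bij(1)] bij_betw_inv_into_left[OF bij(1)]
    unfolding \<alpha>'_def[symmetric] by (auto simp: bij_betw_apply)
  note one = star_automorphism_one[OF \<alpha>(1) one_in_diagonal] star_automorphism_one[OF \<alpha>' one_in_diagonal]
  obtain m where m: "\<And>j x. x \<in> \<D> \<Longrightarrow> \<alpha> ((\<phi> ^^ (m + j)) x) = (\<phi> ^^ j) (\<alpha> ((\<phi> ^^ m) x))"
    using property_P_diagonal[OF hom(1) D(1) one(1) \<alpha>(2)] by blast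
  obtain m' where m': "\<And>j x. x \<in> \<D> \<Longrightarrow> \<alpha>' ((\<phi> ^^ (m' + j)) x) = (\<phi> ^^ j) (\<alpha>' ((\<phi> ^^ m') x))"
    using property_P_diagonal[OF hom(2) D(2) one(2) \<alpha>(3)] by blast
  define \<psi> where "\<psi> x = (\<Sum>i=1..n. S i * \<alpha>' (adj (S i) * x * S i) * adj (S i))" for x
  define \<beta> where "\<beta> x = \<alpha> (\<psi> x)" for x
  have \<psi>D: "\<psi> x \<in> \<D>" if "x \<in> \<D>" for x
    unfolding \<psi>_def using that
    by (intro cstar_subalgebra_sum cstar_subalgebra_diagonal conj_diagonal D compress_diagonal) auto
  have comp: "star_hom_on \<D> (\<lambda>x. \<alpha>' (adj (S i) * x * S i))" if "i \<in> {1..n}" for i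
    by (rule star_hom_comp[OF compress_hom[OF that] compress_diagonal[OF that] hom(2)])
  have "star_hom_on \<D> \<psi>"
    unfolding star_hom_on_def
  proof (intro conjI ballI allI)
    fix x c assume x: "x \<in> \<D>"
    have sc: "\<alpha>' (adj (S i) * (c *\<^sub>C x) * S i) = c *\<^sub>C \<alpha>' (adj (S i) * x * S i)"
      "\<alpha>' (adj (S i) * adj x * S i) = adj (\<alpha>' (adj (S i) * x * S i))" if "i \<in> {1..n}" for i
      using comp[OF that] x unfolding star_hom_on_def by blast+
    show "\<psi> (c *\<^sub>C x) = c *\<^sub>C \<psi> x"
      unfolding \<psi>_def scaleC.scale_sum_right by (intro sum.cong refl) (simp only: sc(1)[unfolded mult_scaleC_left mult_scaleC_right] mult_scaleC_left mult_scaleC_right)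
    show "\<psi> (adj x) = adj (\<psi> x)"
      unfolding \<psi>_def adj_sum by (intro sum.cong refl) (simp only: sc(2)[unfolded mult.assoc] adj_mult adj_adj mult.assoc)
    fix y assume y: "y \<in> \<D>"
    have am: "\<alpha>' (adj (S i) * (x + y) * S i) = \<alpha>' (adj (S i) * x * S i) + \<alpha>' (adj (S i) * y * S i)"
      "\<alpha>' (adj (S i) * (x * y) * S i) = \<alpha>' (adj (S i) * x * S i) * \<alpha>' (adj (S i) * y * S i)" if "i \<in> {1..n}" for i
      using comp[OF that] x y unfolding star_hom_on_def by blast+
    show "\<psi> (x + y) = \<psi> x + \<psi> y"
      unfolding \<psi>_def sum.distrib[symmetric] by (intro sum.cong refl) (simp only: am(1)[unfolded distrib_left distrib_right] distrib_left distrib_right)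
    show "\<psi> (x * y) = \<psi> x * \<psi> y"
      unfolding \<psi>_def block_mult by (intro sum.cong refl) (simp only: am)
  qed
  then have \<beta>: "star_hom_on \<D> \<beta>" unfolding \<beta>_def by (rule star_hom_comp[OF _ \<psi>D hom(1)])
  have "\<psi> 1 = (\<Sum>i=1..n. S i * adj (S i))"
    unfolding \<psi>_def by (intro sum.cong refl) (simp add: one adj_S_mult_S)
  then have \<beta>1: "\<beta> 1 = 1" by (simp only: \<beta>_def ranges one)
  \<comment> \<open>The identity for which \<beta> was built: combined with \<beta> = Ad
    \<open>u\<close> it is the recursion \<open>lam_P_Cons\<close>, now satisfied by
    \<alpha>.\<close>
  have conj: "\<beta> (S i * \<alpha> x * adj (S i)) = \<alpha> (S i * x * adj (S i))" if i: "i \<in> {1..n}" and x: "x \<in> \<D>" for i x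
  proof -
    have "\<psi> (S i * \<alpha> x * adj (S i)) = (\<Sum>j=1..n. if j = i then S i * x * adj (S i) else 0)"
      unfolding \<psi>_def
    proof (intro sum.cong refl)
      fix j assume j: "j \<in> {1..n}"
      have "adj (S j) * (S i * \<alpha> x * adj (S i)) * S j = (adj (S j) * S i) * \<alpha> x * (adj (S i) * S j)"
        by (simp only: mult.assoc)
      also have "\<dots> = (if j = i then \<alpha> x else 0)" using i j by (simp add: adj_S_mult_S)
      finally show "S j * \<alpha>' (adj (S j) * (S i * \<alpha> x * adj (S i)) * S j) * adj (S j) = (if j = i then S i * x * adj (S i) else 0)"
        using D(4)[OF x] star_hom_on_zero[OF cstar_subalgebra_diagonal hom(2)] by simp
    qed
    then show ?thesis using i by (simp add: \<beta>_def)
  qed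
  \<comment> \<open>If \<beta> killed \<open>P \<mu>\<close>, then by injectivity of \<alpha> and
    its inverse every compression of \<open>P \<mu>\<close> by a generator would vanish, hence
    \<open>sw \<mu>\<close> as well.\<close>
  have nz: "\<beta> (P \<mu>) \<noteq> 0" if \<mu>: "\<mu> \<in> W k" for \<mu> k
  proof
    assume "\<beta> (P \<mu>) = 0"
    then have "\<alpha> (\<psi> (P \<mu>)) = \<alpha> 0" by (simp add: \<beta>_def star_hom_on_zero[OF cstar_subalgebra_diagonal hom(1)])
    then have z: "\<psi> (P \<mu>) = 0"
      using bij(1) \<psi>D[OF P_in_diagonal[OF \<mu>]] cstar_subalgebra_zero[OF cstar_subalgebra_diagonal]
      by (auto simp: bij_betw_def inj_on_def)
    have "adj (S i) * P \<mu> * S i = 0" if i: "i \<in> {1..n}" for i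
    proof -
      have "adj (S i) * \<psi> (P \<mu>) * S i = (\<Sum>j=1..n. (adj (S i) * S j) * \<alpha>' (adj (S j) * P \<mu> * S j) * (adj (S j) * S i))"
        unfolding \<psi>_def by (simp add: sum_distrib_left sum_distrib_right mult.assoc)
      also have "\<dots> = (\<Sum>j=1..n. if j = i then \<alpha>' (adj (S i) * P \<mu> * S i) else 0)"
        using i by (intro sum.cong refl) (simp add: adj_S_mult_S)
      finally have "\<alpha>' (adj (S i) * P \<mu> * S i) = 0" using i z by simp
      then show ?thesis
        using D(3)[OF compress_diagonal[OF i P_in_diagonal[OF \<mu>]]] star_hom_on_zero[OF cstar_subalgebra_diagonal hom(1)] by simp
    qed
    then have "(adj (S i) * sw \<mu>) * adj (adj (S i) * sw \<mu>) = 0" if "i \<in> {1..n}" for i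
      using that by (simp add: word_projection_def adj_mult adj_adj mult.assoc)
    then have "adj (S i) * sw \<mu> = 0" if "i \<in> {1..n}" for i
      using that adj_mult_self_eq_0_iff[of "adj (adj (S i) * sw \<mu>)"] by (simp add: adj_adj)
    then have "(\<Sum>i=1..n. S i * adj (S i)) * sw \<mu> = 0" by (simp add: sum_distrib_right mult.assoc)
    then have "sw \<mu> = 0" unfolding ranges by simp
    then show False using norm_sw[OF \<mu>] by simp
  qed
  \<comment> \<open>On shifted elements \<beta> satisfies \<beta> \<phi> = \<alpha> \<phi>
    \<alpha>'. The first \<open>m'\<close> shifts let \<alpha>' release the other \<open>m\<close>,
    and these let \<alpha> commute with \<phi>; the \<open>Suc\<close> is the shift absorbed by
    \<psi>.\<close>
  have fix_shift: "\<beta> ((\<phi> ^^ Suc (m' + m)) x) = (\<phi> ^^ Suc (m' + m)) x" if x: "x \<in> \<D>" for x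
  proof -
    define y where "y = (\<phi> ^^ (m' + m)) x"
    define z where "z = \<alpha>' ((\<phi> ^^ m') x)"
    have yD: "y \<in> \<D>" and zD: "z \<in> \<D>" using x by (auto simp: y_def z_def intro: funpow_shift_diagonal D)
    have yz: "\<alpha>' y = (\<phi> ^^ m) z" unfolding y_def z_def by (rule m'[OF x])
    have "\<psi> (\<phi> y) = (\<Sum>i=1..n. S i * \<alpha>' y * adj (S i))"
      unfolding \<psi>_def by (intro sum.cong refl) (simp add: compress_shift)
    then have "\<beta> (\<phi> y) = \<alpha> (\<phi> (\<alpha>' y))" by (simp add: \<beta>_def canonical_shift_def)
    also have "\<dots> = \<phi> (\<alpha> (\<alpha>' y))" unfolding yz using m[OF zD, of 1] by simp
    also have "\<dots> = \<phi> y" by (simp add: D(3)[OF yD])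
    finally show ?thesis by (simp add: y_def)
  qed
  have \<beta>D: "\<beta> x \<in> \<D>" if "x \<in> \<D>" for x unfolding \<beta>_def by (rule D(1)[OF \<psi>D[OF that]])
  have "\<exists>L \<sigma>. \<sigma> permutes W L \<and> (\<forall>x\<in>\<D>. \<beta> x = perm_unitary L \<sigma> * x * adj (perm_unitary L \<sigma>))"
    by (rule inner_permutation[OF \<beta> \<beta>D \<beta>1 _ fix_shift]) (assumption | erule nz)+
  then obtain L \<sigma> where \<sigma>: "\<sigma> permutes W L"
    and "\<forall>x\<in>\<D>. \<beta> x = perm_unitary L \<sigma> * x * adj (perm_unitary L \<sigma>)"
    by (elim exE conjE) (rule that)
  note u = bspec[OF this(2)]
  let ?u = "perm_unitary L \<sigma>"
  note unit = unitary_perm_unitary[OF \<sigma>]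
  note lam = cuntz_endomorphism[OF unit]
  have words: "\<alpha> (P \<mu>) = lam ?u (P \<mu>)" if "\<mu> \<in> W k" for \<mu> k
    using that
  proof (induction \<mu> arbitrary: k)
    case Nil
    then show ?case by (simp add: one lam)
  next
    case (Cons i \<mu>)
    then have i: "i \<in> {1..n}" and \<mu>: "\<mu> \<in> W (k - 1)" by (auto simp: words_def)
    note PD = P_in_diagonal[OF \<mu>]
    have "\<alpha> (P (i # \<mu>)) = \<beta> (S i * \<alpha> (P \<mu>) * adj (S i))" by (simp only: conj[OF i PD] P_Cons)
    also have "\<dots> = ?u * (S i * lam ?u (P \<mu>) * adj (S i)) * adj ?u"
      using u[OF conj_diagonal[OF i D(1)[OF PD]]] unfolding Cons.IH[OF \<mu>] .
    also have "\<dots> = lam ?u (P (i # \<mu>))" by (rule lam_P_Cons[OF unit i, symmetric])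
    finally show ?case .
  qed
  have "\<alpha> x = lam ?u x" if "x \<in> \<D>" for x
    by (rule diagonal_hom_agree[OF hom(1) one(1) star_hom_on_subset[OF lam(1) subset_UNIV] lam(2) words that])
  moreover have "?u \<in> permutation_unitaries n S"
    unfolding permutation_unitaries_def permutation_unitaries_level_def using \<sigma> by blast
  ultimately show ?thesis using unit by blast
qed

end

section \<open>The diagonal is maximal abelian\<close>

text \<open>Discrete orthogonality of characters, in place of integration over the circle; the bound
  on \<open>k\<close> excludes the nonzero multiples of \<open>L\<close>.\<close>

lemma sum_cis_roots:
  fixes k :: int
  assumes "\<bar>k\<bar> < int L"
  shows "(\<Sum>j<L. cis (2 * pi * real j / real L * of_int k)) = (if k = 0 then of_nat L else 0)"
proof (cases "k = 0")
  case False
  define r where "r = cis (2 * pi * of_int k / real L)"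
  have L: "L > 0" using assms by linarith
  have "cis (2 * pi * real j / real L * of_int k) = r ^ j" for j
    unfolding r_def Complex.DeMoivre by (rule arg_cong[of _ _ cis]) simp
  moreover have "r ^ L = 1" using L by (simp add: r_def Complex.DeMoivre)
  moreover have "r \<noteq> 1"
  proof
    assume "r = 1"
    then have "cos (2 * pi * of_int k / real L) = 1" by (metis cis.simps(1) one_complex.simps(1) r_def)
    then obtain m :: int where "2 * pi * of_int k / real L = of_int m * 2 * pi" using cos_one_2pi_int by blast
    then have "of_int k = real_of_int m * real L" using L by (simp add: field_simps)
    then have "k = m * int L" by (metis of_int_eq_iff of_int_mult of_int_of_nat_eq)
    then show False using assms False by (auto simp: abs_mult)
  qed
  ultimately show ?thesis using False geometric_sum[of r L] by simp
qed simp

text \<open>The coefficients of the Fejer kernel before normalization: a triangular weight, which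
  the truncated subtraction makes zero once \<bar>d\<bar> reaches \<open>N\<close>.\<close>

lemma card_shifted_pairs:
  fixes d :: int
  shows "(\<Sum>s<N. \<Sum>t<N. if int s - int t + d = 0 then 1 else 0) = real (N - nat \<bar>d\<bar>)"
proof -
  have "(\<Sum>t<N. if int s - int t + d = 0 then 1 else 0 :: real) = (if s \<in> {nat (- d)..<N - nat d} then 1 else 0)"
    if "s < N" for s
  proof -
    have "(\<Sum>t<N. if int s - int t + d = 0 then 1 else 0 :: real)
        = (\<Sum>t<N. if t = nat (int s + d) then (if 0 \<le> int s + d then 1 else 0) else 0)"
      by (intro sum.cong) auto
    also have "\<dots> = (if s \<in> {nat (- d)..<N - nat d} then 1 else 0)" using that by auto
    finally show ?thesis .
  qed
  then have "(\<Sum>s<N. \<Sum>t<N. if int s - int t + d = 0 then 1 else 0)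
      = (\<Sum>s<N. if s \<in> {nat (- d)..<N - nat d} then 1 else 0 :: real)" by (intro sum.cong) auto
  also have "\<dots> = (\<Sum>s\<in>{..<N} \<inter> {nat (- d)..<N - nat d}. 1)" by (rule sum.inter_restrict[symmetric]) simp
  also have "{..<N} \<inter> {nat (- d)..<N - nat d} = {nat (- d)..<N - nat d}" by auto
  finally show ?thesis by (cases "d \<ge> 0") auto
qed

context cuntz_family begin

section \<open>Gauge twists and Fejer means\<close>

abbreviation "homog d x \<equiv> homogeneous_pair n S S d x x"

lemma self_pair: "cuntz_pair n S S"
  by (rule cuntz_pair.intro[OF cuntz_family_axioms cuntz_family_axioms])

text \<open>The rescaled generators \<open>?T\<close> form another Cuntz family, and the twisted sum
  is the same polynomial evaluated there, so the comparison of two families applies.\<close>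

lemma norm_twist_le:
  assumes X: "\<And>d. homog d (X d)"
  shows "norm (\<Sum>d\<in>{-int D..int D}. cis (\<theta> * of_int d) *\<^sub>C X d) \<le> norm (\<Sum>d\<in>{-int D..int D}. X d)"
proof -
  let ?T = "\<lambda>i. cis \<theta> *\<^sub>C S i"
  have c: "cis \<theta> * cnj (cis \<theta>) = 1" "cnj (cis \<theta>) * cis \<theta> = 1" by (simp_all add: cis_cnj cis_mult)
  have fam: "cuntz_family n ?T"
  proof
    show "isometry (?T i)" if "i \<in> {1..n}" for i
      using isom[OF that] c by (simp add: isometry_def adj_scaleC mult_scaleC_left mult_scaleC_right scaleC_scaleC)
    show "(\<Sum>i=1..n. ?T i * adj (?T i)) = 1"
      using ranges c by (simp add: adj_scaleC mult_scaleC_left mult_scaleC_right scaleC_scaleC)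
  qed (rule two_le)
  interpret cuntz_pair n S ?T by (rule cuntz_pair.intro[OF cuntz_family_axioms fam])
  have sw_T: "word_isometry ?T \<mu> = cis (\<theta> * length \<mu>) *\<^sub>C sw \<mu>" for \<mu>
    by (induction \<mu>) (simp_all add: mult_scaleC_left mult_scaleC_right scaleC_scaleC cis_mult algebra_simps)
  have mat_T: "word_mat n ?T a b c = cis (\<theta> * of_int (int a - int b)) *\<^sub>C wmat a b c" for a b c
  proof -
    have "c \<mu> \<nu> *\<^sub>C (word_isometry ?T \<mu> * adj (word_isometry ?T \<nu>))
        = cis (\<theta> * of_int (int a - int b)) *\<^sub>C (c \<mu> \<nu> *\<^sub>C (sw \<mu> * adj (sw \<nu>)))"
      if "\<mu> \<in> W a" "\<nu> \<in> W b" for \<mu> \<nu>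
      using that
      by (simp add: sw_T length_words adj_scaleC mult_scaleC_left mult_scaleC_right scaleC_scaleC cis_cnj cis_mult algebra_simps)
    then show ?thesis unfolding word_mat_def scaleC.scale_sum_right by (intro sum.cong refl) simp
  qed
  have hom: "homogeneous_pair n S ?T d (X d) (cis (\<theta> * of_int d) *\<^sub>C X d)" for d
  proof -
    obtain a b c where abc: "int a - int b = d" "X d = wmat a b c"
      using X[of d] by (auto simp: homogeneous_pair_def)
    then show ?thesis unfolding homogeneous_pair_def using mat_T[of a b c] by metis
  qed
  show ?thesis
  proof (rule graded_norm_le, rule gradedI)
    \<comment> \<open>Components outside the window are set to zero, since \<open>X\<close> may be
      nonzero there.\<close>
    show "homogeneous_pair n S ?T d (if \<bar>d\<bar> \<le> int D then X d else 0)
        (if \<bar>d\<bar> \<le> int D then cis (\<theta> * of_int d) *\<^sub>C X d else 0)" for d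
      using hom hom_zero by simp
  qed (auto intro!: sum.cong)
qed

text \<open>By truncated subtraction only degrees with \<bar>d\<bar> less than \<open>N\<close>
  survive, however large the window \<open>D\<close> is.\<close>

definition fejer :: "nat \<Rightarrow> nat \<Rightarrow> (int \<Rightarrow> 'a) \<Rightarrow> 'a" where
  "fejer N D X = (\<Sum>d\<in>{-int D..int D}. (real (N - nat \<bar>d\<bar>) / real N) *\<^sub>R X d)"

text \<open>The Fejer mean is an average of twists over the roots of unity of order \<open>L\<close>, with the nonnegative
  weights \<open>|\<Sum>\<^sub>s z\<^sup>s|\<^sup>2 / (N L)\<close>.\<close>

lemma norm_fejer_le:
  assumes X: "\<And>d. homog d (X d)" and N: "N > 0"
  shows "norm (fejer N D X) \<le> norm (\<Sum>d\<in>{-int D..int D}. X d)"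
proof -
  let ?I = "{-int D..int D}"
  \<comment> \<open>The exponents \<open>s - t + d\<close> below have absolute value at most
    \<open>N - 1 + D\<close>, so roots of unity of this order detect exactly the exponent 0.\<close>
  define L where "L = N + D + 1"
  define \<theta> where "\<theta> j = 2 * pi * real j / real L" for j :: nat
  define K where "K j = (cmod (\<Sum>s<N. cis (\<theta> j * of_int (int s))))\<^sup>2" for j
  have K: "complex_of_real (K j) = (\<Sum>s<N. \<Sum>t<N. cis (\<theta> j * of_int (int s - int t)))" for j
  proof -
    have "complex_of_real (K j) = (\<Sum>s<N. cis (\<theta> j * of_int (int s))) * cnj (\<Sum>s<N. cis (\<theta> j * of_int (int s)))"
      unfolding K_def by (rule complex_norm_square)
    then show ?thesis by (simp add: sum_product cis_cnj cis_mult algebra_simps)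
  qed
  have coeff: "(\<Sum>j<L. complex_of_real (K j) * cis (\<theta> j * of_int d)) = of_nat L * of_real (real (N - nat \<bar>d\<bar>))"
    if d: "\<bar>d\<bar> \<le> int D" for d
  proof -
    have "(\<Sum>j<L. complex_of_real (K j) * cis (\<theta> j * of_int d))
        = (\<Sum>j<L. \<Sum>s<N. \<Sum>t<N. cis (\<theta> j * of_int (int s - int t + d)))"
      unfolding K sum_distrib_right cis_mult
      by (intro sum.cong refl arg_cong[of _ _ cis]) (simp add: algebra_simps)
    also have "\<dots> = (\<Sum>s<N. \<Sum>j<L. \<Sum>t<N. cis (\<theta> j * of_int (int s - int t + d)))" by (rule sum.swap)
    also have "\<dots> = (\<Sum>s<N. \<Sum>t<N. \<Sum>j<L. cis (\<theta> j * of_int (int s - int t + d)))"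
      by (intro sum.cong refl sum.swap)
    also have "\<dots> = (\<Sum>s<N. \<Sum>t<N. if int s - int t + d = 0 then of_nat L else 0)"
      unfolding \<theta>_def using d by (intro sum.cong refl sum_cis_roots) (auto simp: L_def)
    also have "\<dots> = of_nat L * of_real (\<Sum>s<N. \<Sum>t<N. if int s - int t + d = 0 then 1 else 0)"
      by (simp add: sum_distrib_left if_distrib cong: if_cong)
    finally show ?thesis unfolding card_shifted_pairs .
  qed
  have LN: "real L > 0" "real N > 0" using N by (auto simp: L_def)
  let ?p = "\<Sum>d\<in>?I. X d" and ?g = "\<lambda>j. \<Sum>d\<in>?I. cis (\<theta> j * of_int d) *\<^sub>C X d"
  have "complex_of_real (\<Sum>j<L. K j) = complex_of_real (real L * real N)" using coeff[of 0] by simp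
  then have sumK: "(\<Sum>j<L. K j) = real L * real N" by (simp only: of_real_eq_iff)
  have "(\<Sum>j<L. K j *\<^sub>R ?g j) = (\<Sum>d\<in>?I. (\<Sum>j<L. complex_of_real (K j) * cis (\<theta> j * of_int d)) *\<^sub>C X d)"
    unfolding scaleR_scaleC scaleC.scale_sum_right scaleC_scaleC scaleC.scale_sum_left by (rule sum.swap)
  also have "\<dots> = (\<Sum>d\<in>?I. (real L * real (N - nat \<bar>d\<bar>)) *\<^sub>R X d)"
  proof (intro sum.cong refl)
    fix d assume "d \<in> ?I"
    then have "\<bar>d\<bar> \<le> int D" by auto
    from coeff[OF this] show "(\<Sum>j<L. complex_of_real (K j) * cis (\<theta> j * of_int d)) *\<^sub>C X d = (real L * real (N - nat \<bar>d\<bar>)) *\<^sub>R X d"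
      by (simp add: scaleR_scaleC)
  qed
  also have "\<dots> = (real L * real N) *\<^sub>R fejer N D X"
    using LN by (simp add: fejer_def scaleR_sum_right)
  finally have "(real L * real N) * norm (fejer N D X) = norm (\<Sum>j<L. K j *\<^sub>R ?g j)"
    using LN by (simp add: abs_mult)
  also have "\<dots> \<le> (\<Sum>j<L. K j * norm ?p)"
  proof (intro sum_norm_le)
    fix j
    have "K j \<ge> 0" by (simp add: K_def)
    then show "norm (K j *\<^sub>R ?g j) \<le> K j * norm ?p"
      using norm_twist_le[OF X, where \<theta>="\<theta> j"] by (simp add: mult_left_mono)
  qed
  also have "\<dots> = (real L * real N) * norm ?p" by (simp add: sum_distrib_right[symmetric] sumK)
  finally show ?thesis using LN by (simp add: mult_le_cancel_left)
qed

lemma fejer_diff: "fejer N D X - fejer N D Y = fejer N D (\<lambda>d. X d - Y d)"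
  by (simp add: fejer_def sum_subtractf[symmetric] scaleR_diff_right)

section \<open>Pinching: the conditional expectation onto the commutant of level \<open>k\<close> of
  the diagonal\<close>

definition pinch :: "nat \<Rightarrow> 'a \<Rightarrow> 'a" where
  "pinch k x = (\<Sum>\<kappa>\<in>W k. P \<kappa> * x * P \<kappa>)"

lemma pinch_diff: "pinch k (x - y) = pinch k x - pinch k y"
  by (simp add: pinch_def algebra_simps sum_subtractf)

lemma pinch_sum: "pinch k (sum f A) = (\<Sum>i\<in>A. pinch k (f i))"
  unfolding pinch_def sum_distrib_left sum_distrib_right by (rule sum.swap)

lemma P_mult_self: "\<mu> \<in> W k \<Longrightarrow> P \<mu> * P \<mu> = P \<mu>"
  by (simp add: P_mult)

lemma norm_compress_P_le: "\<mu> \<in> W k \<Longrightarrow> norm (P \<mu> * x * P \<mu>) \<le> norm x"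
  using norm_mult_ineq[of "P \<mu> * x" "P \<mu>"] norm_mult_ineq[of "P \<mu>" x] by (simp add: norm_P)

lemma norm_pinch_le: "norm (pinch k x) \<le> norm x"
  unfolding pinch_def
proof (rule norm_orthogonal_sum_le)
  fix \<mu> \<nu> assume \<mu>: "\<mu> \<in> W k" and \<nu>: "\<nu> \<in> W k" and ne: "\<mu> \<noteq> \<nu>"
  have z: "P \<mu> * P \<nu> = 0" using P_mult[OF \<mu> \<nu>] ne by simp
  have "adj (P \<mu> * x * P \<mu>) * (P \<nu> * x * P \<nu>) = P \<mu> * adj x * (P \<mu> * P \<nu>) * x * P \<nu>"
    "P \<mu> * x * P \<mu> * adj (P \<nu> * x * P \<nu>) = P \<mu> * x * (P \<mu> * P \<nu>) * adj x * P \<nu>"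
    by (simp_all add: adj_mult mult.assoc)
  then show "adj (P \<mu> * x * P \<mu>) * (P \<nu> * x * P \<nu>) = 0" "P \<mu> * x * P \<mu> * adj (P \<nu> * x * P \<nu>) = 0"
    by (simp_all add: z)
qed (auto intro: norm_compress_P_le)

lemma pinch_mult_P:
  assumes \<mu>: "\<mu> \<in> W k"
  shows "pinch k x * P \<mu> = P \<mu> * x * P \<mu>"
proof -
  have "pinch k x * P \<mu> = (\<Sum>\<kappa>\<in>W k. if \<kappa> = \<mu> then P \<mu> * x * P \<mu> else 0)"
    unfolding pinch_def sum_distrib_right using \<mu> by (intro sum.cong refl) (auto simp: mult.assoc P_mult)
  then show ?thesis using \<mu> by simp
qed

text \<open>A pinched element and its adjoint commute with the cylinder projections of level
  \<open>k\<close>, hence so does their product, and the compressions reassemble it.\<close>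

lemma pinch_pinch: "pinch k (adj (pinch k x) * pinch k x) = adj (pinch k x) * pinch k x"
proof -
  have comm: "P \<mu> * pinch k x = P \<mu> * x * P \<mu>" if \<mu>: "\<mu> \<in> W k" for \<mu>
  proof -
    have "P \<mu> * pinch k x = (\<Sum>\<kappa>\<in>W k. if \<kappa> = \<mu> then P \<mu> * x * P \<mu> else 0)"
      unfolding pinch_def sum_distrib_left using \<mu> by (intro sum.cong refl) (auto simp: P_mult simp flip: mult.assoc)
    then show ?thesis using \<mu> by simp
  qed
  have comm_adj: "adj (pinch k x) * P \<mu> = P \<mu> * adj (pinch k x)" if \<mu>: "\<mu> \<in> W k" for \<mu>
    using arg_cong[OF trans[OF comm[OF \<mu>] pinch_mult_P[OF \<mu>, symmetric]], of adj] by (simp add: adj_mult)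
  have c: "P \<mu> * (adj (pinch k x) * pinch k x) * P \<mu> = adj (pinch k x) * pinch k x * P \<mu>" if \<mu>: "\<mu> \<in> W k" for \<mu>
  proof -
    have "P \<mu> * (adj (pinch k x) * pinch k x) * P \<mu> = (P \<mu> * adj (pinch k x)) * pinch k x * P \<mu>"
      by (simp only: mult.assoc)
    also have "\<dots> = adj (pinch k x) * (P \<mu> * pinch k x) * P \<mu>" unfolding comm_adj[OF \<mu>, symmetric] by (simp only: mult.assoc)
    also have "\<dots> = adj (pinch k x) * pinch k x * (P \<mu> * P \<mu>)"
      unfolding trans[OF comm[OF \<mu>] pinch_mult_P[OF \<mu>, symmetric]] by (simp only: mult.assoc)
    finally show ?thesis by (simp only: P_mult_self[OF \<mu>])
  qed
  have "pinch k (adj (pinch k x) * pinch k x) = (\<Sum>\<mu>\<in>W k. adj (pinch k x) * pinch k x * P \<mu>)"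
    by (subst pinch_def) (intro sum.cong refl c)
  then show ?thesis by (simp only: sum_mult_P[symmetric])
qed

lemma pinch_commutant:
  assumes "\<And>\<mu>. \<mu> \<in> W k \<Longrightarrow> x * P \<mu> = P \<mu> * x"
  shows "pinch k x = x"
proof -
  have "P \<mu> * x * P \<mu> = x * P \<mu>" if "\<mu> \<in> W k" for \<mu>
    using assms[OF that] P_mult_self[OF that] by (metis mult.assoc)
  then have "pinch k x = (\<Sum>\<mu>\<in>W k. x * P \<mu>)" unfolding pinch_def by (intro sum.cong refl)
  then show ?thesis by (simp only: sum_mult_P[symmetric])
qed

lemma homog_diff: "homog d x \<Longrightarrow> homog d y \<Longrightarrow> homog d (x - y)"
  using cuntz_pair.hom_add[OF self_pair, of d x x "(-1) *\<^sub>C y" "(-1) *\<^sub>C y"]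
    cuntz_pair.hom_scaleC[OF self_pair, of d y y "-1"]
  by (simp add: scaleC.scale_minus_left)

lemma homog_pinch:
  assumes "homog d x"
  shows "homog d (pinch k x)"
proof -
  interpret cuntz_pair n S S by (rule self_pair)
  have "homog 0 (P \<mu>)" if \<mu>: "\<mu> \<in> W k" for \<mu>
  proof -
    have "wmat k k (\<lambda>\<rho> \<tau>. if \<rho> = \<mu> then (if \<tau> = \<mu> then 1 else 0) else 0)
        = (\<Sum>\<rho>\<in>W k. \<Sum>\<tau>\<in>W k. if \<tau> = \<mu> then (if \<rho> = \<mu> then P \<mu> else 0) else 0)"
      unfolding word_mat_def by (intro sum.cong refl) (auto simp: word_projection_def)
    then have "P \<mu> = wmat k k (\<lambda>\<rho> \<tau>. if \<rho> = \<mu> then (if \<tau> = \<mu> then 1 else 0) else 0)" using \<mu> by simp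
    then show ?thesis unfolding homogeneous_pair_def by (metis diff_self)
  qed
  then have "homog d (P \<mu> * x * P \<mu>)" if "\<mu> \<in> W k" for \<mu>
    using hom_mult[OF hom_mult[OF _ assms]] that by fastforce
  then show ?thesis unfolding pinch_def by (rule hom_sum)
qed

lemma pinch_mat: "pinch k (wmat k k c) = diag_sum k (\<lambda>\<mu>. c \<mu> \<mu>)"
proof -
  have "P \<kappa> * wmat k k c * P \<kappa> = c \<kappa> \<kappa> *\<^sub>C P \<kappa>" if \<kappa>: "\<kappa> \<in> W k" for \<kappa>
  proof -
    have "P \<kappa> * wmat k k c * P \<kappa> = (\<Sum>\<mu>\<in>W k. \<Sum>\<nu>\<in>W k.
        c \<mu> \<nu> *\<^sub>C (sw \<kappa> * (adj (sw \<kappa>) * sw \<mu>) * (adj (sw \<nu>) * sw \<kappa>) * adj (sw \<kappa>)))"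
      by (simp add: word_mat_def word_projection_def sum_distrib_left sum_distrib_right
          mult_scaleC_left mult_scaleC_right mult.assoc)
    also have "\<dots> = (\<Sum>\<mu>\<in>W k. \<Sum>\<nu>\<in>W k. if \<nu> = \<kappa> then (if \<mu> = \<kappa> then c \<kappa> \<kappa> *\<^sub>C P \<kappa> else 0) else 0)"
      using \<kappa> by (intro sum.cong refl) (auto simp: sw_orth word_projection_def)
    finally show ?thesis using \<kappa> by simp
  qed
  then show ?thesis unfolding pinch_def by (intro sum.cong refl)
qed

text \<open>An element of degree 0 is a square matrix over words of some length; pinching at that
  length keeps its diagonal entries.\<close>

lemma homog_0_pinch:
  assumes "homog 0 z"
  shows "\<exists>k c. pinch k z = diag_sum k c"
proof -
  obtain a b c where "int a - int b = 0" "z = wmat a b c" using assms by (auto simp: homogeneous_pair_def)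
  then show ?thesis using pinch_mat by (metis eq_iff_diff_eq_0 of_nat_eq_iff)
qed

text \<open>Topologically: aperiodic words are dense, and at an aperiodic word an element of nonzero degree has
  no diagonal part.\<close>

lemma aperiodic_cylinder:
  assumes z: "homog d z" "d \<noteq> 0" and \<mu>: "\<mu> \<in> W j"
  shows "\<exists>k \<tau>. \<mu> @ \<tau> \<in> W (j + k) \<and> P (\<mu> @ \<tau>) * z * P (\<mu> @ \<tau>) = 0"
proof -
  obtain a b c where ab: "int a - int b = d" and zc: "z = wmat a b c"
    using z by (auto simp: homogeneous_pair_def)
  \<comment> \<open>The padding by \<open>a + b\<close> letters makes \<open>?\<mu>'\<close> longer
    than both \<open>\<rho>\<close> and \<open>\<tau>\<close>. The remainders then have lengths
    \<open>j + b\<close> and \<open>j + a\<close>, which differ since \<open>d\<close> is nonzero,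
    and \<open>M\<close> bounds both.\<close>
  define M where "M = j + a + b"
  let ?\<mu>' = "\<mu> @ replicate (a + b) 1" and ?\<kappa> = "replicate M 1 @ [2::nat]"
  have rep: "replicate (a + b) 1 \<in> W (a + b)" "?\<kappa> \<in> W (M + 1)" using two_le by (auto simp: words_def)
  have \<mu>': "?\<mu>' \<in> W (a + (j + b))" "?\<mu>' \<in> W (b + (j + a))" using append_words[OF \<mu> rep(1)] by (simp_all add: add_ac)
  have "adj (sw ?\<kappa>) * ((adj (sw ?\<mu>') * sw \<rho>) * (adj (sw \<tau>) * sw ?\<mu>')) * sw ?\<kappa> = 0"
    if \<rho>: "\<rho> \<in> W a" and \<tau>: "\<tau> \<in> W b" for \<rho> \<tau>
  proof -
    let ?\<alpha> = "drop a ?\<mu>'" and ?\<beta> = "drop b ?\<mu>'"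
    have w: "?\<alpha> \<in> W (j + b)" "?\<beta> \<in> W (j + a)" by (rule drop_words[OF \<mu>'(1)] drop_words[OF \<mu>'(2)])+
    have "j + b \<noteq> j + a" using ab z(2) by auto
    then have 0: "adj (sw ?\<kappa>) * (adj (sw ?\<alpha>) * sw ?\<beta>) * sw ?\<kappa> = 0"
      unfolding sw_eq_vec[OF w(1)] sw_eq_vec[OF w(2)] by (rule aperiodic_sandwich_vec) (simp_all add: M_def)
    have "adj (sw ?\<mu>') * sw \<rho> = adj (adj (sw \<rho>) * sw ?\<mu>')" by (simp add: adj_mult adj_adj)
    then have "adj (sw ?\<mu>') * sw \<rho> = adj (sw ?\<alpha>) \<or> adj (sw ?\<mu>') * sw \<rho> = 0"
      using adj_sw_mult_sw[OF \<rho> \<mu>'(1)] by auto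
    moreover have "adj (sw \<tau>) * sw ?\<mu>' = sw ?\<beta> \<or> adj (sw \<tau>) * sw ?\<mu>' = 0"
      using adj_sw_mult_sw[OF \<tau> \<mu>'(2)] by auto
    ultimately show ?thesis using 0 by (elim disjE) simp_all
  qed
  then have "(\<Sum>\<rho>\<in>W a. \<Sum>\<tau>\<in>W b. c \<rho> \<tau> *\<^sub>C
      (adj (sw ?\<kappa>) * ((adj (sw ?\<mu>') * sw \<rho>) * (adj (sw \<tau>) * sw ?\<mu>')) * sw ?\<kappa>)) = 0" by simp
  then have "adj (sw ?\<kappa>) * (adj (sw ?\<mu>') * z * sw ?\<mu>') * sw ?\<kappa> = 0"
    unfolding zc word_mat_def
    by (simp only: sum_distrib_left sum_distrib_right mult_scaleC_left mult_scaleC_right mult.assoc)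
  then have "adj (sw (?\<mu>' @ ?\<kappa>)) * z * sw (?\<mu>' @ ?\<kappa>) = 0"
    unfolding word_isometry_append[of S ?\<mu>'] adj_mult by (simp only: mult.assoc)
  then have "sw (?\<mu>' @ ?\<kappa>) * (adj (sw (?\<mu>' @ ?\<kappa>)) * z * sw (?\<mu>' @ ?\<kappa>)) * adj (sw (?\<mu>' @ ?\<kappa>)) = 0"
    by simp
  then have "P (?\<mu>' @ ?\<kappa>) * z * P (?\<mu>' @ ?\<kappa>) = 0" unfolding word_projection_def by (simp only: mult.assoc)
  moreover have "?\<mu>' @ ?\<kappa> \<in> W (j + (a + b + (M + 1)))"
    using append_words[OF append_words[OF \<mu> rep(1)] rep(2)] by (simp add: add_ac)
  ultimately show ?thesis unfolding append_assoc by blast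
qed

text \<open>A compression argument: \<open>z\<^sup>* z\<close> is close to a function on finitely many cylinders, and each cylinder
  contains one on which \<open>z\<close> is small.\<close>

lemma norm_offdiagonal_le:
  assumes z: "homog d z" "d \<noteq> 0" and close: "\<And>k. norm (z - pinch k z) \<le> e"
  shows "norm z \<le> 9 * e"
proof -
  have e: "e \<ge> 0" using close norm_ge_zero order_trans by blast
  let ?r = "norm z"
  have "homog 0 (adj z * z)"
    using cuntz_pair.hom_mult[OF self_pair cuntz_pair.hom_adj[OF self_pair z(1)] z(1)] by simp
  then obtain k c where kc: "pinch k (adj z * z) = diag_sum k c" using homog_0_pinch by blast
  let ?w = "pinch k z"
  have w: "norm ?w \<le> ?r" by (rule norm_pinch_le)
  have zw: "norm (adj z * z - adj ?w * ?w) \<le> 2 * ?r * e"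
  proof -
    have "adj z * z - adj ?w * ?w = adj z * (z - ?w) + adj (z - ?w) * ?w" by (simp add: algebra_simps adj_diff)
    also have "norm \<dots> \<le> norm (adj z * (z - ?w)) + norm (adj (z - ?w) * ?w)" by (rule norm_triangle_ineq)
    also have "\<dots> \<le> ?r * norm (z - ?w) + norm (z - ?w) * norm ?w"
      using norm_mult_ineq[of "adj z" "z - ?w"] norm_mult_ineq[of "adj (z - ?w)" ?w] by simp
    also have "\<dots> \<le> ?r * e + e * ?r" using close[of k] w e by (intro add_mono mult_mono) auto
    finally show ?thesis by (simp add: mult_ac)
  qed
  have "norm (diag_sum k c - adj ?w * ?w) \<le> 2 * ?r * e"
  proof -
    have "diag_sum k c - adj ?w * ?w = pinch k (adj z * z - adj ?w * ?w)" by (simp add: pinch_diff kc pinch_pinch)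
    then show ?thesis using norm_pinch_le[of k "adj z * z - adj ?w * ?w"] zw by simp
  qed
  then have d: "norm (diag_sum k c - adj z * z) \<le> 4 * ?r * e"
    using zw norm_triangle_ineq4[of "diag_sum k c - adj ?w * ?w" "adj z * z - adj ?w * ?w"] by simp
  have "norm (diag_sum k c) \<le> 4 * ?r * e + e\<^sup>2"
  proof (rule norm_diag_sum_le)
    fix \<mu> assume \<mu>: "\<mu> \<in> W k"
    obtain l \<tau> where \<tau>: "\<mu> @ \<tau> \<in> W (k + l)" and 0: "P (\<mu> @ \<tau>) * z * P (\<mu> @ \<tau>) = 0"
      using aperiodic_cylinder[OF z \<mu>] by blast
    let ?\<eta> = "\<mu> @ \<tau>"
    \<comment> \<open>The compression of \<open>z\<close> to this cylinder is zero, so there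
      \<open>z\<close> coincides with its defect from being pinched.\<close>
    have "z * P ?\<eta> = (z - pinch (k + l) z) * P ?\<eta>" by (simp add: left_diff_distrib pinch_mult_P[OF \<tau>] 0)
    then have "norm (z * P ?\<eta>) \<le> e"
      using norm_mult_ineq[of "z - pinch (k + l) z" "P ?\<eta>"] close[of "k + l"] norm_P[OF \<tau>] by simp
    then have "norm (adj (z * P ?\<eta>) * (z * P ?\<eta>)) \<le> e\<^sup>2"
      unfolding norm_adj_mult_self by (intro power_mono) auto
    then have 1: "norm (P ?\<eta> * (adj z * z) * P ?\<eta>) \<le> e\<^sup>2" by (simp add: adj_mult mult.assoc)
    have "diag_sum k c * P ?\<eta> = diag_sum k c * P \<mu> * P ?\<eta>" using P_mult_extension[OF \<mu>] by (simp add: mult.assoc)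
    also have "\<dots> = c \<mu> *\<^sub>C P ?\<eta>" by (simp add: diag_sum_mult_P[OF \<mu>] mult_scaleC_left P_mult_extension[OF \<mu>])
    finally have "P ?\<eta> * diag_sum k c * P ?\<eta> = c \<mu> *\<^sub>C P ?\<eta>"
      by (simp add: mult.assoc mult_scaleC_right P_mult_self[OF \<tau>])
    then have "cmod (c \<mu>) = norm (P ?\<eta> * diag_sum k c * P ?\<eta>)" by (simp add: norm_scaleC norm_P[OF \<tau>])
    also have "\<dots> = norm (P ?\<eta> * (diag_sum k c - adj z * z) * P ?\<eta> + P ?\<eta> * (adj z * z) * P ?\<eta>)"
      by (simp add: algebra_simps)
    also have "\<dots> \<le> norm (P ?\<eta> * (diag_sum k c - adj z * z) * P ?\<eta>) + norm (P ?\<eta> * (adj z * z) * P ?\<eta>)"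
      by (rule norm_triangle_ineq)
    also have "\<dots> \<le> 4 * ?r * e + e\<^sup>2"
      using norm_compress_P_le[OF \<tau>, of "diag_sum k c - adj z * z"] d 1 by linarith
    finally show "cmod (c \<mu>) \<le> 4 * ?r * e + e\<^sup>2" .
  qed (use e in simp)
  then have "norm (adj z * z) \<le> 8 * ?r * e + e\<^sup>2"
    using d norm_triangle_ineq4[of "diag_sum k c" "diag_sum k c - adj z * z"] by simp
  \<comment> \<open>The source of the 9: if \<open>?r\<close> exceeded \<open>9 * e\<close>, the
    right-hand side would be at most \<open>9 * ?r * e\<close>, which is then less than
    \<open>?r * ?r\<close>.\<close>
  then have le: "?r * ?r \<le> 8 * ?r * e + e * e" by (simp add: norm_adj_mult_self power2_eq_square)
  show ?thesis
  proof (rule ccontr)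
    assume "\<not> ?thesis"
    then have gt: "9 * e < ?r" by simp
    then have "?r * (9 * e) < ?r * ?r" using e by (intro mult_strict_left_mono) auto
    moreover have "e * e \<le> ?r * e" using gt e by (intro mult_right_mono) auto
    ultimately show False using le by (simp add: algebra_simps)
  qed
qed

end

section \<open>The commutant of the diagonal\<close>

context cuntz_generated begin

text \<open>Stated for every window \<open>M \<ge> D\<close>, so that two approximants of different
  degrees can be compared over one range.\<close>

lemma homog_approx:
  assumes "e > 0"
  obtains D X where "\<And>d. homog d (X d)" "\<And>d. \<bar>d\<bar> > int D \<Longrightarrow> X d = 0"
    "\<And>M. int D \<le> M \<Longrightarrow> norm (x - (\<Sum>d\<in>{-M..M}. X d)) < e"
proof -
  interpret cuntz_pair n S S by (rule self_pair)
  have "x \<in> closure {x. \<exists>D y. graded D x y}" using closure_graded[OF generates] by simp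
  then obtain y where "y \<in> {x. \<exists>D y. graded D x y}" "dist y x < e" using closure_approachable assms by metis
  then obtain D y' where y: "graded D y y'" "dist y x < e" by blast
  obtain X Y where X: "\<And>d. homogeneous_pair n S S d (X d) (Y d)" "\<And>d. \<bar>d\<bar> > int D \<Longrightarrow> X d = 0 \<and> Y d = 0"
    "\<And>M. int D \<le> M \<Longrightarrow> y = (\<Sum>d\<in>{-M..M}. X d) \<and> y' = (\<Sum>d\<in>{-M..M}. Y d)" using gradedE[OF y(1)] by metis
  have "X d = Y d" for d using X(1)[of d] by (auto simp: homogeneous_pair_def)
  then have "homog d (X d)" for d using X(1)[of d] by simp
  moreover have "norm (x - (\<Sum>d\<in>{-M..M}. X d)) < e" if "int D \<le> M" for M
    using X(3)[OF that] y(2) by (simp add: dist_norm norm_minus_commute)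
  ultimately show thesis using that X(2) by blast
qed

text \<open>The coarse approximant \<open>X1\<close> fixes the Fejer order \<open>N\<close>; only
  then is the accuracy \<delta> of the fine approximant \<open>X2\<close> chosen. Each nonzero
  degree of \<open>X2\<close> is small by \<open>norm_offdiagonal_le\<close>, and fewer than
  \<open>2 N\<close> of them survive in the mean, whatever the degree of \<open>X2\<close>. Degree 0
  is close to the diagonal by pinching.\<close>

theorem diagonal_maximal_abelian:
  assumes comm: "\<And>k \<mu>. \<mu> \<in> W k \<Longrightarrow> x * P \<mu> = P \<mu> * x"
  shows "x \<in> \<D>"
proof -
  have "\<exists>y\<in>\<D>. dist y x < e" if e: "e > 0" for e
  proof -
    define \<epsilon> where "\<epsilon> = e / 6"
    have \<epsilon>: "\<epsilon> > 0" using e by (simp add: \<epsilon>_def)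
    obtain D1 X1 where X1: "\<And>d. homog d (X1 d)" "\<And>d. \<bar>d\<bar> > int D1 \<Longrightarrow> X1 d = 0"
      "\<And>M. int D1 \<le> M \<Longrightarrow> norm (x - (\<Sum>d\<in>{-M..M}. X1 d)) < \<epsilon>" using homog_approx[OF \<epsilon>, of x] by metis
    \<comment> \<open>The Fejer mean lowers the weight of degree \<open>d\<close> by \<bar>d\<bar> /
      \<open>N\<close>, so it moves the coarse approximant by at most \<open>B / N\<close>.\<close>
    define B where "B = (\<Sum>d\<in>{-int D1..int D1}. of_int \<bar>d\<bar> * norm (X1 d))"
    obtain N0 :: nat where N0: "B / \<epsilon> < real N0" using reals_Archimedean2 by blast
    define N where "N = N0 + D1 + 1"
    have N: "N > 0" "B < \<epsilon> * real N" "D1 < N"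
      using N0 \<epsilon> by (auto simp: N_def field_simps) (smt (verit) mult_pos_pos of_nat_0_le_iff mult_nonneg_nonneg)
    \<comment> \<open>The budget of the last estimate: \<open>2 * \<delta>\<close> for degree 0, and
      \<open>18 * \<delta>\<close>, namely 9 times \<open>2 * \<delta>\<close>, for each of at most
      \<open>2 * N\<close> other degrees.\<close>
    define \<delta> where "\<delta> = \<epsilon> / (2 + 18 * (2 * real N))"
    have \<delta>: "\<delta> > 0" "\<delta> \<le> \<epsilon>" "\<delta> * (2 + 18 * (2 * real N)) = \<epsilon>"
      using \<epsilon> N by (auto simp: \<delta>_def field_simps)
    obtain D2 X2 where X2: "\<And>d. homog d (X2 d)" "\<And>d. \<bar>d\<bar> > int D2 \<Longrightarrow> X2 d = 0"
      "\<And>M. int D2 \<le> M \<Longrightarrow> norm (x - (\<Sum>d\<in>{-M..M}. X2 d)) < \<delta>" using homog_approx[OF \<delta>(1), of x] by metis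
    define D where "D = D1 + D2"
    let ?I = "{-int D..int D}"
    let ?p1 = "\<Sum>d\<in>?I. X1 d" and ?p2 = "\<Sum>d\<in>?I. X2 d"
    have p1: "norm (x - ?p1) < \<epsilon>" and p2: "norm (x - ?p2) < \<delta>"
      using X1(3)[of "int D"] X2(3)[of "int D"] by (simp_all add: D_def)
    have f1: "norm (?p1 - fejer N D X1) \<le> \<epsilon>"
    proof -
      have "?p1 - fejer N D X1 = (\<Sum>d\<in>?I. X1 d - (real (N - nat \<bar>d\<bar>) / real N) *\<^sub>R X1 d)"
        by (simp add: fejer_def sum_subtractf)
      also have "\<dots> = (\<Sum>d\<in>{-int D1..int D1}. X1 d - (real (N - nat \<bar>d\<bar>) / real N) *\<^sub>R X1 d)"
        using X1(2) by (intro sum.mono_neutral_right) (force simp: D_def)+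
      also have "norm \<dots> \<le> (\<Sum>d\<in>{-int D1..int D1}. of_int \<bar>d\<bar> * norm (X1 d) / real N)"
      proof (intro sum_norm_le)
        fix d assume "d \<in> {-int D1..int D1}"
        then have "nat \<bar>d\<bar> \<le> N" using N by auto
        then have "1 - real (N - nat \<bar>d\<bar>) / real N = of_int \<bar>d\<bar> / real N" using N by (simp add: field_simps of_nat_diff)
        moreover have "X1 d - (real (N - nat \<bar>d\<bar>) / real N) *\<^sub>R X1 d = (1 - real (N - nat \<bar>d\<bar>) / real N) *\<^sub>R X1 d"
          by (simp add: scaleR_diff_left)
        ultimately show "norm (X1 d - (real (N - nat \<bar>d\<bar>) / real N) *\<^sub>R X1 d) \<le> of_int \<bar>d\<bar> * norm (X1 d) / real N"
          by simp
      qed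
      also have "\<dots> = B / real N" by (simp add: B_def sum_divide_distrib)
      also have "\<dots> \<le> \<epsilon>" using N by (simp add: field_simps)
      finally show ?thesis .
    qed
    have f12: "norm (fejer N D X1 - fejer N D X2) \<le> 2 * \<epsilon>"
    proof -
      have "norm (fejer N D X1 - fejer N D X2) \<le> norm (\<Sum>d\<in>?I. X1 d - X2 d)"
        unfolding fejer_diff by (rule norm_fejer_le[OF homog_diff[OF X1(1) X2(1)] N(1)])
      also have "(\<Sum>d\<in>?I. X1 d - X2 d) = (x - ?p2) - (x - ?p1)" by (simp add: sum_subtractf)
      also have "norm \<dots> \<le> norm (x - ?p2) + norm (x - ?p1)" by (rule norm_triangle_ineq4)
      finally show ?thesis using p1 p2 \<delta> by simp
    qed
    \<comment> \<open>As \<open>x\<close> is fixed by pinching, \<open>?p2\<close> is nearly fixed;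
      the defect of one component is a component of the total defect and thus no larger.\<close>
    have pin: "norm (X2 d - pinch k (X2 d)) \<le> 2 * \<delta>" if d: "d \<in> ?I" for d k
    proof -
      have "norm (X2 d - pinch k (X2 d)) \<le> norm (\<Sum>d\<in>?I. X2 d - pinch k (X2 d))"
        by (rule cuntz_pair.graded_component_le[OF self_pair homog_diff[OF X2(1) homog_pinch[OF X2(1)]] d])
      also have "(\<Sum>d\<in>?I. X2 d - pinch k (X2 d)) = pinch k (x - ?p2) - (x - ?p2)"
        by (simp add: sum_subtractf pinch_diff pinch_sum pinch_commutant[OF comm])
      also have "norm \<dots> \<le> norm (pinch k (x - ?p2)) + norm (x - ?p2)" by (rule norm_triangle_ineq4)
      also have "\<dots> \<le> 2 * \<delta>" using norm_pinch_le[of k "x - ?p2"] p2 by simp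
      finally show ?thesis .
    qed
    obtain k c where kc: "pinch k (X2 0) = diag_sum k c" using homog_0_pinch[OF X2(1)] by blast
    let ?y = "diag_sum k c"
    have f2: "norm (fejer N D X2 - ?y) \<le> \<epsilon>"
    proof -
      let ?J = "{d\<in>?I - {0}. \<bar>d\<bar> < int N}"
      have "fejer N D X2 = X2 0 + (\<Sum>d\<in>?I - {0}. (real (N - nat \<bar>d\<bar>) / real N) *\<^sub>R X2 d)"
        unfolding fejer_def using N by (subst sum.remove[of _ 0]) auto
      also have "(\<Sum>d\<in>?I - {0}. (real (N - nat \<bar>d\<bar>) / real N) *\<^sub>R X2 d) = (\<Sum>d\<in>?J. (real (N - nat \<bar>d\<bar>) / real N) *\<^sub>R X2 d)"
        by (intro sum.mono_neutral_right) auto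
      finally have "norm (fejer N D X2 - ?y) = norm ((X2 0 - ?y) + (\<Sum>d\<in>?J. (real (N - nat \<bar>d\<bar>) / real N) *\<^sub>R X2 d))"
        by (simp add: algebra_simps)
      also have "\<dots> \<le> norm (X2 0 - ?y) + norm (\<Sum>d\<in>?J. (real (N - nat \<bar>d\<bar>) / real N) *\<^sub>R X2 d)"
        by (rule norm_triangle_ineq)
      also have "\<dots> \<le> 2 * \<delta> + (\<Sum>d\<in>?J. 18 * \<delta>)"
      proof (intro add_mono sum_norm_le)
        show "norm (X2 0 - ?y) \<le> 2 * \<delta>" using pin[of 0 k] by (simp add: kc)
        fix d assume d: "d \<in> ?J"
        have "norm (X2 d) \<le> 9 * (2 * \<delta>)"
          by (rule norm_offdiagonal_le[OF X2(1)]) (use d pin in auto)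
        moreover have "real (N - nat \<bar>d\<bar>) / real N * norm (X2 d) \<le> norm (X2 d)"
          using N by (intro mult_left_le_one_le) auto
        ultimately show "norm ((real (N - nat \<bar>d\<bar>) / real N) *\<^sub>R X2 d) \<le> 18 * \<delta>" by simp
      qed
      also have "\<dots> = 2 * \<delta> + real (card ?J) * (18 * \<delta>)" by simp
      also have "\<dots> \<le> 2 * \<delta> + (2 * real N) * (18 * \<delta>)"
      proof -
        have "card ?J \<le> card {-int N<..<int N}" by (intro card_mono) auto
        also have "\<dots> \<le> 2 * N" by simp
        finally have "real (card ?J) \<le> 2 * real N" by linarith
        then show ?thesis using \<delta> by (intro add_mono mult_right_mono) auto
      qed
      also have "\<dots> = \<epsilon>" using \<delta>(3) by (simp add: algebra_simps)
      finally show ?thesis .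
    qed
    have "norm (x - ?y) < 6 * \<epsilon>"
    proof -
      have "x - ?y = (x - ?p1) + (?p1 - fejer N D X1) + (fejer N D X1 - fejer N D X2) + (fejer N D X2 - ?y)" by simp
      also have "norm \<dots> \<le> norm (x - ?p1) + norm (?p1 - fejer N D X1) + norm (fejer N D X1 - fejer N D X2) + norm (fejer N D X2 - ?y)"
        by (meson norm_triangle_ineq add_right_mono order_trans)
      finally show ?thesis using p1 f1 f12 f2 \<epsilon> by linarith
    qed
    then show ?thesis
      using diag_sum_in_diagonal by (intro bexI[of _ ?y]) (auto simp: dist_norm norm_minus_commute \<epsilon>_def)
  qed
  then have "x \<in> closure \<D>" by (simp add: closure_approachable)
  then show ?thesis by (simp add: closure_closed[OF cstar_subalgebra_closed[OF cstar_subalgebra_diagonal]])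
qed

end

section \<open>Conclusion\<close>

lemma unitary_mult: "unitary u \<Longrightarrow> unitary v \<Longrightarrow> unitary (u * v)"
proof -
  assume uv: "unitary u" "unitary v"
  have "adj (u * v) * (u * v) = adj v * (adj u * u) * v" "(u * v) * adj (u * v) = u * (v * adj v) * adj u"
    by (simp_all add: adj_mult mult.assoc)
  then show ?thesis using uv by (simp add: unitary_def)
qed

lemma unitary_adj: "unitary u \<Longrightarrow> unitary (adj u)"
  by (simp add: unitary_def adj_adj)

lemma unitary_image:
  assumes "star_hom_on UNIV f" "f 1 = 1" "unitary u"
  shows "unitary (f u)"
  using assms(2,3) star_hom_UNIVD(2,4)[OF assms(1)] unfolding unitary_def by metis

context cuntz_generated begin

text \<open>Fixing \<open>P \<mu>\<close> means \<open>P \<mu> = v * P \<mu> * adj v\<close>, that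
  is, \<open>v\<close> commutes with all cylinder projections. Stated for any \<open>g\<close> with
  \<open>g (S i) = v * S i\<close>, so that it applies to compositions directly.\<close>

lemma bij_of_trivial_on_diagonal:
  assumes g: "star_hom_on UNIV g" "g 1 = 1" and v: "unitary v" "\<And>i. i \<in> {1..n} \<Longrightarrow> g (S i) = v * S i"
    and triv: "\<And>x. x \<in> \<D> \<Longrightarrow> g x = x"
  shows "bij g"
proof -
  have vv: "adj v * v = 1" "v * adj v = 1" using v by (simp_all add: unitary_def)
  have comm: "v * P \<mu> = P \<mu> * v" if \<mu>: "\<mu> \<in> W k" for \<mu> k
  proof (cases \<mu>)
    case (Cons i \<nu>)
    then have i: "i \<in> {1..n}" and \<nu>: "\<nu> \<in> W (k - 1)" using \<mu> by (auto simp: words_def)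
    have "P \<mu> = g (P \<mu>)" using triv[OF P_in_diagonal[OF \<mu>]] by simp
    also have "\<dots> = (v * S i) * g (P \<nu>) * adj (v * S i)"
      unfolding Cons P_Cons star_hom_UNIVD(2,4)[OF g(1)] v(2)[OF i] ..
    also have "\<dots> = v * P \<mu> * adj v"
      unfolding triv[OF P_in_diagonal[OF \<nu>]] Cons P_Cons adj_mult by (simp only: mult.assoc)
    finally have "P \<mu> * v = v * P \<mu> * (adj v * v)" by (metis mult.assoc)
    then show ?thesis by (simp add: vv)
  qed simp
  then have vD: "v \<in> \<D>" by (rule diagonal_maximal_abelian)
  note v' = unitary_adj[OF v(1)]
  let ?h = "lam (adj v)"
  note h = cuntz_endomorphism[OF v']
  have words: "?h (P \<mu>) = P \<mu>" if "\<mu> \<in> W k" for \<mu> k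
    using that
  proof (induction \<mu> arbitrary: k)
    case (Cons i \<mu>)
    then have i: "i \<in> {1..n}" and \<mu>: "\<mu> \<in> W (k - 1)" by (auto simp: words_def)
    have "?h (P (i # \<mu>)) = adj v * P (i # \<mu>) * v"
      by (simp only: lam_P_Cons[OF v' i] Cons.IH[OF \<mu>] P_Cons[of i \<mu>, symmetric] adj_adj)
    also have "\<dots> = adj v * v * P (i # \<mu>)" using comm[OF Cons.prems] by (simp only: mult.assoc)
    finally show ?case by (simp add: vv)
  qed (simp add: h)
  have "star_hom_on \<D> (\<lambda>x. x)" by (simp add: star_hom_on_def)
  then have hD: "?h x = x" if "x \<in> \<D>" for x
    using diagonal_hom_agree[OF star_hom_on_subset[OF h(1) subset_UNIV] h(2) _ _ words that] by simp
  have id: "star_hom_on UNIV (\<lambda>x. x)" by (simp add: star_hom_on_def)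
  \<comment> \<open>On generators \<open>?h (v * S i) = ?h v * adj v * S i\<close>, and
    \<open>?h\<close> fixes \<open>v\<close> because \<open>v\<close> lies in the diagonal; the
    other order uses that \<open>g\<close> fixes \<open>adj v\<close>.\<close>
  have "(\<lambda>x. ?h (g x)) = (\<lambda>x. x)"
    by (rule hom_ext[OF star_hom_comp[OF g(1) UNIV_I h(1)] _ id])
      (simp_all add: g h v star_hom_UNIVD[OF h(1)] hD[OF vD] vv flip: mult.assoc)
  moreover have "(\<lambda>x. g (?h x)) = (\<lambda>x. x)"
    by (rule hom_ext[OF star_hom_comp[OF h(1) UNIV_I g(1)] _ id])
      (simp_all add: g h v star_hom_UNIVD[OF g(1)] triv[OF vD] vv flip: mult.assoc)
  ultimately show ?thesis by (intro o_bij[of ?h]) (auto simp: fun_eq_iff)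
qed

text \<open>\<open>u\<close> comes from the existence theorem applied to the inverse of \<alpha>.
  Both compositions of \<open>lam w\<close> with \<open>lam u\<close> are trivial on the diagonal,
  hence bijective; one order makes \<open>lam w\<close> injective, the other surjective. Their
  unitaries arise from \<open>lam u (w * S i) = lam u w * u * S i\<close> and the same with
  \<open>u\<close> and \<open>w\<close> exchanged.\<close>

theorem automorphism_of_P_automorphism:
  assumes \<alpha>: "\<alpha> \<in> P_automorphisms n S" and w: "unitary w" and eq: "\<And>x. x \<in> \<D> \<Longrightarrow> lam w x = \<alpha> x"
  shows "star_automorphism_on UNIV (lam w)"
proof -
  let ?\<alpha>' = "inv_into \<D> \<alpha>"
  have bij: "bij_betw \<alpha> \<D> \<D>" using \<alpha> by (simp add: P_automorphisms_def star_automorphism_on_def)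
  obtain u where u: "unitary u" and eq': "\<And>x. x \<in> \<D> \<Longrightarrow> ?\<alpha>' x = lam u x"
    using ex_permutation_unitary[OF P_automorphism_inv[OF \<alpha>]] by metis
  note lw = cuntz_endomorphism[OF w] and lu = cuntz_endomorphism[OF u]
  have D: "\<alpha> x \<in> \<D>" "?\<alpha>' x \<in> \<D>" "\<alpha> (?\<alpha>' x) = x" "?\<alpha>' (\<alpha> x) = x" if "x \<in> \<D>" for x
    using that bij bij_betw_inv_into[OF bij] bij_betw_inv_into_right[OF bij] bij_betw_inv_into_left[OF bij]
    by (auto simp: bij_betw_apply)
  have "bij (\<lambda>x. lam u (lam w x))"
  proof (rule bij_of_trivial_on_diagonal[OF star_hom_comp[OF lw(1) UNIV_I lu(1)]])
    show "unitary (lam u w * u)" by (rule unitary_mult[OF unitary_image[OF lu(1,2) w] u])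
    show "lam u (lam w (S i)) = lam u w * u * S i" if "i \<in> {1..n}" for i
      using that by (simp only: lw lu star_hom_UNIVD[OF lu(1)] mult.assoc)
    show "lam u (lam w x) = x" if "x \<in> \<D>" for x
      using eq[OF that] eq'[OF D(1)[OF that]] D(4)[OF that] by simp
  qed (simp add: lw lu)
  moreover have "bij (\<lambda>x. lam w (lam u x))"
  proof (rule bij_of_trivial_on_diagonal[OF star_hom_comp[OF lu(1) UNIV_I lw(1)]])
    show "unitary (lam w u * w)" by (rule unitary_mult[OF unitary_image[OF lw(1,2) u] w])
    show "lam w (lam u (S i)) = lam w u * w * S i" if "i \<in> {1..n}" for i
      using that by (simp only: lw lu star_hom_UNIVD[OF lw(1)] mult.assoc)
    show "lam w (lam u x) = x" if "x \<in> \<D>" for x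
      using eq'[OF that] eq[OF D(2)[OF that]] D(3)[OF that] by simp
  qed (simp add: lw lu)
  ultimately have "bij (lam w)"
    by (metis (no_types, lifting) bijI bij_is_inj bij_is_surj injD injI surjD surjI surj_def)
  then show ?thesis using lw(1) by (simp add: star_automorphism_on_def)
qed

end

theorem theorem3p6:
  fixes n :: nat and S :: "nat \<Rightarrow> 'a::cstar_algebra" and \<alpha> :: "'a \<Rightarrow> 'a"
  assumes "n \<ge> 2"
    and "cuntz_algebra n S"
    and "\<alpha> \<in> P_automorphisms n S"
  shows "(\<exists>u\<in>permutation_unitaries n S. \<forall>x\<in>diagonal n S. \<alpha> x = cuntz_endomorphism n S u x) \<and>
    (\<forall>w. unitary w \<and> (\<forall>x\<in>diagonal n S. cuntz_endomorphism n S w x = \<alpha> x) \<longrightarrow>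
       star_automorphism_on UNIV (cuntz_endomorphism n S w))"
proof -
  interpret cuntz_generated n S
    using assms(1,2) by unfold_locales (simp_all add: cuntz_algebra_def)
  show ?thesis
    using ex_permutation_unitary[OF assms(3)] automorphism_of_P_automorphism[OF assms(3)] by blast
qed

end
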